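(* Let $n\ge 1$ and let $\mathcal{B}$ be a strict 2-category. A $\mathbb{1}$-parametric $n$-fold distributive law in $\mathcal{B}$, i.e. a strict 2-functor $\mathcal{D}:\mathbf{mnd}^n(\mathbb{1})\to\mathcal{B}$, is given by precisely the following data: 1. a 0-cell $a$ of $\mathcal{B}$; 2. 1-cells $t_1,\dots,t_n:a\to a$; 3. 2-cells $\eta^i:\mathbf{Id}_a\to t_i$ and $\mu^i:t_i\cdot t_i\to t_i$ for $1\le i\le n$, making each $t_i$ a monad on $a$; 4. 2-cells $\sigma_{i,j}:t_i\cdot t_j\to t_j\cdot t_i$ for $1\le i<j\le n$ which are distributive laws and which satisfy the Yang-Baxter equation $$(t_k\cdot\sigma_{i,j})\circ(\sigma_{i,k}\cdot t_j)\circ(t_i\cdot\sigma_{j,k}) = (\sigma_{j,k}\cdot t_i)\circ(t_j\cdot\sigma_{i,k})\circ(\sigma_{i,j}\cdot t_k)$$ for all $1\le i<j<k\le n$.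
   Context: $\circ$ is vertical and $\cdot$ is horizontal composition; a 1-cell in a composite of 2-cells denotes its identity 2-cell. $\mathbb{1}$ is the terminal 2-category. $\Delta_\alpha$ is the augmented simplex category (finite totally ordered sets, including the empty one, and monotone maps), with its strict monoidal structure given by ordinal sum. $\mathbb{B}\Delta_\alpha$ is its delooping: the strict 2-category with one object $*$, with 1-cells the objects of $\Delta_\alpha$, 2-cells its morphisms, and horizontal composition the ordinal sum. For a strict 2-category $\mathcal{C}$, $\mathbf{mnd}(\mathcal{C}):=\mathcal{C}\otimes_l\mathbb{B}\Delta_\alpha$, and $\mathbf{mnd}^n$ is the $n$-fold iterate. The lax Gray tensor product $\mathcal{B}\otimes_l\mathcal{C}$ of strict 2-categories is the strict 2-category with the following description. - Objects are pairs $(b,c)$. - 1-cells are generated under composition by $(f,\mathbf{Id})$ and $(\mathbf{Id},g)$, with $f$ a 1-cell of $\mathcal{B}$ and $g$ a 1-cell of $\mathcal{C}$, subject to $(f_1,\mathbf{Id})\cdot(f_2,\mathbf{Id})=(f_1\cdot f_2,\mathbf{Id})$, $(\mathbf{Id},g_1)\cdot(\mathbf{Id},g_2)=(\mathbf{Id},g_1\cdot g_2)$, and $(\mathbf{Id},\mathbf{Id})$ being the identity. - 2-cells are generated under horizontal and vertical composition by $(\phi,\mathbf{Id})$ and $(\mathbf{Id},\psi)$, for 2-cells $\phi$ of $\mathcal{B}$ and $\psi$ of $\mathcal{C}$, and by $\gamma_{f,g}:(f,\mathbf{Id})\cdot(\mathbf{Id},g)\to(\mathbf{Id},g)\cdot(f,\mathbf{Id})$.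 The 2-cells are subject to these relations: - $(-,\mathbf{Id})$ and $(\mathbf{Id},-)$ respect vertical and horizontal composition and identities; - $\gamma_{f,\mathbf{Id}}$ and $\gamma_{\mathbf{Id},g}$ are identities; - $\gamma_{(f_1\cdot f_2),g}=(\gamma_{f_1,g}\cdot(f_2,\mathbf{Id}))\circ((f_1,\mathbf{Id})\cdot\gamma_{f_2,g})$; - $\gamma_{f,(g_1\cdot g_2)}=((\mathbf{Id},g_1)\cdot\gamma_{f,g_2})\circ(\gamma_{f,g_1}\cdot(\mathbf{Id},g_2))$; - $\gamma_{f_2,g_2}\circ((\phi,\mathbf{Id})\cdot(\mathbf{Id},\psi))=((\mathbf{Id},\psi)\cdot(\phi,\mathbf{Id}))\circ\gamma_{f_1,g_1}$ for $\phi:f_1\to f_2$, $\psi:g_1\to g_2$. A monad on $a$ is $(t,\eta,\mu)$ with $\mu\circ(\eta\cdot t)=\mathbf{Id}_t=\mu\circ(t\cdot\eta)$ and $\mu\circ(\mu\cdot t)=\mu\circ(t\cdot\mu)$. A 2-cell $\sigma:s\cdot t\to t\cdot s$ between monads $(s,\eta^s,\mu^s)$ and $(t,\eta^t,\mu^t)$ on $a$ is a distributive law if - $\sigma\circ(\eta^s\cdot t)=t\cdot\eta^s$; - $\sigma\circ(s\cdot\eta^t)=\eta^t\cdot s$; - $\sigma\circ(\mu^s\cdot t)=(t\cdot\mu^s)\circ(\sigma\cdot s)\circ(s\cdot\sigma)$; - $\sigma\circ(s\cdot\mu^t)=(\mu^t\cdot s)\circ(t\cdot\sigma)\circ(\sigma\cdot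 t)$. For $\sigma_{i,j}$ take $s=t_i$, $t=t_j$. In the correspondence, $t_i$, $\eta^i$, $\mu^i$ are the images of the one-element ordinal $[0]$ and of the maps $[-1]\to[0]$, $[1]\to[0]$ in the $i$-th copy of $\mathbb{B}\Delta_\alpha$ (where $[k]$ is the ordinal with $k+1$ elements), and $\sigma_{i,j}$ is the image of the swap 2-cell $\gamma$ of $[0]$ in the $i$-th copy and $[0]$ in the $j$-th copy. *)

theory Defs
  imports "HOL-Library.Countable_Set" "HOL-Library.FuncSet"
begin

section \<open>Strict 2-categories and strict 2-functors\<close>

text \<open>All compositions are written in applicative order: in \<open>f \<cdot> g\<close>, \<open>\<alpha> \<star> \<beta>\<close> (horizontal)
  and \<open>\<alpha> \<bullet> \<beta>\<close> (vertical) the right-hand factor comes first.\<close>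

record ('o, 'm, 'c) two_cat =
  cell0 :: "'o set"
  cell1 :: "'m set"
  cell2 :: "'c set"
  src1 :: "'m \<Rightarrow> 'o"
  tgt1 :: "'m \<Rightarrow> 'o"
  src2 :: "'c \<Rightarrow> 'm"
  tgt2 :: "'c \<Rightarrow> 'm"
  id1 :: "'o \<Rightarrow> 'm"  ("\<one>\<index>")
  comp1 :: "'m \<Rightarrow> 'm \<Rightarrow> 'm"  (infixl "\<cdot>\<index>" 70)
  id2 :: "'m \<Rightarrow> 'c"  ("\<iota>\<index>")
  vcomp :: "'c \<Rightarrow> 'c \<Rightarrow> 'c"  (infixl "\<bullet>\<index>" 65)
  hcomp :: "'c \<Rightarrow> 'c \<Rightarrow> 'c"  (infixl "\<star>\<index>" 70)

definition hom1 :: "('o, 'm, 'c) two_cat \<Rightarrow> 'o \<Rightarrow> 'o \<Rightarrow> 'm set" where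
  "hom1 C a b = {f \<in> cell1 C. src1 C f = a \<and> tgt1 C f = b}"

definition hom2 :: "('o, 'm, 'c) two_cat \<Rightarrow> 'm \<Rightarrow> 'm \<Rightarrow> 'c set" where
  "hom2 C f g = {\<alpha> \<in> cell2 C. src2 C \<alpha> = f \<and> tgt2 C \<alpha> = g}"

locale strict_2_category =
  fixes C :: "('o, 'm, 'c) two_cat" (structure)
  assumes src1_closed: "f \<in> cell1 C \<Longrightarrow> src1 C f \<in> cell0 C"
    and tgt1_closed: "f \<in> cell1 C \<Longrightarrow> tgt1 C f \<in> cell0 C"
    and src2_closed: "\<alpha> \<in> cell2 C \<Longrightarrow> src2 C \<alpha> \<in> cell1 C"
    and tgt2_closed: "\<alpha> \<in> cell2 C \<Longrightarrow> tgt2 C \<alpha> \<in> cell1 C"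
    and src_globular: "\<alpha> \<in> cell2 C \<Longrightarrow> src1 C (src2 C \<alpha>) = src1 C (tgt2 C \<alpha>)"
    and tgt_globular: "\<alpha> \<in> cell2 C \<Longrightarrow> tgt1 C (src2 C \<alpha>) = tgt1 C (tgt2 C \<alpha>)"
    and id1_hom: "a \<in> cell0 C \<Longrightarrow> \<one> a \<in> hom1 C a a"
    and comp1_hom: "f \<in> hom1 C b c \<Longrightarrow> g \<in> hom1 C a b \<Longrightarrow> f \<cdot> g \<in> hom1 C a c"
    and comp1_assoc: "f \<in> hom1 C c d \<Longrightarrow> g \<in> hom1 C b c \<Longrightarrow> h \<in> hom1 C a b \<Longrightarrow>
      (f \<cdot> g) \<cdot> h = f \<cdot> (g \<cdot> h)"
    and comp1_unit_left: "f \<in> hom1 C a b \<Longrightarrow> \<one> b \<cdot> f = f"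
    and comp1_unit_right: "f \<in> hom1 C a b \<Longrightarrow> f \<cdot> \<one> a = f"
    and id2_hom: "f \<in> cell1 C \<Longrightarrow> \<iota> f \<in> hom2 C f f"
    and vcomp_hom: "\<alpha> \<in> hom2 C g h \<Longrightarrow> \<beta> \<in> hom2 C f g \<Longrightarrow> \<alpha> \<bullet> \<beta> \<in> hom2 C f h"
    and vcomp_assoc: "\<alpha> \<in> hom2 C h k \<Longrightarrow> \<beta> \<in> hom2 C g h \<Longrightarrow> \<gamma> \<in> hom2 C f g \<Longrightarrow>
      (\<alpha> \<bullet> \<beta>) \<bullet> \<gamma> = \<alpha> \<bullet> (\<beta> \<bullet> \<gamma>)"
    and vcomp_unit_left: "\<alpha> \<in> hom2 C f g \<Longrightarrow> \<iota> g \<bullet> \<alpha> = \<alpha>"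
    and vcomp_unit_right: "\<alpha> \<in> hom2 C f g \<Longrightarrow> \<alpha> \<bullet> \<iota> f = \<alpha>"
    and hcomp_hom: "\<alpha> \<in> hom2 C f f' \<Longrightarrow> \<beta> \<in> hom2 C g g' \<Longrightarrow> src1 C f = tgt1 C g \<Longrightarrow>
      \<alpha> \<star> \<beta> \<in> hom2 C (f \<cdot> g) (f' \<cdot> g')"
    and hcomp_assoc: "\<alpha> \<in> hom2 C f f' \<Longrightarrow> \<beta> \<in> hom2 C g g' \<Longrightarrow> \<gamma> \<in> hom2 C h h' \<Longrightarrow>
      src1 C f = tgt1 C g \<Longrightarrow> src1 C g = tgt1 C h \<Longrightarrow> (\<alpha> \<star> \<beta>) \<star> \<gamma> = \<alpha> \<star> (\<beta> \<star> \<gamma>)"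
    and hcomp_unit_left: "\<alpha> \<in> hom2 C f g \<Longrightarrow> f \<in> hom1 C a b \<Longrightarrow> \<iota> (\<one> b) \<star> \<alpha> = \<alpha>"
    and hcomp_unit_right: "\<alpha> \<in> hom2 C f g \<Longrightarrow> f \<in> hom1 C a b \<Longrightarrow> \<alpha> \<star> \<iota> (\<one> a) = \<alpha>"
    and hcomp_id2: "f \<in> hom1 C b c \<Longrightarrow> g \<in> hom1 C a b \<Longrightarrow> \<iota> f \<star> \<iota> g = \<iota> (f \<cdot> g)"
    and interchange: "\<alpha> \<in> hom2 C f' f'' \<Longrightarrow> \<beta> \<in> hom2 C f f' \<Longrightarrow>
      \<gamma> \<in> hom2 C g' g'' \<Longrightarrow> \<delta> \<in> hom2 C g g' \<Longrightarrow> src1 C f = tgt1 C g \<Longrightarrow>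
      (\<alpha> \<bullet> \<beta>) \<star> (\<gamma> \<bullet> \<delta>) = (\<alpha> \<star> \<gamma>) \<bullet> (\<beta> \<star> \<delta>)"

record ('o, 'm, 'c, 'p, 'n, 'd) two_fun =
  map0 :: "'o \<Rightarrow> 'p"
  map1 :: "'m \<Rightarrow> 'n"
  map2 :: "'c \<Rightarrow> 'd"

text \<open>The component maps are extensional (\<open>\<rightarrow>\<^sub>E\<close>), so that 2-functors agreeing on all cells
  are equal.\<close>

definition strict_2_functors ::
  "('o, 'm, 'c) two_cat \<Rightarrow> ('p, 'n, 'd) two_cat \<Rightarrow> ('o, 'm, 'c, 'p, 'n, 'd) two_fun set" where
  "strict_2_functors A B = {F.
     map0 F \<in> cell0 A \<rightarrow>\<^sub>E cell0 B \<and>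
     map1 F \<in> cell1 A \<rightarrow>\<^sub>E cell1 B \<and>
     map2 F \<in> cell2 A \<rightarrow>\<^sub>E cell2 B \<and>
     (\<forall>f \<in> cell1 A. src1 B (map1 F f) = map0 F (src1 A f) \<and>
                    tgt1 B (map1 F f) = map0 F (tgt1 A f)) \<and>
     (\<forall>\<alpha> \<in> cell2 A. src2 B (map2 F \<alpha>) = map1 F (src2 A \<alpha>) \<and>
                    tgt2 B (map2 F \<alpha>) = map1 F (tgt2 A \<alpha>)) \<and>
     (\<forall>a \<in> cell0 A. map1 F (id1 A a) = id1 B (map0 F a)) \<and>
     (\<forall>f \<in> cell1 A. \<forall>g \<in> cell1 A. src1 A f = tgt1 A g \<longrightarrow>
        map1 F (comp1 A f g) = comp1 B (map1 F f) (map1 F g)) \<and>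
     (\<forall>f \<in> cell1 A. map2 F (id2 A f) = id2 B (map1 F f)) \<and>
     (\<forall>\<alpha> \<in> cell2 A. \<forall>\<beta> \<in> cell2 A. src2 A \<alpha> = tgt2 A \<beta> \<longrightarrow>
        map2 F (vcomp A \<alpha> \<beta>) = vcomp B (map2 F \<alpha>) (map2 F \<beta>)) \<and>
     (\<forall>\<alpha> \<in> cell2 A. \<forall>\<beta> \<in> cell2 A. src1 A (src2 A \<alpha>) = tgt1 A (src2 A \<beta>) \<longrightarrow>
        map2 F (hcomp A \<alpha> \<beta>) = hcomp B (map2 F \<alpha>) (map2 F \<beta>))}"

definition terminal_2cat :: "(unit, unit, unit) two_cat" where
  "terminal_2cat = \<lparr>
     cell0 = UNIV, cell1 = UNIV, cell2 = UNIV,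
     src1 = (\<lambda>_. ()), tgt1 = (\<lambda>_. ()), src2 = (\<lambda>_. ()), tgt2 = (\<lambda>_. ()),
     id1 = (\<lambda>_. ()), comp1 = (\<lambda>_ _. ()),
     id2 = (\<lambda>_. ()), vcomp = (\<lambda>_ _. ()), hcomp = (\<lambda>_ _. ())\<rparr>"


section \<open>The delooping of the augmented simplex category\<close>

text \<open>\<open>\<Delta>\<^sub>\<alpha>\<close> in skeletal form: the natural number \<open>m\<close> stands for the ordinal \<open>{0..<m}\<close> with \<open>m\<close>
  elements (so \<open>[k]\<close> is \<open>k + 1\<close>), and the pair \<open>(m, xs)\<close> for the monotone map
  \<open>{0..<length xs} \<rightarrow> {0..<m}\<close> with list of values \<open>xs\<close>. Ordinal sum places the second
  summand after the first.\<close>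

type_synonym monotone_map = "nat \<times> nat list"

definition deloop_simplex :: "(unit, nat, monotone_map) two_cat" where
  "deloop_simplex = \<lparr>
     cell0 = UNIV,
     cell1 = UNIV,
     cell2 = {(m, xs). sorted xs \<and> set xs \<subseteq> {0..<m}},
     src1 = (\<lambda>_. ()),
     tgt1 = (\<lambda>_. ()),
     src2 = (\<lambda>(m, xs). length xs),
     tgt2 = (\<lambda>(m, xs). m),
     id1 = (\<lambda>_. 0),
     comp1 = (\<lambda>m n. m + n),
     id2 = (\<lambda>m. (m, [0..<m])),
     vcomp = (\<lambda>(m, xs) (k, ys). (m, map (\<lambda>y. xs ! y) ys)),
     hcomp = (\<lambda>(m, xs) (n, ys). (m + n, xs @ map (\<lambda>y. m + y) ys))\<rparr>"


section \<open>The lax Gray tensor product\<close>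

text \<open>Formal composites of the generators. \<open>Left1 f c\<close> is \<open>(f, Id\<^sub>c)\<close>, \<open>Right1 b g\<close> is \<open>(Id\<^sub>b, g)\<close>,
  \<open>Ident1 b c\<close> is the identity on the object \<open>(b, c)\<close>; similarly for 2-cells, where \<open>Swap f g\<close> is
  \<open>\<gamma>\<^bsub>f,g\<^esub>\<close> and \<open>Ident2 e\<close> is the identity 2-cell on \<open>e\<close>.\<close>

datatype ('o, 'm, 'p, 'n) expr1 =
    Left1 'm 'p
  | Right1 'o 'n
  | Ident1 'o 'p
  | Comp1 "('o, 'm, 'p, 'n) expr1" "('o, 'm, 'p, 'n) expr1"

datatype ('o, 'm, 'c, 'p, 'n, 'd) expr2 =
    Left2 'c 'p
  | Right2 'o 'd
  | Swap 'm 'n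
  | Ident2 "('o, 'm, 'p, 'n) expr1"
  | VComp "('o, 'm, 'c, 'p, 'n, 'd) expr2" "('o, 'm, 'c, 'p, 'n, 'd) expr2"
  | HComp "('o, 'm, 'c, 'p, 'n, 'd) expr2" "('o, 'm, 'c, 'p, 'n, 'd) expr2"

definition rep :: "'e set \<Rightarrow> 'e" where
  "rep X = (SOME x. x \<in> X)"

locale gray_data =
  fixes B :: "('o, 'm, 'c) two_cat" and C :: "('p, 'n, 'd) two_cat"
begin

primrec esrc1 :: "('o, 'm, 'p, 'n) expr1 \<Rightarrow> 'o \<times> 'p" where
  "esrc1 (Left1 f c) = (src1 B f, c)"
| "esrc1 (Right1 b g) = (b, src1 C g)"
| "esrc1 (Ident1 b c) = (b, c)"
| "esrc1 (Comp1 e d) = esrc1 d"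

primrec etgt1 :: "('o, 'm, 'p, 'n) expr1 \<Rightarrow> 'o \<times> 'p" where
  "etgt1 (Left1 f c) = (tgt1 B f, c)"
| "etgt1 (Right1 b g) = (b, tgt1 C g)"
| "etgt1 (Ident1 b c) = (b, c)"
| "etgt1 (Comp1 e d) = etgt1 e"

primrec wf1 :: "('o, 'm, 'p, 'n) expr1 \<Rightarrow> bool" where
  "wf1 (Left1 f c) \<longleftrightarrow> f \<in> cell1 B \<and> c \<in> cell0 C"
| "wf1 (Right1 b g) \<longleftrightarrow> b \<in> cell0 B \<and> g \<in> cell1 C"
| "wf1 (Ident1 b c) \<longleftrightarrow> b \<in> cell0 B \<and> c \<in> cell0 C"
| "wf1 (Comp1 e d) \<longleftrightarrow> wf1 e \<and> wf1 d \<and> esrc1 e = etgt1 d"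

inductive eq1 :: "('o, 'm, 'p, 'n) expr1 \<Rightarrow> ('o, 'm, 'p, 'n) expr1 \<Rightarrow> bool" where
  eq1_refl: "wf1 e \<Longrightarrow> eq1 e e"
| eq1_sym: "eq1 e d \<Longrightarrow> eq1 d e"
| eq1_trans: "eq1 e d \<Longrightarrow> eq1 d k \<Longrightarrow> eq1 e k"
| eq1_comp: "eq1 e e' \<Longrightarrow> eq1 d d' \<Longrightarrow> esrc1 e = etgt1 d \<Longrightarrow> eq1 (Comp1 e d) (Comp1 e' d')"
| eq1_assoc: "wf1 (Comp1 (Comp1 e d) k) \<Longrightarrow> eq1 (Comp1 (Comp1 e d) k) (Comp1 e (Comp1 d k))"
| eq1_unit_left: "wf1 e \<Longrightarrow> etgt1 e = (b, c) \<Longrightarrow> eq1 (Comp1 (Ident1 b c) e) e"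
| eq1_unit_right: "wf1 e \<Longrightarrow> esrc1 e = (b, c) \<Longrightarrow> eq1 (Comp1 e (Ident1 b c)) e"
| eq1_left_comp: "f \<in> cell1 B \<Longrightarrow> f' \<in> cell1 B \<Longrightarrow> src1 B f = tgt1 B f' \<Longrightarrow> c \<in> cell0 C \<Longrightarrow>
    eq1 (Comp1 (Left1 f c) (Left1 f' c)) (Left1 (comp1 B f f') c)"
| eq1_right_comp: "g \<in> cell1 C \<Longrightarrow> g' \<in> cell1 C \<Longrightarrow> src1 C g = tgt1 C g' \<Longrightarrow> b \<in> cell0 B \<Longrightarrow>
    eq1 (Comp1 (Right1 b g) (Right1 b g')) (Right1 b (comp1 C g g'))"
| eq1_left_id: "b \<in> cell0 B \<Longrightarrow> c \<in> cell0 C \<Longrightarrow> eq1 (Left1 (id1 B b) c) (Ident1 b c)"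
| eq1_right_id: "b \<in> cell0 B \<Longrightarrow> c \<in> cell0 C \<Longrightarrow> eq1 (Right1 b (id1 C c)) (Ident1 b c)"

primrec esrc2 :: "('o, 'm, 'c, 'p, 'n, 'd) expr2 \<Rightarrow> ('o, 'm, 'p, 'n) expr1" where
  "esrc2 (Left2 \<phi> c) = Left1 (src2 B \<phi>) c"
| "esrc2 (Right2 b \<psi>) = Right1 b (src2 C \<psi>)"
| "esrc2 (Swap f g) = Comp1 (Left1 f (tgt1 C g)) (Right1 (src1 B f) g)"
| "esrc2 (Ident2 e) = e"
| "esrc2 (VComp x y) = esrc2 y"
| "esrc2 (HComp x y) = Comp1 (esrc2 x) (esrc2 y)"

primrec etgt2 :: "('o, 'm, 'c, 'p, 'n, 'd) expr2 \<Rightarrow> ('o, 'm, 'p, 'n) expr1" where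
  "etgt2 (Left2 \<phi> c) = Left1 (tgt2 B \<phi>) c"
| "etgt2 (Right2 b \<psi>) = Right1 b (tgt2 C \<psi>)"
| "etgt2 (Swap f g) = Comp1 (Right1 (tgt1 B f) g) (Left1 f (src1 C g))"
| "etgt2 (Ident2 e) = e"
| "etgt2 (VComp x y) = etgt2 x"
| "etgt2 (HComp x y) = Comp1 (etgt2 x) (etgt2 y)"

primrec wf2 :: "('o, 'm, 'c, 'p, 'n, 'd) expr2 \<Rightarrow> bool" where
  "wf2 (Left2 \<phi> c) \<longleftrightarrow> \<phi> \<in> cell2 B \<and> c \<in> cell0 C"
| "wf2 (Right2 b \<psi>) \<longleftrightarrow> b \<in> cell0 B \<and> \<psi> \<in> cell2 C"
| "wf2 (Swap f g) \<longleftrightarrow> f \<in> cell1 B \<and> g \<in> cell1 C"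
| "wf2 (Ident2 e) \<longleftrightarrow> wf1 e"
| "wf2 (VComp x y) \<longleftrightarrow> wf2 x \<and> wf2 y \<and> eq1 (esrc2 x) (etgt2 y)"
| "wf2 (HComp x y) \<longleftrightarrow> wf2 x \<and> wf2 y \<and> esrc1 (esrc2 x) = etgt1 (esrc2 y)"

text \<open>The strict 2-category axioms, closure under composition, and the relations imposed
  on the generators.\<close>

inductive eq2 ::
  "('o, 'm, 'c, 'p, 'n, 'd) expr2 \<Rightarrow> ('o, 'm, 'c, 'p, 'n, 'd) expr2 \<Rightarrow> bool" where
  eq2_refl: "wf2 x \<Longrightarrow> eq2 x x"
| eq2_sym: "eq2 x y \<Longrightarrow> eq2 y x"
| eq2_trans: "eq2 x y \<Longrightarrow> eq2 y z \<Longrightarrow> eq2 x z"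
| eq2_ident: "eq1 e d \<Longrightarrow> eq2 (Ident2 e) (Ident2 d)"
| eq2_vcomp: "eq2 x x' \<Longrightarrow> eq2 y y' \<Longrightarrow> wf2 (VComp x y) \<Longrightarrow> eq2 (VComp x y) (VComp x' y')"
| eq2_hcomp: "eq2 x x' \<Longrightarrow> eq2 y y' \<Longrightarrow> wf2 (HComp x y) \<Longrightarrow> eq2 (HComp x y) (HComp x' y')"
| eq2_vassoc: "wf2 (VComp (VComp x y) z) \<Longrightarrow> eq2 (VComp (VComp x y) z) (VComp x (VComp y z))"
| eq2_vunit_left: "wf2 x \<Longrightarrow> eq2 (VComp (Ident2 (etgt2 x)) x) x"
| eq2_vunit_right: "wf2 x \<Longrightarrow> eq2 (VComp x (Ident2 (esrc2 x))) x"
| eq2_hassoc: "wf2 (HComp (HComp x y) z) \<Longrightarrow> eq2 (HComp (HComp x y) z) (HComp x (HComp y z))"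
| eq2_hunit_left: "wf2 x \<Longrightarrow> etgt1 (esrc2 x) = (b, c) \<Longrightarrow> eq2 (HComp (Ident2 (Ident1 b c)) x) x"
| eq2_hunit_right: "wf2 x \<Longrightarrow> esrc1 (esrc2 x) = (b, c) \<Longrightarrow> eq2 (HComp x (Ident2 (Ident1 b c))) x"
| eq2_hident: "wf1 (Comp1 e d) \<Longrightarrow> eq2 (HComp (Ident2 e) (Ident2 d)) (Ident2 (Comp1 e d))"
| eq2_interchange: "wf2 (HComp (VComp x x') (VComp y y')) \<Longrightarrow>
    eq2 (HComp (VComp x x') (VComp y y')) (VComp (HComp x y) (HComp x' y'))"
| eq2_left_vcomp: "\<phi> \<in> cell2 B \<Longrightarrow> \<phi>' \<in> cell2 B \<Longrightarrow> src2 B \<phi> = tgt2 B \<phi>' \<Longrightarrow> c \<in> cell0 C \<Longrightarrow>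
    eq2 (VComp (Left2 \<phi> c) (Left2 \<phi>' c)) (Left2 (vcomp B \<phi> \<phi>') c)"
| eq2_left_hcomp: "\<phi> \<in> cell2 B \<Longrightarrow> \<phi>' \<in> cell2 B \<Longrightarrow>
    src1 B (src2 B \<phi>) = tgt1 B (src2 B \<phi>') \<Longrightarrow> c \<in> cell0 C \<Longrightarrow>
    eq2 (HComp (Left2 \<phi> c) (Left2 \<phi>' c)) (Left2 (hcomp B \<phi> \<phi>') c)"
| eq2_left_id: "f \<in> cell1 B \<Longrightarrow> c \<in> cell0 C \<Longrightarrow> eq2 (Left2 (id2 B f) c) (Ident2 (Left1 f c))"
| eq2_right_vcomp: "\<psi> \<in> cell2 C \<Longrightarrow> \<psi>' \<in> cell2 C \<Longrightarrow> src2 C \<psi> = tgt2 C \<psi>' \<Longrightarrow> b \<in> cell0 B \<Longrightarrow>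
    eq2 (VComp (Right2 b \<psi>) (Right2 b \<psi>')) (Right2 b (vcomp C \<psi> \<psi>'))"
| eq2_right_hcomp: "\<psi> \<in> cell2 C \<Longrightarrow> \<psi>' \<in> cell2 C \<Longrightarrow>
    src1 C (src2 C \<psi>) = tgt1 C (src2 C \<psi>') \<Longrightarrow> b \<in> cell0 B \<Longrightarrow>
    eq2 (HComp (Right2 b \<psi>) (Right2 b \<psi>')) (Right2 b (hcomp C \<psi> \<psi>'))"
| eq2_right_id: "b \<in> cell0 B \<Longrightarrow> g \<in> cell1 C \<Longrightarrow> eq2 (Right2 b (id2 C g)) (Ident2 (Right1 b g))"
| eq2_swap_id_right: "f \<in> cell1 B \<Longrightarrow> c \<in> cell0 C \<Longrightarrow>
    eq2 (Swap f (id1 C c)) (Ident2 (Left1 f c))"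
| eq2_swap_id_left: "b \<in> cell0 B \<Longrightarrow> g \<in> cell1 C \<Longrightarrow>
    eq2 (Swap (id1 B b) g) (Ident2 (Right1 b g))"
| eq2_swap_comp_left: "f \<in> cell1 B \<Longrightarrow> f' \<in> cell1 B \<Longrightarrow> src1 B f = tgt1 B f' \<Longrightarrow> g \<in> cell1 C \<Longrightarrow>
    eq2 (Swap (comp1 B f f') g)
        (VComp (HComp (Swap f g) (Ident2 (Left1 f' (src1 C g))))
               (HComp (Ident2 (Left1 f (tgt1 C g))) (Swap f' g)))"
| eq2_swap_comp_right: "f \<in> cell1 B \<Longrightarrow> g \<in> cell1 C \<Longrightarrow> g' \<in> cell1 C \<Longrightarrow> src1 C g = tgt1 C g' \<Longrightarrow>
    eq2 (Swap f (comp1 C g g'))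
        (VComp (HComp (Ident2 (Right1 (tgt1 B f) g)) (Swap f g'))
               (HComp (Swap f g) (Ident2 (Right1 (src1 B f) g'))))"
| eq2_swap_natural: "\<phi> \<in> hom2 B f f' \<Longrightarrow> \<psi> \<in> hom2 C g g' \<Longrightarrow>
    eq2 (VComp (Swap f' g') (HComp (Left2 \<phi> (tgt1 C g)) (Right2 (src1 B f) \<psi>)))
        (VComp (HComp (Right2 (tgt1 B f) \<psi>) (Left2 \<phi> (src1 C g))) (Swap f g))"

definition cls1 :: "('o, 'm, 'p, 'n) expr1 \<Rightarrow> ('o, 'm, 'p, 'n) expr1 set" where
  "cls1 e = {d. eq1 e d}"

definition cls2 ::
  "('o, 'm, 'c, 'p, 'n, 'd) expr2 \<Rightarrow> ('o, 'm, 'c, 'p, 'n, 'd) expr2 set" where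
  "cls2 x = {y. eq2 x y}"

definition gray ::
  "('o \<times> 'p, ('o, 'm, 'p, 'n) expr1 set, ('o, 'm, 'c, 'p, 'n, 'd) expr2 set) two_cat" where
  "gray = \<lparr>
     cell0 = cell0 B \<times> cell0 C,
     cell1 = cls1 ` {e. wf1 e},
     cell2 = cls2 ` {x. wf2 x},
     src1 = (\<lambda>X. esrc1 (rep X)),
     tgt1 = (\<lambda>X. etgt1 (rep X)),
     src2 = (\<lambda>X. cls1 (esrc2 (rep X))),
     tgt2 = (\<lambda>X. cls1 (etgt2 (rep X))),
     id1 = (\<lambda>(b, c). cls1 (Ident1 b c)),
     comp1 = (\<lambda>X Y. cls1 (Comp1 (rep X) (rep Y))),
     id2 = (\<lambda>X. cls2 (Ident2 (rep X))),
     vcomp = (\<lambda>X Y. cls2 (VComp (rep X) (rep Y))),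
     hcomp = (\<lambda>X Y. cls2 (HComp (rep X) (rep Y)))\<rparr>"

end

abbreviation gray_tensor (infixl "\<otimes>\<^sub>l" 70) where
  "B \<otimes>\<^sub>l C \<equiv> gray_data.gray B C"

definition mnd where
  "mnd C = C \<otimes>\<^sub>l deloop_simplex"


section \<open>Iterating\<close>

text \<open>The cells of \<open>mnd C\<close> live in other types than those of \<open>C\<close>. To iterate inside one HOL type,
  the cells of a 2-category with countably many cells are renamed to natural numbers by the
  injections \<open>to_nat_on\<close>; the result is isomorphic to the original 2-category. All cell sets of
  \<open>mnd C\<close> are countable if those of \<open>C\<close> are.\<close>

definition num0 :: "('o, 'm, 'c) two_cat \<Rightarrow> 'o \<Rightarrow> nat" where
  "num0 C = to_nat_on (cell0 C)"

definition num1 :: "('o, 'm, 'c) two_cat \<Rightarrow> 'm \<Rightarrow> nat" where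
  "num1 C = to_nat_on (cell1 C)"

definition num2 :: "('o, 'm, 'c) two_cat \<Rightarrow> 'c \<Rightarrow> nat" where
  "num2 C = to_nat_on (cell2 C)"

definition numbered :: "('o, 'm, 'c) two_cat \<Rightarrow> (nat, nat, nat) two_cat" where
  "numbered C =
    (let r0 = inv_into (cell0 C) (num0 C);
         r1 = inv_into (cell1 C) (num1 C);
         r2 = inv_into (cell2 C) (num2 C)
     in \<lparr>
       cell0 = num0 C ` cell0 C,
       cell1 = num1 C ` cell1 C,
       cell2 = num2 C ` cell2 C,
       src1 = (\<lambda>f. num0 C (src1 C (r1 f))),
       tgt1 = (\<lambda>f. num0 C (tgt1 C (r1 f))),
       src2 = (\<lambda>\<alpha>. num1 C (src2 C (r2 \<alpha>))),
       tgt2 = (\<lambda>\<alpha>. num1 C (tgt2 C (r2 \<alpha>))),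
       id1 = (\<lambda>a. num1 C (id1 C (r0 a))),
       comp1 = (\<lambda>f g. num1 C (comp1 C (r1 f) (r1 g))),
       id2 = (\<lambda>f. num2 C (id2 C (r1 f))),
       vcomp = (\<lambda>\<alpha> \<beta>. num2 C (vcomp C (r2 \<alpha>) (r2 \<beta>))),
       hcomp = (\<lambda>\<alpha> \<beta>. num2 C (hcomp C (r2 \<alpha>) (r2 \<beta>)))\<rparr>)"

definition mnd_power :: "nat \<Rightarrow> (nat, nat, nat) two_cat \<Rightarrow> (nat, nat, nat) two_cat" where
  "mnd_power n = (\<lambda>C. numbered (mnd C)) ^^ n"

definition mnd_power_terminal :: "nat \<Rightarrow> (nat, nat, nat) two_cat" where
  "mnd_power_terminal n = mnd_power n (numbered terminal_2cat)"

text \<open>The unique object of \<open>mnd\<^sup>n(1)\<close>, the images of 1-cells and 2-cells of \<open>deloop_simplex\<close> under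
  the inclusion of its \<open>i\<close>-th copy (\<open>1 \<le> i \<le> n\<close>, the \<open>n\<close>-th copy being the last tensor factor), and,
  for \<open>i < j\<close>, the swap 2-cell of a 1-cell \<open>f\<close> of the \<open>i\<close>-th copy and a 1-cell \<open>g\<close> of the \<open>j\<close>-th.\<close>

primrec base :: "nat \<Rightarrow> nat" where
  "base 0 = num0 terminal_2cat ()"
| "base (Suc n) = num0 (mnd (mnd_power_terminal n)) (base n, ())"

primrec copy1 :: "nat \<Rightarrow> nat \<Rightarrow> nat \<Rightarrow> nat" where
  "copy1 0 i f = undefined"
| "copy1 (Suc n) i f =
    (let C = mnd_power_terminal n in
     num1 (mnd C) (gray_data.cls1 C deloop_simplex
       (if i = Suc n then Right1 (base n) f else Left1 (copy1 n i f) ())))"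

primrec copy2 :: "nat \<Rightarrow> nat \<Rightarrow> monotone_map \<Rightarrow> nat" where
  "copy2 0 i \<phi> = undefined"
| "copy2 (Suc n) i \<phi> =
    (let C = mnd_power_terminal n in
     num2 (mnd C) (gray_data.cls2 C deloop_simplex
       (if i = Suc n then Right2 (base n) \<phi> else Left2 (copy2 n i \<phi>) ())))"

primrec swap :: "nat \<Rightarrow> nat \<Rightarrow> nat \<Rightarrow> nat \<Rightarrow> nat \<Rightarrow> nat" where
  "swap 0 i j f g = undefined"
| "swap (Suc n) i j f g =
    (let C = mnd_power_terminal n in
     num2 (mnd C) (gray_data.cls2 C deloop_simplex
       (if j = Suc n then Swap (copy1 n i f) g else Left2 (swap n i j f g) ())))"


section \<open>Monads and distributive laws in a 2-category\<close>

locale monad_on =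
  fixes B :: "('o, 'm, 'c) two_cat" (structure)
    and a :: 'o and t :: 'm and \<eta> :: 'c and \<mu> :: 'c
  assumes object: "a \<in> cell0 B"
    and endo: "t \<in> hom1 B a a"
    and unit: "\<eta> \<in> hom2 B (\<one> a) t"
    and mult: "\<mu> \<in> hom2 B (t \<cdot> t) t"
    and unit_left: "\<mu> \<bullet> (\<eta> \<star> \<iota> t) = \<iota> t"
    and unit_right: "\<mu> \<bullet> (\<iota> t \<star> \<eta>) = \<iota> t"
    and assoc: "\<mu> \<bullet> (\<mu> \<star> \<iota> t) = \<mu> \<bullet> (\<iota> t \<star> \<mu>)"

locale distributive_law =
  S: monad_on B a s \<eta>s \<mu>s + T: monad_on B a t \<eta>t \<mu>t
  for B :: "('o, 'm, 'c) two_cat" (structure)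
    and a :: 'o and s :: 'm and \<eta>s :: 'c and \<mu>s :: 'c and t :: 'm and \<eta>t :: 'c and \<mu>t :: 'c +
  fixes \<sigma> :: 'c
  assumes cell: "\<sigma> \<in> hom2 B (s \<cdot> t) (t \<cdot> s)"
    and unit_s: "\<sigma> \<bullet> (\<eta>s \<star> \<iota> t) = \<iota> t \<star> \<eta>s"
    and unit_t: "\<sigma> \<bullet> (\<iota> s \<star> \<eta>t) = \<eta>t \<star> \<iota> s"
    and mult_s: "\<sigma> \<bullet> (\<mu>s \<star> \<iota> t) = (\<iota> t \<star> \<mu>s) \<bullet> (\<sigma> \<star> \<iota> s) \<bullet> (\<iota> s \<star> \<sigma>)"
    and mult_t: "\<sigma> \<bullet> (\<iota> s \<star> \<mu>t) = (\<mu>t \<star> \<iota> s) \<bullet> (\<iota> t \<star> \<sigma>) \<bullet> (\<sigma> \<star> \<iota> t)"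

definition yang_baxter ::
  "('o, 'm, 'c) two_cat \<Rightarrow> (nat \<Rightarrow> 'm) \<Rightarrow> (nat \<times> nat \<Rightarrow> 'c) \<Rightarrow> nat \<Rightarrow> nat \<Rightarrow> nat \<Rightarrow> bool" where
  "yang_baxter B t \<sigma> i j k \<longleftrightarrow>
     (\<iota>\<^bsub>B\<^esub> (t k) \<star>\<^bsub>B\<^esub> \<sigma> (i, j)) \<bullet>\<^bsub>B\<^esub> (\<sigma> (i, k) \<star>\<^bsub>B\<^esub> \<iota>\<^bsub>B\<^esub> (t j)) \<bullet>\<^bsub>B\<^esub> (\<iota>\<^bsub>B\<^esub> (t i) \<star>\<^bsub>B\<^esub> \<sigma> (j, k)) =
     (\<sigma> (j, k) \<star>\<^bsub>B\<^esub> \<iota>\<^bsub>B\<^esub> (t i)) \<bullet>\<^bsub>B\<^esub> (\<iota>\<^bsub>B\<^esub> (t j) \<star>\<^bsub>B\<^esub> \<sigma> (i, k)) \<bullet>\<^bsub>B\<^esub> (\<sigma> (i, j) \<star>\<^bsub>B\<^esub> \<iota>\<^bsub>B\<^esub> (t k))"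

definition pairs_below :: "nat \<Rightarrow> (nat \<times> nat) set" where
  "pairs_below n = {(i, j). 1 \<le> i \<and> i < j \<and> j \<le> n}"

text \<open>Finite families are functions extensional on their index set.\<close>

definition dist_law_data :: "nat \<Rightarrow> ('o, 'm, 'c) two_cat \<Rightarrow>
    ('o \<times> (nat \<Rightarrow> 'm) \<times> (nat \<Rightarrow> 'c) \<times> (nat \<Rightarrow> 'c) \<times> (nat \<times> nat \<Rightarrow> 'c)) set" where
  "dist_law_data n B = {(a, t, \<eta>, \<mu>, \<sigma>).
     a \<in> cell0 B \<and>
     t \<in> extensional {1..n} \<and> \<eta> \<in> extensional {1..n} \<and> \<mu> \<in> extensional {1..n} \<and>
     \<sigma> \<in> extensional (pairs_below n) \<and>
     (\<forall>i \<in> {1..n}. monad_on B a (t i) (\<eta> i) (\<mu> i)) \<and>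
     (\<forall>i j. 1 \<le> i \<and> i < j \<and> j \<le> n \<longrightarrow>
        distributive_law B a (t i) (\<eta> i) (\<mu> i) (t j) (\<eta> j) (\<mu> j) (\<sigma> (i, j))) \<and>
     (\<forall>i j k. 1 \<le> i \<and> i < j \<and> j < k \<and> k \<le> n \<longrightarrow> yang_baxter B t \<sigma> i j k)}"

definition parametric_dist_laws :: "nat \<Rightarrow> ('o, 'm, 'c) two_cat \<Rightarrow>
    (nat, nat, nat, 'o, 'm, 'c) two_fun set" where
  "parametric_dist_laws n B = strict_2_functors (mnd_power_terminal n) B"

text \<open>The one-element ordinal is \<open>1\<close>; \<open>(1, [])\<close> is the map to it from the empty ordinal and
  \<open>(1, [0, 0])\<close> the map from the two-element ordinal.\<close>

definition extract_data :: "nat \<Rightarrow> (nat, nat, nat, 'o, 'm, 'c) two_fun \<Rightarrow>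
    'o \<times> (nat \<Rightarrow> 'm) \<times> (nat \<Rightarrow> 'c) \<times> (nat \<Rightarrow> 'c) \<times> (nat \<times> nat \<Rightarrow> 'c)" where
  "extract_data n D =
    (map0 D (base n),
     \<lambda>i \<in> {1..n}. map1 D (copy1 n i 1),
     \<lambda>i \<in> {1..n}. map2 D (copy2 n i (1, [])),
     \<lambda>i \<in> {1..n}. map2 D (copy2 n i (1, [0, 0])),
     \<lambda>(i, j) \<in> pairs_below n. map2 D (swap n i j 1 1))"

end

theory Submission
  imports Defs
begin

text \<open>
  The lax Gray tensor product is the tensor of a closed structure: a 2-functor out of
  \<open>C \<otimes>\<^sub>l D\<close> amounts to a 2-functor from \<open>C\<close> to the 2-category of 2-functors on \<open>D\<close>, lax
  transformations and modifications. When \<open>D\<close> is the delooping of \<open>\<Delta>\<^sub>\<alpha>\<close>, the free monoidal category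
  on a monoid, 2-functors on \<open>D\<close> are monads, and the 2-category in question is the 2-category
  \<open>monads B\<close> of monads in the target \<open>B\<close>: its 1-cells are pairs of a 1-cell \<open>f\<close> and a 2-cell
  \<open>\<sigma> : f \<cdot> t \<rightarrow> u \<cdot> f\<close> compatible with the monad structures of \<open>t\<close> and \<open>u\<close>, and its 2-cells are the
  2-cells of \<open>B\<close> that commute with the \<open>\<sigma>\<close>. So 2-functors \<open>mnd C \<rightarrow> B\<close> correspond to 2-functors
  \<open>C \<rightarrow> monads B\<close> (\<open>bij_betw_transpose\<close>).

  This gives an induction on \<open>n\<close>, for all targets at once: 2-functors \<open>mnd\<^sup>n\<^sup>+\<^sup>1(1) \<rightarrow> B\<close> are 2-functors
  \<open>mnd\<^sup>n(1) \<rightarrow> monads B\<close>, hence \<open>n\<close>-fold distributive laws in \<open>monads B\<close>. It remains to recognise these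
  as \<open>(n + 1)\<close>-fold distributive laws in \<open>B\<close> (\<open>bij_betw_flatten_data\<close>), by reading off what it means for
  the data to consist of cells of \<open>monads B\<close>. The object is the last monad \<open>t\<close>. A monad on it is a
  monad \<open>s\<close> in \<open>B\<close> with a distributive law \<open>s \<cdot> t \<rightarrow> t \<cdot> s\<close>: two of the four axioms say that \<open>s\<close>
  is a 1-cell, the other two that its unit and multiplication are 2-cells
  (\<open>monad_on_monads_typing\<close>). A 2-cell \<open>s \<cdot> s' \<rightarrow> s' \<cdot> s\<close> of \<open>B\<close> is a 2-cell of \<open>monads B\<close> exactly when
  it satisfies the Yang-Baxter equation with the two laws over \<open>t\<close> (\<open>swap_monads_typing\<close>). All other
  equations are between 2-cells and can be checked in \<open>B\<close>. The induction starts at \<open>n = 0\<close>, where a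
  2-functor out of the terminal 2-category is an object.

  Since the induction hypothesis is used for \<open>monads B\<close> in place of \<open>B\<close>, the cells of both must have
  the same type. The datatypes \<open>obj\<close>, \<open>arr\<close> and \<open>cel\<close> are closed under the formation of monads; an
  arbitrary target is isomorphic to one whose cells are in these types, and both sides of
  the bijection respect isomorphisms.
\<close>

section \<open>Calculating in a strict 2-category\<close>

text \<open>The axioms are restated with explicit sources and targets in place of hom-sets: the side
  conditions then contain no unknowns, and the simplifier can discharge them.\<close>

context strict_2_category
begin

lemma cell1_id1 [simp]: "a \<in> cell0 C \<Longrightarrow> \<one> a \<in> cell1 C"
  and src1_id1 [simp]: "a \<in> cell0 C \<Longrightarrow> src1 C (\<one> a) = a"
  and tgt1_id1 [simp]: "a \<in> cell0 C \<Longrightarrow> tgt1 C (\<one> a) = a"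
  using id1_hom[of a] by (auto simp: hom1_def)

lemma
  assumes "f \<in> cell1 C" "g \<in> cell1 C" "src1 C f = tgt1 C g"
  shows cell1_comp1 [simp]: "f \<cdot> g \<in> cell1 C"
    and src1_comp1 [simp]: "src1 C (f \<cdot> g) = src1 C g"
    and tgt1_comp1 [simp]: "tgt1 C (f \<cdot> g) = tgt1 C f"
  using comp1_hom[of f "tgt1 C g" "tgt1 C f" g "src1 C g"] assms by (auto simp: hom1_def)

lemma comp1_assoc' [simp]:
  assumes "f \<in> cell1 C" "g \<in> cell1 C" "h \<in> cell1 C" "src1 C f = tgt1 C g" "src1 C g = tgt1 C h"
  shows "(f \<cdot> g) \<cdot> h = f \<cdot> (g \<cdot> h)"
  using assms by (intro comp1_assoc) (auto simp: hom1_def)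

lemma comp1_unit_left' [simp]: "f \<in> cell1 C \<Longrightarrow> tgt1 C f = b \<Longrightarrow> \<one> b \<cdot> f = f"
  by (rule comp1_unit_left) (auto simp: hom1_def)

lemma comp1_unit_right' [simp]: "f \<in> cell1 C \<Longrightarrow> src1 C f = a \<Longrightarrow> f \<cdot> \<one> a = f"
  by (rule comp1_unit_right) (auto simp: hom1_def)

lemma cell2_id2 [simp]: "f \<in> cell1 C \<Longrightarrow> \<iota> f \<in> cell2 C"
  and src2_id2 [simp]: "f \<in> cell1 C \<Longrightarrow> src2 C (\<iota> f) = f"
  and tgt2_id2 [simp]: "f \<in> cell1 C \<Longrightarrow> tgt2 C (\<iota> f) = f"
  using id2_hom[of f] by (auto simp: hom2_def)

lemma
  assumes "\<alpha> \<in> cell2 C" "\<beta> \<in> cell2 C" "src2 C \<alpha> = tgt2 C \<beta>"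
  shows cell2_vcomp [simp]: "\<alpha> \<bullet> \<beta> \<in> cell2 C"
    and src2_vcomp [simp]: "src2 C (\<alpha> \<bullet> \<beta>) = src2 C \<beta>"
    and tgt2_vcomp [simp]: "tgt2 C (\<alpha> \<bullet> \<beta>) = tgt2 C \<alpha>"
  using vcomp_hom[of \<alpha> "tgt2 C \<beta>" "tgt2 C \<alpha>" \<beta> "src2 C \<beta>"] assms by (auto simp: hom2_def)

lemma
  assumes "\<alpha> \<in> cell2 C" "\<beta> \<in> cell2 C" "src1 C (src2 C \<alpha>) = tgt1 C (src2 C \<beta>)"
  shows cell2_hcomp [simp]: "\<alpha> \<star> \<beta> \<in> cell2 C"
    and src2_hcomp [simp]: "src2 C (\<alpha> \<star> \<beta>) = src2 C \<alpha> \<cdot> src2 C \<beta>"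
    and tgt2_hcomp [simp]: "tgt2 C (\<alpha> \<star> \<beta>) = tgt2 C \<alpha> \<cdot> tgt2 C \<beta>"
  using hcomp_hom[of \<alpha> "src2 C \<alpha>" "tgt2 C \<alpha>" \<beta> "src2 C \<beta>" "tgt2 C \<beta>"] assms
  by (auto simp: hom2_def)

lemma vcomp_assoc' [simp]:
  assumes "\<alpha> \<in> cell2 C" "\<beta> \<in> cell2 C" "\<gamma> \<in> cell2 C"
    "src2 C \<alpha> = tgt2 C \<beta>" "src2 C \<beta> = tgt2 C \<gamma>"
  shows "(\<alpha> \<bullet> \<beta>) \<bullet> \<gamma> = \<alpha> \<bullet> (\<beta> \<bullet> \<gamma>)"
  using assms by (intro vcomp_assoc) (auto simp: hom2_def)

lemma vcomp_unit_left' [simp]: "\<alpha> \<in> cell2 C \<Longrightarrow> tgt2 C \<alpha> = f \<Longrightarrow> \<iota> f \<bullet> \<alpha> = \<alpha>"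
  by (rule vcomp_unit_left) (auto simp: hom2_def)

lemma vcomp_unit_right' [simp]: "\<alpha> \<in> cell2 C \<Longrightarrow> src2 C \<alpha> = f \<Longrightarrow> \<alpha> \<bullet> \<iota> f = \<alpha>"
  by (rule vcomp_unit_right) (auto simp: hom2_def)

lemma hcomp_assoc' [simp]:
  assumes "\<alpha> \<in> cell2 C" "\<beta> \<in> cell2 C" "\<gamma> \<in> cell2 C"
    "src1 C (src2 C \<alpha>) = tgt1 C (src2 C \<beta>)" "src1 C (src2 C \<beta>) = tgt1 C (src2 C \<gamma>)"
  shows "(\<alpha> \<star> \<beta>) \<star> \<gamma> = \<alpha> \<star> (\<beta> \<star> \<gamma>)"
  using assms
  by (auto simp: hom2_def intro!: hcomp_assoc[of _ "src2 C \<alpha>" "tgt2 C \<alpha>" _ "src2 C \<beta>" "tgt2 C \<beta>"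
      _ "src2 C \<gamma>" "tgt2 C \<gamma>"])

lemma hcomp_unit_left' [simp]:
  "\<alpha> \<in> cell2 C \<Longrightarrow> tgt1 C (src2 C \<alpha>) = b \<Longrightarrow> \<iota> (\<one> b) \<star> \<alpha> = \<alpha>"
  by (rule hcomp_unit_left[of _ "src2 C \<alpha>" "tgt2 C \<alpha>"])
    (auto simp: hom2_def hom1_def src2_closed)

lemma hcomp_unit_right' [simp]:
  "\<alpha> \<in> cell2 C \<Longrightarrow> src1 C (src2 C \<alpha>) = a \<Longrightarrow> \<alpha> \<star> \<iota> (\<one> a) = \<alpha>"
  by (rule hcomp_unit_right[of _ "src2 C \<alpha>" "tgt2 C \<alpha>"])
    (auto simp: hom2_def hom1_def src2_closed)

lemma hcomp_id2' [simp]: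
  "f \<in> cell1 C \<Longrightarrow> g \<in> cell1 C \<Longrightarrow> src1 C f = tgt1 C g \<Longrightarrow> \<iota> f \<star> \<iota> g = \<iota> (f \<cdot> g)"
  by (rule hcomp_id2) (auto simp: hom1_def)

lemma interchange':
  assumes "\<alpha> \<in> cell2 C" "\<beta> \<in> cell2 C" "\<gamma> \<in> cell2 C" "\<delta> \<in> cell2 C"
    "src2 C \<alpha> = tgt2 C \<beta>" "src2 C \<gamma> = tgt2 C \<delta>" "src1 C (src2 C \<beta>) = tgt1 C (src2 C \<delta>)"
  shows "(\<alpha> \<bullet> \<beta>) \<star> (\<gamma> \<bullet> \<delta>) = (\<alpha> \<star> \<gamma>) \<bullet> (\<beta> \<star> \<delta>)"
  using assms by (intro interchange) (auto simp: hom2_def)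

lemma whisker_left_vcomp [simp]:
  assumes "f \<in> cell1 C" "\<alpha> \<in> cell2 C" "\<beta> \<in> cell2 C" "src2 C \<alpha> = tgt2 C \<beta>"
    "src1 C f = tgt1 C (src2 C \<beta>)"
  shows "\<iota> f \<star> (\<alpha> \<bullet> \<beta>) = (\<iota> f \<star> \<alpha>) \<bullet> (\<iota> f \<star> \<beta>)"
  using interchange'[of "\<iota> f" "\<iota> f" \<alpha> \<beta>] assms by simp

lemma whisker_right_vcomp [simp]:
  assumes "f \<in> cell1 C" "\<alpha> \<in> cell2 C" "\<beta> \<in> cell2 C" "src2 C \<alpha> = tgt2 C \<beta>"
    "src1 C (src2 C \<beta>) = tgt1 C f"
  shows "(\<alpha> \<bullet> \<beta>) \<star> \<iota> f = (\<alpha> \<star> \<iota> f) \<bullet> (\<beta> \<star> \<iota> f)"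
  using interchange'[of \<alpha> \<beta> "\<iota> f" "\<iota> f"] assms by simp

lemma whisker_left_comp1 [simp]:
  assumes "f \<in> cell1 C" "g \<in> cell1 C" "\<alpha> \<in> cell2 C" "src1 C f = tgt1 C g"
    "src1 C g = tgt1 C (src2 C \<alpha>)"
  shows "\<iota> f \<star> (\<iota> g \<star> \<alpha>) = \<iota> (f \<cdot> g) \<star> \<alpha>"
  using hcomp_assoc'[of "\<iota> f" "\<iota> g" \<alpha>] assms by (simp del: hcomp_assoc')

text \<open>The simplification rules reduce composites to vertical composites of whiskered cells; what
  remains is the freedom to change their order.\<close>

lemma exchange:
  assumes "\<alpha> \<in> cell2 C" "\<beta> \<in> cell2 C" "src1 C (src2 C \<alpha>) = tgt1 C (src2 C \<beta>)"
  shows "(\<alpha> \<star> \<iota> (tgt2 C \<beta>)) \<bullet> (\<iota> (src2 C \<alpha>) \<star> \<beta>) = \<alpha> \<star> \<beta>"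
    and "(\<iota> (tgt2 C \<alpha>) \<star> \<beta>) \<bullet> (\<alpha> \<star> \<iota> (src2 C \<beta>)) = \<alpha> \<star> \<beta>"
  using interchange'[of \<alpha> "\<iota> (src2 C \<alpha>)" "\<iota> (tgt2 C \<beta>)" \<beta>]
    interchange'[of "\<iota> (tgt2 C \<alpha>)" \<alpha> \<beta> "\<iota> (src2 C \<beta>)"] assms
  by (simp_all add: src2_closed tgt2_closed src_globular[symmetric] tgt_globular[symmetric])

end

section \<open>The delooped augmented simplex category\<close>

lemma deloop_simps [simp]:
  "cell0 deloop_simplex = UNIV" "cell1 deloop_simplex = UNIV"
  "src1 deloop_simplex m = ()" "tgt1 deloop_simplex m = ()"
  "src2 deloop_simplex \<phi> = length (snd \<phi>)" "tgt2 deloop_simplex \<phi> = fst \<phi>"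
  "id1 deloop_simplex x = 0" "comp1 deloop_simplex m n = m + n"
  "id2 deloop_simplex m = (m, [0..<m])"
  "vcomp deloop_simplex \<phi> \<psi> = (fst \<phi>, map (\<lambda>y. snd \<phi> ! y) (snd \<psi>))"
  "hcomp deloop_simplex \<phi> \<psi> = (fst \<phi> + fst \<psi>, snd \<phi> @ map (\<lambda>y. fst \<phi> + y) (snd \<psi>))"
  by (simp_all add: deloop_simplex_def split_beta)

lemma cell2_deloop: "(m, xs) \<in> cell2 deloop_simplex \<longleftrightarrow> sorted xs \<and> (\<forall>x\<in>set xs. x < m)"
  by (auto simp: deloop_simplex_def)

lemma id_cell2_deloop [simp]: "(m, [0..<m]) \<in> cell2 deloop_simplex"
  by (simp add: cell2_deloop)

lemma unit_cell2_deloop [simp]: "(m, []) \<in> cell2 deloop_simplex"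
  by (simp add: cell2_deloop)

lemma mult_cell2_deloop [simp]: "(Suc 0, replicate k 0) \<in> cell2 deloop_simplex"
  by (simp add: cell2_deloop sorted_replicate)

lemma mult2_cell2_deloop [simp]: "(Suc 0, [0, 0]) \<in> cell2 deloop_simplex"
  by (simp add: cell2_deloop)

lemma vcomp_deloop_closed:
  assumes "(m, xs) \<in> cell2 deloop_simplex" "(length xs, ys) \<in> cell2 deloop_simplex"
  shows "(m, map ((!) xs) ys) \<in> cell2 deloop_simplex"
  using assms unfolding cell2_deloop
  by (auto simp: sorted_iff_nth_mono)

lemma hcomp_deloop_closed:
  assumes "(m, xs) \<in> cell2 deloop_simplex" "(n, ys) \<in> cell2 deloop_simplex"
  shows "(m + n, xs @ map ((+) m) ys) \<in> cell2 deloop_simplex"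
proof -
  have "sorted (map ((+) m) ys)"
    using assms(2) by (auto simp: cell2_deloop sorted_map intro: sorted_wrt_mono_rel[of ys "(\<le>)"])
  then show ?thesis
    using assms by (fastforce simp: cell2_deloop sorted_append)
qed

lemma strict_2_category_deloop: "strict_2_category deloop_simplex"
proof unfold_locales
  fix \<alpha> \<beta> :: monotone_map and f g h
  assume "\<alpha> \<in> hom2 deloop_simplex g h" "\<beta> \<in> hom2 deloop_simplex f g"
  then show "vcomp deloop_simplex \<alpha> \<beta> \<in> hom2 deloop_simplex f h"
    by (cases \<alpha>; cases \<beta>) (auto simp: hom2_def vcomp_deloop_closed)
next
  fix \<alpha> \<beta> :: monotone_map and f f' g g'
  assume "\<alpha> \<in> hom2 deloop_simplex f f'" "\<beta> \<in> hom2 deloop_simplex g g'"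
  then show "hcomp deloop_simplex \<alpha> \<beta> \<in>
    hom2 deloop_simplex (comp1 deloop_simplex f g) (comp1 deloop_simplex f' g')"
    by (cases \<alpha>; cases \<beta>) (auto simp: hom2_def hcomp_deloop_closed)
next
  fix \<alpha> \<beta> \<gamma> \<delta> :: monotone_map and f f' f'' g g' g''
  assume "\<alpha> \<in> hom2 deloop_simplex f' f''" "\<beta> \<in> hom2 deloop_simplex f f'"
    "\<gamma> \<in> hom2 deloop_simplex g' g''" "\<delta> \<in> hom2 deloop_simplex g g'"
  then show "hcomp deloop_simplex (vcomp deloop_simplex \<alpha> \<beta>) (vcomp deloop_simplex \<gamma> \<delta>) =
    vcomp deloop_simplex (hcomp deloop_simplex \<alpha> \<gamma>) (hcomp deloop_simplex \<beta> \<delta>)"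
    by (cases \<alpha>; cases \<beta>; cases \<gamma>; cases \<delta>) (auto simp: hom2_def cell2_deloop nth_append)
next
  fix f g :: nat and a b c :: unit
  show "hcomp deloop_simplex (id2 deloop_simplex f) (id2 deloop_simplex g) =
    id2 deloop_simplex (comp1 deloop_simplex f g)"
    by (auto simp: nth_append simp del: upt_Suc intro!: nth_equalityI)
next
  fix \<alpha> :: monotone_map and f g
  assume "\<alpha> \<in> hom2 deloop_simplex f g"
  then have "\<forall>x\<in>set (snd \<alpha>). x < fst \<alpha>" and g: "fst \<alpha> = g"
    by (cases \<alpha>; simp add: hom2_def cell2_deloop)+
  then have "map ((!) [0..<fst \<alpha>]) (snd \<alpha>) = snd \<alpha>"
    by (intro map_idI) simp
  then show "vcomp deloop_simplex (id2 deloop_simplex g) \<alpha> = \<alpha>"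
    by (simp add: g[symmetric])
qed (auto simp: hom1_def hom2_def cell2_deloop map_nth)

text \<open>By monotonicity the elements mapped below \<open>p\<close> form an initial segment, so cutting the list of
  values there exhibits the map as an ordinal sum.\<close>

lemma deloop_split:
  assumes "(p + q, ys) \<in> cell2 deloop_simplex"
  obtains ys1 ys2 where "ys = ys1 @ map ((+) p) ys2"
    "(p, ys1) \<in> cell2 deloop_simplex" "(q, ys2) \<in> cell2 deloop_simplex"
proof -
  define ys1 ys2 where "ys1 = takeWhile (\<lambda>y. y < p) ys"
    and "ys2 = dropWhile (\<lambda>y. y < p) ys"
  have ys: "ys = ys1 @ ys2" by (simp add: ys1_def ys2_def)
  have s: "sorted ys1" "sorted ys2" and lt: "\<forall>y\<in>set ys2. y < p + q"
    using assms unfolding ys cell2_deloop by (auto simp: sorted_append)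
  have ge: "p \<le> y" if "y \<in> set ys2" for y
  proof (cases ys2)
    case (Cons z zs)
    then have "\<not> z < p" unfolding ys2_def by (metis dropWhile_eq_Cons_conv)
    with Cons s(2) that show ?thesis by auto
  qed (use that in simp)
  have "ys = ys1 @ map ((+) p) (map (\<lambda>y. y - p) ys2)"
    using ge unfolding ys by (auto simp: map_idI)
  moreover have "(p, ys1) \<in> cell2 deloop_simplex"
    using s(1) set_takeWhileD unfolding cell2_deloop ys1_def by fastforce
  moreover have "(q, map (\<lambda>y. y - p) ys2) \<in> cell2 deloop_simplex"
    using s(2) ge lt unfolding cell2_deloop by (fastforce simp: sorted_iff_nth_mono diff_le_mono)
  ultimately show ?thesis by (rule that)
qed

lemma deloop_Suc:
  assumes "(Suc m, xs) \<in> cell2 deloop_simplex"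
  obtains k xs' where "xs = replicate k 0 @ map Suc xs'" "(m, xs') \<in> cell2 deloop_simplex"
proof -
  obtain ys zs where *: "xs = ys @ map ((+) 1) zs" "(1, ys) \<in> cell2 deloop_simplex"
      "(m, zs) \<in> cell2 deloop_simplex"
    using deloop_split[of 1 m xs] assms by auto
  from *(2) have "\<forall>y\<in>set ys. y = 0" by (auto simp: cell2_deloop)
  then have "ys = replicate (length ys) 0" by (simp add: replicate_length_same)
  moreover have "map ((+) 1) zs = map Suc zs" by simp
  ultimately show ?thesis using that *(1,3) by metis
qed

text \<open>\<open>\<Delta>\<^sub>\<alpha>\<close> is generated as a monoidal category by the monoid \<open>1\<close>: the maps \<open>k \<rightarrow> 1\<close> are
  iterated multiplications, and every map is an ordinal sum of such maps, one for each point of its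
  codomain.\<close>

lemma deloop_induct [consumes 1, case_names unit mult ident vcomp hcomp]:
  assumes "\<phi> \<in> cell2 deloop_simplex"
    and unit: "P (1, [])" and mult: "P (1, [0, 0])" and ident: "\<And>m. P (m, [0..<m])"
    and vcomp: "\<And>\<phi> \<psi>. \<phi> \<in> cell2 deloop_simplex \<Longrightarrow> \<psi> \<in> cell2 deloop_simplex \<Longrightarrow>
      length (snd \<phi>) = fst \<psi> \<Longrightarrow> P \<phi> \<Longrightarrow> P \<psi> \<Longrightarrow> P (vcomp deloop_simplex \<phi> \<psi>)"
    and hcomp: "\<And>\<phi> \<psi>. \<phi> \<in> cell2 deloop_simplex \<Longrightarrow> \<psi> \<in> cell2 deloop_simplex \<Longrightarrow>
      P \<phi> \<Longrightarrow> P \<psi> \<Longrightarrow> P (hcomp deloop_simplex \<phi> \<psi>)"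
  shows "P \<phi>"
proof -
  have rep: "P (1, replicate k 0)" for k
  proof (induction k)
    case (Suc k)
    have "P (2, 0 # map Suc (replicate k 0))"
      using hcomp[of "(1, [0])" "(1, replicate k 0)"] Suc ident[of 1]
        by (simp add: cell2_deloop numeral_2_eq_2)
    then have "P (vcomp deloop_simplex (1, [0, 0]) (2, 0 # map Suc (replicate k 0)))"
      using mult by (intro vcomp) (auto simp: cell2_deloop)
    then show ?case by simp
  qed (use unit in simp)
  have "P (m, xs)" if "(m, xs) \<in> cell2 deloop_simplex" for m xs
    using that
  proof (induction m arbitrary: xs)
    case 0
    then have "xs = []" by (cases xs) (auto simp: cell2_deloop)
    then show ?case using ident[of 0] by simp
  next
    case (Suc m)
    obtain k xs' where xs: "xs = replicate k 0 @ map Suc xs'" "(m, xs') \<in> cell2 deloop_simplex"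
      using Suc.prems by (rule deloop_Suc)
    then have "P (hcomp deloop_simplex (1, replicate k 0) (m, xs'))"
      using Suc.IH rep by (intro hcomp) auto
    then show ?case using xs(1) by simp
  qed
  with assms(1) show ?thesis by (cases \<phi>) simp
qed

section \<open>Monads are 2-functors on the delooped simplex category\<close>

primrec pow1 :: "('o, 'm, 'c) two_cat \<Rightarrow> 'o \<Rightarrow> 'm \<Rightarrow> nat \<Rightarrow> 'm" where
  "pow1 B a t 0 = id1 B a"
| "pow1 B a t (Suc n) = comp1 B t (pow1 B a t n)"

primrec mult_n :: "('o, 'm, 'c) two_cat \<Rightarrow> 'm \<Rightarrow> 'c \<Rightarrow> 'c \<Rightarrow> nat \<Rightarrow> 'c" where
  "mult_n B t \<eta> \<mu> 0 = \<eta>"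
| "mult_n B t \<eta> \<mu> (Suc k) = vcomp B \<mu> (hcomp B (id2 B t) (mult_n B t \<eta> \<mu> k))"

primrec mults :: "('o, 'm, 'c) two_cat \<Rightarrow> 'o \<Rightarrow> 'm \<Rightarrow> 'c \<Rightarrow> 'c \<Rightarrow> nat list \<Rightarrow> 'c" where
  "mults B a t \<eta> \<mu> [] = id2 B (id1 B a)"
| "mults B a t \<eta> \<mu> (k # ks) = hcomp B (mult_n B t \<eta> \<mu> k) (mults B a t \<eta> \<mu> ks)"

text \<open>The sizes of the fibres determine a monotone map. They turn ordinal sum into concatenation of
  lists, which makes the assignment of \<open>monad_map\<close> below visibly compatible with it.\<close>

definition fibres :: "monotone_map \<Rightarrow> nat list" where
  "fibres \<phi> = map (count_list (snd \<phi>)) [0..<fst \<phi>]"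

lemma length_fibres [simp]: "length (fibres \<phi>) = fst \<phi>"
  by (simp add: fibres_def)

lemma count_list_map_plus: "count_list (map ((+) m) ys) j = (if j < m then 0 else count_list ys (j - m))"
  for m :: nat
  by (induction ys) auto

lemma count_list_eq_0: "(\<And>x. x \<in> set xs \<Longrightarrow> x \<noteq> j) \<Longrightarrow> count_list xs j = 0"
  by (metis count_list_0_iff)

lemma fibres_hcomp:
  assumes "(m, xs) \<in> cell2 deloop_simplex"
  shows "fibres (m + n, xs @ map ((+) m) ys) = fibres (m, xs) @ fibres (n, ys)"
proof -
  have "count_list xs j = 0" if "m \<le> j" for j
    using assms that by (auto simp: cell2_deloop intro!: count_list_eq_0)
  then show ?thesis
    unfolding fibres_def
    by (intro nth_equalityI) (auto simp: count_list_map_plus nth_append)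
qed

lemma fibres_Suc:
  "fibres (Suc m, replicate k 0 @ map Suc xs) = k # fibres (m, xs)"
proof -
  have "count_list (replicate k (0::nat)) 0 = k" by (induction k) auto
  then have "fibres (1, replicate k 0) = [k]" by (simp add: fibres_def)
  moreover have "map ((+) 1) xs = map Suc xs" by simp
  ultimately show ?thesis
    using fibres_hcomp[of 1 "replicate k 0" m xs] by (metis One_nat_def append_Cons append_Nil
        mult_cell2_deloop plus_1_eq_Suc)
qed

lemma sum_list_fibres:
  "(m, xs) \<in> cell2 deloop_simplex \<Longrightarrow> sum_list (fibres (m, xs)) = length xs"
proof (induction m arbitrary: xs)
  case 0
  then have "xs = []" by (cases xs) (auto simp: cell2_deloop)
  then show ?case by (simp add: fibres_def)
next
  case (Suc m)
  then obtain k xs' where "xs = replicate k 0 @ map Suc xs'" "(m, xs') \<in> cell2 deloop_simplex"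
    by (elim deloop_Suc)
  with Suc.IH show ?case by (simp add: fibres_Suc)
qed

text \<open>The value at a monotone map of the 2-functor \<open>deloop_simplex \<rightarrow> B\<close> classifying a monad.\<close>

definition monad_map :: "('o, 'm, 'c) two_cat \<Rightarrow> 'o \<Rightarrow> 'm \<Rightarrow> 'c \<Rightarrow> 'c \<Rightarrow> monotone_map \<Rightarrow> 'c" where
  "monad_map B a t \<eta> \<mu> \<phi> = mults B a t \<eta> \<mu> (fibres \<phi>)"

locale monad_in = strict_2_category B + monad_on B a t \<eta> \<mu>
  for B :: "('o, 'm, 'c) two_cat" (structure) and a t \<eta> \<mu>
begin

abbreviation "pow \<equiv> pow1 B a t"
abbreviation "mun \<equiv> mult_n B t \<eta> \<mu>"
abbreviation "muns \<equiv> mults B a t \<eta> \<mu>"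
abbreviation "mon \<equiv> monad_map B a t \<eta> \<mu>"

lemma cells [simp]:
  "a \<in> cell0 B" "t \<in> cell1 B" "src1 B t = a" "tgt1 B t = a"
  "\<eta> \<in> cell2 B" "src2 B \<eta> = \<one> a" "tgt2 B \<eta> = t"
  "\<mu> \<in> cell2 B" "src2 B \<mu> = t \<cdot> t" "tgt2 B \<mu> = t"
  using object endo unit mult by (auto simp: hom1_def hom2_def)

lemma pow [simp]: "pow n \<in> cell1 B" "src1 B (pow n) = a" "tgt1 B (pow n) = a"
  by (induction n) simp_all

lemma pow_add [simp]: "pow (m + n) = pow m \<cdot> pow n"
  by (induction m) simp_all

lemma mun [simp]: "mun k \<in> cell2 B" "src2 B (mun k) = pow k" "tgt2 B (mun k) = t"
  by (induction k) simp_all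

lemma muns [simp]: "muns ks \<in> cell2 B" "src2 B (muns ks) = pow (sum_list ks)"
  "tgt2 B (muns ks) = pow (length ks)"
  by (induction ks) simp_all

lemma muns_append: "muns (ks @ ls) = muns ks \<star> muns ls"
  by (induction ks) simp_all

text \<open>The case of two blocks of the general associative law \<open>mun_muns\<close>.\<close>

lemma mun_add: "\<mu> \<bullet> (mun k \<star> mun l) = mun (k + l)"
proof (induction k)
  case 0
  have "\<mu> \<bullet> (\<eta> \<star> mun l) = \<mu> \<bullet> ((\<eta> \<star> \<iota> t) \<bullet> mun l)"
    using exchange(1)[of \<eta> "mun l"] by simp
  also have "\<dots> = (\<mu> \<bullet> (\<eta> \<star> \<iota> t)) \<bullet> mun l" by (subst vcomp_assoc') simp_all
  also have "\<dots> = mun l" by (simp add: unit_left)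
  finally show ?case by simp
next
  case (Suc k)
  have "\<mu> \<bullet> (mun (Suc k) \<star> mun l) = \<mu> \<bullet> ((\<mu> \<star> \<iota> t) \<bullet> (\<iota> t \<star> (mun k \<star> mun l)))"
    using interchange'[of \<mu> "\<iota> t \<star> mun k" "\<iota> t" "mun l"] by simp
  also have "\<dots> = (\<mu> \<bullet> (\<mu> \<star> \<iota> t)) \<bullet> (\<iota> t \<star> (mun k \<star> mun l))" by (subst vcomp_assoc') simp_all
  also have "\<dots> = \<mu> \<bullet> (\<iota> t \<star> (\<mu> \<bullet> (mun k \<star> mun l)))" by (simp add: assoc)
  finally show ?case by (simp add: Suc)
qed

lemma mun_muns: "mun (length ks) \<bullet> muns ks = mun (sum_list ks)"
proof (induction ks)
  case (Cons k ks)
  have "mun (length (k # ks)) \<bullet> muns (k # ks)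
      = \<mu> \<bullet> ((\<iota> t \<star> mun (length ks)) \<bullet> (mun k \<star> muns ks))"
    by simp
  also have "\<dots> = \<mu> \<bullet> (mun k \<star> (mun (length ks) \<bullet> muns ks))"
    using interchange'[of "\<iota> t" "mun k" "mun (length ks)" "muns ks"] by simp
  also have "\<dots> = mun (sum_list (k # ks))" by (simp add: Cons mun_add)
  finally show ?case .
qed simp

lemma mon [simp]:
  assumes "\<phi> \<in> cell2 deloop_simplex"
  shows "mon \<phi> \<in> cell2 B" "src2 B (mon \<phi>) = pow (length (snd \<phi>))" "tgt2 B (mon \<phi>) = pow (fst \<phi>)"
  using assms sum_list_fibres[of "fst \<phi>" "snd \<phi>"] by (simp_all add: monad_map_def)

lemma mon_hcomp:
  assumes "(m, xs) \<in> cell2 deloop_simplex"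
  shows "mon (m + n, xs @ map ((+) m) ys) = mon (m, xs) \<star> mon (n, ys)"
  by (simp add: monad_map_def fibres_hcomp[OF assms] muns_append)

lemma mon_unit [simp]: "mon (Suc 0, []) = \<eta>"
  by (simp add: monad_map_def fibres_def)

lemma mon_mult [simp]: "mon (Suc 0, [0, 0]) = \<mu>"
  by (simp add: monad_map_def fibres_def unit_right)

lemma mon_id [simp]: "mon (m, [0..<m]) = \<iota> (pow m)"
proof (induction m)
  case 0
  show ?case by (simp add: monad_map_def fibres_def)
next
  case (Suc m)
  have "fibres (Suc m, [0..<Suc m]) = 1 # fibres (m, [0..<m])"
    using fibres_Suc[of m 1 "[0..<m]"] by (simp add: map_Suc_upt upt_conv_Cons del: upt_Suc)
  with Suc show ?case by (simp add: monad_map_def unit_right)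
qed

text \<open>Induction on the codomain: the first point of the codomain splits off an iterated
  multiplication from the left-hand map, and the preimage of its fibre splits off a summand of the
  right-hand map.\<close>

lemma mon_vcomp:
  "(m, xs) \<in> cell2 deloop_simplex \<Longrightarrow> (length xs, ys) \<in> cell2 deloop_simplex \<Longrightarrow>
    mon (m, map ((!) xs) ys) = mon (m, xs) \<bullet> mon (length xs, ys)"
proof (induction m arbitrary: xs ys)
  case 0
  then have "xs = []" "ys = []" by (cases xs; cases ys; auto simp: cell2_deloop)+
  then show ?case by (simp add: monad_map_def fibres_def)
next
  case (Suc m)
  obtain k xs' where xs: "xs = replicate k 0 @ map Suc xs'" and xs': "(m, xs') \<in> cell2 deloop_simplex"
    using Suc.prems(1) by (rule deloop_Suc)
  obtain ys1 ys2 where ys: "ys = ys1 @ map ((+) k) ys2" and ys1: "(k, ys1) \<in> cell2 deloop_simplex"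
      and ys2: "(length xs', ys2) \<in> cell2 deloop_simplex"
    using deloop_split[of k "length xs'" ys] Suc.prems(2) xs by auto
  have len: "length xs = k + length xs'" by (simp add: xs)
  have "map ((!) xs) ys1 = map (\<lambda>_. 0) ys1"
    using ys1 by (intro map_cong) (auto simp: xs nth_append cell2_deloop)
  moreover have "map ((!) xs) (map ((+) k) ys2) = map Suc (map ((!) xs') ys2)"
    using ys2 by (auto simp: xs nth_append cell2_deloop)
  ultimately have "map ((!) xs) ys = replicate (length ys1) 0 @ map Suc (map ((!) xs') ys2)"
    by (simp only: ys map_append map_replicate_const)
  then have "mon (Suc m, map ((!) xs) ys) = mun (length ys1) \<star> mon (m, map ((!) xs') ys2)"
    by (simp only: monad_map_def fibres_Suc mults.simps)
  also have "mun (length ys1) = mun k \<bullet> mon (k, ys1)"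
    using mun_muns[of "fibres (k, ys1)"]
    by (simp only: sum_list_fibres[OF ys1] monad_map_def length_fibres fst_conv)
  also have "mon (m, map ((!) xs') ys2) = mon (m, xs') \<bullet> mon (length xs', ys2)"
    by (rule Suc.IH[OF xs' ys2])
  also have "(mun k \<bullet> mon (k, ys1)) \<star> (mon (m, xs') \<bullet> mon (length xs', ys2))
      = (mun k \<star> mon (m, xs')) \<bullet> (mon (k, ys1) \<star> mon (length xs', ys2))"
    by (rule interchange') (use ys1 ys2 xs' in simp_all)
  also have "mun k \<star> mon (m, xs') = mon (Suc m, xs)"
    by (simp only: xs monad_map_def fibres_Suc mults.simps)
  also have "mon (k, ys1) \<star> mon (length xs', ys2) = mon (length xs, ys)"
    by (simp only: ys mon_hcomp[OF ys1] len)
  finally show ?case .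
qed

end

section \<open>The 2-category of monads\<close>

context strict_2_category
begin

lemma vcomp_eq_extend:
  assumes "\<alpha> \<bullet> \<beta> = \<gamma> \<bullet> \<delta>" "\<alpha> \<in> cell2 C" "\<beta> \<in> cell2 C" "\<gamma> \<in> cell2 C" "\<delta> \<in> cell2 C" "\<xi> \<in> cell2 C"
    "src2 C \<alpha> = tgt2 C \<beta>" "src2 C \<gamma> = tgt2 C \<delta>" "src2 C \<beta> = tgt2 C \<xi>" "src2 C \<delta> = tgt2 C \<xi>"
  shows "\<alpha> \<bullet> (\<beta> \<bullet> \<xi>) = \<gamma> \<bullet> (\<delta> \<bullet> \<xi>)"
  using assms vcomp_assoc'[of \<alpha> \<beta> \<xi>] vcomp_assoc'[of \<gamma> \<delta> \<xi>] by (simp del: vcomp_assoc')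

lemma slide:
  assumes "\<alpha> \<in> cell2 C" "\<beta> \<in> cell2 C" "src1 C (src2 C \<alpha>) = tgt1 C (src2 C \<beta>)"
    "f = src2 C \<alpha>" "f' = tgt2 C \<alpha>" "g = src2 C \<beta>" "g' = tgt2 C \<beta>"
  shows "(\<alpha> \<star> \<iota> g') \<bullet> (\<iota> f \<star> \<beta>) = (\<iota> f' \<star> \<beta>) \<bullet> (\<alpha> \<star> \<iota> g)"
  using exchange[of \<alpha> \<beta>] assms by simp

end

text \<open>The direction of \<open>\<sigma>\<close> is that of a distributive law of \<open>f\<close> over the monads: two of the axioms of
  a distributive law of \<open>s\<close> over \<open>t\<close> state that it is a monad opfunctor from \<open>t\<close> to itself with
  underlying 1-cell \<open>s\<close>.\<close>

locale monad_opfunctor =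
  strict_2_category B + S: monad_in B a t \<eta> \<mu> + T: monad_in B b u \<eta>' \<mu>'
  for B :: "('o, 'm, 'c) two_cat" (structure) and a t \<eta> \<mu> b u \<eta>' \<mu>' +
  fixes f :: 'm and \<sigma> :: 'c
  assumes und: "f \<in> hom1 B a b"
    and law: "\<sigma> \<in> hom2 B (f \<cdot> t) (u \<cdot> f)"
    and law_unit: "\<sigma> \<bullet> (\<iota> f \<star> \<eta>) = \<eta>' \<star> \<iota> f"
    and law_mult: "\<sigma> \<bullet> (\<iota> f \<star> \<mu>) = (\<mu>' \<star> \<iota> f) \<bullet> (\<iota> u \<star> \<sigma>) \<bullet> (\<sigma> \<star> \<iota> t)"
begin

lemma cells [simp]:
  "f \<in> cell1 B" "src1 B f = a" "tgt1 B f = b"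
  "\<sigma> \<in> cell2 B" "src2 B \<sigma> = f \<cdot> t" "tgt2 B \<sigma> = u \<cdot> f"
  using und law by (auto simp: hom1_def hom2_def)

end

lemma (in monad_in) id_opfunctor: "monad_opfunctor B a t \<eta> \<mu> a t \<eta> \<mu> (\<one> a) (\<iota> t)"
  by unfold_locales (simp_all add: hom1_def hom2_def)

lemma comp_opfunctor:
  fixes B (structure)
  assumes F: "monad_opfunctor B a t \<eta> \<mu> b u \<eta>' \<mu>' f \<sigma>"
    and G: "monad_opfunctor B b u \<eta>' \<mu>' c v \<eta>'' \<mu>'' g \<tau>"
  shows "monad_opfunctor B a t \<eta> \<mu> c v \<eta>'' \<mu>'' (g \<cdot> f) ((\<tau> \<star> \<iota> f) \<bullet> (\<iota> g \<star> \<sigma>))"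
proof -
  interpret F: monad_opfunctor B a t \<eta> \<mu> b u \<eta>' \<mu>' f \<sigma> by fact
  interpret G: monad_opfunctor B b u \<eta>' \<mu>' c v \<eta>'' \<mu>'' g \<tau> by fact
  show ?thesis
  proof
    show "g \<cdot> f \<in> hom1 B a c" by (simp add: hom1_def)
    show "(\<tau> \<star> \<iota> f) \<bullet> (\<iota> g \<star> \<sigma>) \<in> hom2 B (g \<cdot> f \<cdot> t) (v \<cdot> (g \<cdot> f))" by (simp add: hom2_def)
    have "(\<tau> \<star> \<iota> f) \<bullet> (\<iota> g \<star> \<sigma>) \<bullet> (\<iota> (g \<cdot> f) \<star> \<eta>) = (\<tau> \<star> \<iota> f) \<bullet> (\<iota> g \<star> (\<sigma> \<bullet> (\<iota> f \<star> \<eta>)))"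
      by simp
    also have "\<dots> = (\<tau> \<bullet> (\<iota> g \<star> \<eta>')) \<star> \<iota> f" by (simp add: F.law_unit)
    also have "\<dots> = \<eta>'' \<star> \<iota> (g \<cdot> f)" by (simp add: G.law_unit)
    finally show "(\<tau> \<star> \<iota> f) \<bullet> (\<iota> g \<star> \<sigma>) \<bullet> (\<iota> (g \<cdot> f) \<star> \<eta>) = \<eta>'' \<star> \<iota> (g \<cdot> f)" .
    have "(\<tau> \<star> \<iota> f) \<bullet> (\<iota> g \<star> \<sigma>) \<bullet> (\<iota> (g \<cdot> f) \<star> \<mu>) = (\<tau> \<star> \<iota> f) \<bullet> (\<iota> g \<star> (\<sigma> \<bullet> (\<iota> f \<star> \<mu>)))"
      by simp
    also have "\<dots> = ((\<tau> \<bullet> (\<iota> g \<star> \<mu>')) \<star> \<iota> f) \<bullet> ((\<iota> (g \<cdot> u) \<star> \<sigma>) \<bullet> (\<iota> g \<star> \<sigma> \<star> \<iota> t))"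
      by (simp add: F.law_mult)
    also have "\<dots> = (\<mu>'' \<star> \<iota> (g \<cdot> f)) \<bullet> ((\<iota> v \<star> (\<tau> \<star> \<iota> f)) \<bullet>
        ((\<tau> \<star> \<iota> (u \<cdot> f)) \<bullet> ((\<iota> (g \<cdot> u) \<star> \<sigma>) \<bullet> (\<iota> g \<star> \<sigma> \<star> \<iota> t))))"
      by (simp add: G.law_mult)
    \<comment> \<open>the middle instances of \<open>\<tau>\<close> and \<open>\<sigma>\<close> act on disjoint factors\<close>
    also have "(\<tau> \<star> \<iota> (u \<cdot> f)) \<bullet> ((\<iota> (g \<cdot> u) \<star> \<sigma>) \<bullet> (\<iota> g \<star> \<sigma> \<star> \<iota> t))
        = (\<iota> (v \<cdot> g) \<star> \<sigma>) \<bullet> ((\<tau> \<star> \<iota> (f \<cdot> t)) \<bullet> (\<iota> g \<star> \<sigma> \<star> \<iota> t))"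
      by (rule F.vcomp_eq_extend[OF F.slide]) simp_all
    finally show "(\<tau> \<star> \<iota> f) \<bullet> (\<iota> g \<star> \<sigma>) \<bullet> (\<iota> (g \<cdot> f) \<star> \<mu>) =
        (\<mu>'' \<star> \<iota> (g \<cdot> f)) \<bullet> (\<iota> v \<star> ((\<tau> \<star> \<iota> f) \<bullet> (\<iota> g \<star> \<sigma>))) \<bullet>
        (((\<tau> \<star> \<iota> f) \<bullet> (\<iota> g \<star> \<sigma>)) \<star> \<iota> t)"
      by simp
  qed
qed

text \<open>Types of cells that are closed under forming monads, so that \<open>monads\<close> can be iterated. The first
  constructor of each embeds the cells of a given 2-category. The second one builds a monad
  (object, endo-1-cell, unit, multiplication), a monad opfunctor, and a 2-cell between monad
  opfunctors.\<close>

datatype ('o, 'm, 'c) obj =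
    Obj (un_Obj: 'o)
  | Mon (ob: "('o, 'm, 'c) obj") (en: "('o, 'm, 'c) arr") (unt: "('o, 'm, 'c) cel")
      (mlt: "('o, 'm, 'c) cel")
and ('o, 'm, 'c) arr =
    Arr (un_Arr: 'm)
  | Opf (adom: "('o, 'm, 'c) obj") (acod: "('o, 'm, 'c) obj") (und1: "('o, 'm, 'c) arr")
      (law: "('o, 'm, 'c) cel")
and ('o, 'm, 'c) cel =
    Cel (un_Cel: 'c)
  | Tra (cdom: "('o, 'm, 'c) arr") (ccod: "('o, 'm, 'c) arr") (und2: "('o, 'm, 'c) cel")

type_synonym ('o, 'm, 'c) tower = "(('o, 'm, 'c) obj, ('o, 'm, 'c) arr, ('o, 'm, 'c) cel) two_cat"

definition monad_obj :: "('o, 'm, 'c) tower \<Rightarrow> ('o, 'm, 'c) obj \<Rightarrow> bool" where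
  "monad_obj B X \<longleftrightarrow> X = Mon (ob X) (en X) (unt X) (mlt X) \<and>
    monad_in B (ob X) (en X) (unt X) (mlt X)"

definition monad_arr :: "('o, 'm, 'c) tower \<Rightarrow> ('o, 'm, 'c) arr \<Rightarrow> bool" where
  "monad_arr B F \<longleftrightarrow> F = Opf (adom F) (acod F) (und1 F) (law F) \<and>
    monad_obj B (adom F) \<and> monad_obj B (acod F) \<and>
    monad_opfunctor B (ob (adom F)) (en (adom F)) (unt (adom F)) (mlt (adom F))
      (ob (acod F)) (en (acod F)) (unt (acod F)) (mlt (acod F)) (und1 F) (law F)"

definition monad_cel :: "('o, 'm, 'c) tower \<Rightarrow> ('o, 'm, 'c) cel \<Rightarrow> bool" where
  "monad_cel B \<phi> \<longleftrightarrow> \<phi> = Tra (cdom \<phi>) (ccod \<phi>) (und2 \<phi>) \<and>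
    monad_arr B (cdom \<phi>) \<and> monad_arr B (ccod \<phi>) \<and>
    adom (cdom \<phi>) = adom (ccod \<phi>) \<and> acod (cdom \<phi>) = acod (ccod \<phi>) \<and>
    und2 \<phi> \<in> hom2 B (und1 (cdom \<phi>)) (und1 (ccod \<phi>)) \<and>
    vcomp B (law (ccod \<phi>)) (hcomp B (und2 \<phi>) (id2 B (en (adom (cdom \<phi>))))) =
    vcomp B (hcomp B (id2 B (en (acod (cdom \<phi>)))) (und2 \<phi>)) (law (cdom \<phi>))"

definition monad_id1 :: "('o, 'm, 'c) tower \<Rightarrow> ('o, 'm, 'c) obj \<Rightarrow> ('o, 'm, 'c) arr" where
  "monad_id1 B X = Opf X X (id1 B (ob X)) (id2 B (en X))"

definition monad_comp1 ::
  "('o, 'm, 'c) tower \<Rightarrow> ('o, 'm, 'c) arr \<Rightarrow> ('o, 'm, 'c) arr \<Rightarrow> ('o, 'm, 'c) arr" where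
  "monad_comp1 B G F = Opf (adom F) (acod G) (comp1 B (und1 G) (und1 F))
    (vcomp B (hcomp B (law G) (id2 B (und1 F))) (hcomp B (id2 B (und1 G)) (law F)))"

definition monads :: "('o, 'm, 'c) tower \<Rightarrow> ('o, 'm, 'c) tower" where
  "monads B = \<lparr>
     cell0 = Collect (monad_obj B), cell1 = Collect (monad_arr B), cell2 = Collect (monad_cel B),
     src1 = adom, tgt1 = acod, src2 = cdom, tgt2 = ccod,
     id1 = monad_id1 B,
     comp1 = monad_comp1 B,
     id2 = (\<lambda>F. Tra F F (id2 B (und1 F))),
     vcomp = (\<lambda>\<psi> \<phi>. Tra (cdom \<phi>) (ccod \<psi>) (vcomp B (und2 \<psi>) (und2 \<phi>))),
     hcomp = (\<lambda>\<psi> \<phi>. Tra (monad_comp1 B (cdom \<psi>) (cdom \<phi>)) (monad_comp1 B (ccod \<psi>) (ccod \<phi>))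
       (hcomp B (und2 \<psi>) (und2 \<phi>)))\<rparr>"

lemma monads_simps [simp]:
  "cell0 (monads B) = Collect (monad_obj B)" "cell1 (monads B) = Collect (monad_arr B)"
  "cell2 (monads B) = Collect (monad_cel B)"
  "src1 (monads B) = adom" "tgt1 (monads B) = acod" "src2 (monads B) = cdom" "tgt2 (monads B) = ccod"
  "id1 (monads B) X = monad_id1 B X"
  "comp1 (monads B) G F = monad_comp1 B G F"
  "id2 (monads B) F = Tra F F (id2 B (und1 F))"
  "vcomp (monads B) \<psi> \<phi> = Tra (cdom \<phi>) (ccod \<psi>) (vcomp B (und2 \<psi>) (und2 \<phi>))"
  "hcomp (monads B) \<psi> \<phi> = Tra (monad_comp1 B (cdom \<psi>) (cdom \<phi>)) (monad_comp1 B (ccod \<psi>) (ccod \<phi>))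
     (hcomp B (und2 \<psi>) (und2 \<phi>))"
  by (simp_all add: monads_def)

context
  fixes B :: "('o, 'm, 'c) tower" (structure)
  assumes B: "strict_2_category B"
begin

interpretation strict_2_category B by (rule B)

lemma monad_objD: "monad_obj B X \<Longrightarrow> monad_in B (ob X) (en X) (unt X) (mlt X)"
  by (simp only: monad_obj_def)

lemma monad_arrD:
  "monad_arr B F \<Longrightarrow>
    monad_opfunctor B (ob (adom F)) (en (adom F)) (unt (adom F)) (mlt (adom F))
      (ob (acod F)) (en (acod F)) (unt (acod F)) (mlt (acod F)) (und1 F) (law F)"
  by (simp only: monad_arr_def)

lemma monad_obj_cells [simp]:
  assumes "monad_obj B X"
  shows "ob X \<in> cell0 B" "en X \<in> cell1 B" "src1 B (en X) = ob X" "tgt1 B (en X) = ob X"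
    "unt X \<in> cell2 B" "src2 B (unt X) = \<one> (ob X)" "tgt2 B (unt X) = en X"
    "mlt X \<in> cell2 B" "src2 B (mlt X) = en X \<cdot> en X" "tgt2 B (mlt X) = en X"
  using monad_in.cells[OF monad_objD[OF assms]] by simp_all

lemma monad_arr_cells [simp]:
  assumes "monad_arr B F"
  shows "monad_obj B (adom F)" "monad_obj B (acod F)"
    "und1 F \<in> cell1 B" "src1 B (und1 F) = ob (adom F)" "tgt1 B (und1 F) = ob (acod F)"
    "law F \<in> cell2 B" "src2 B (law F) = und1 F \<cdot> en (adom F)"
    "tgt2 B (law F) = en (acod F) \<cdot> und1 F"
  using monad_opfunctor.cells[OF monad_arrD[OF assms]] assms by (simp_all only: monad_arr_def)

lemma monad_cel_cells [simp]:
  assumes "monad_cel B \<phi>"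
  shows "monad_arr B (cdom \<phi>)" "monad_arr B (ccod \<phi>)"
    "adom (ccod \<phi>) = adom (cdom \<phi>)" "acod (ccod \<phi>) = acod (cdom \<phi>)"
    "und2 \<phi> \<in> cell2 B" "src2 B (und2 \<phi>) = und1 (cdom \<phi>)" "tgt2 B (und2 \<phi>) = und1 (ccod \<phi>)"
  using assms unfolding monad_cel_def by (simp_all add: hom2_def)

lemma monad_cel_law:
  assumes "monad_cel B \<phi>"
  shows "law (ccod \<phi>) \<bullet> (und2 \<phi> \<star> \<iota> (en (adom (cdom \<phi>)))) =
    (\<iota> (en (acod (cdom \<phi>))) \<star> und2 \<phi>) \<bullet> law (cdom \<phi>)"
  using assms unfolding monad_cel_def by blast

lemma monad_id1 [simp]:
  "adom (monad_id1 B X) = X" "acod (monad_id1 B X) = X" "und1 (monad_id1 B X) = \<one> (ob X)"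
  "law (monad_id1 B X) = \<iota> (en X)"
  "monad_obj B X \<Longrightarrow> monad_arr B (monad_id1 B X)"
  by (simp_all add: monad_arr_def monad_id1_def monad_in.id_opfunctor monad_objD)

lemma monad_comp1 [simp]:
  "adom (monad_comp1 B G F) = adom F" "acod (monad_comp1 B G F) = acod G"
  "und1 (monad_comp1 B G F) = und1 G \<cdot> und1 F"
  "law (monad_comp1 B G F) = (law G \<star> \<iota> (und1 F)) \<bullet> (\<iota> (und1 G) \<star> law F)"
  by (simp_all add: monad_comp1_def)

lemma monad_arr_comp1 [simp]:
  assumes "monad_arr B F" "monad_arr B G" "adom G = acod F"
  shows "monad_arr B (monad_comp1 B G F)"
  using comp_opfunctor[OF monad_arrD[OF assms(1)]] monad_arrD[OF assms(2)] assms
  by (simp add: monad_arr_def[of B "monad_comp1 _ _ _"]) (simp add: monad_comp1_def)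

lemma monad_arr_eqI:
  "monad_arr B F \<Longrightarrow> monad_arr B G \<Longrightarrow> adom F = adom G \<Longrightarrow> acod F = acod G \<Longrightarrow>
    und1 F = und1 G \<Longrightarrow> law F = law G \<Longrightarrow> F = G"
  by (metis monad_arr_def)

lemma monad_vcomp:
  assumes "monad_cel B \<psi>" "monad_cel B \<phi>" "cdom \<psi> = ccod \<phi>"
  shows "monad_cel B (Tra (cdom \<phi>) (ccod \<psi>) (und2 \<psi> \<bullet> und2 \<phi>))"
proof -
  let ?t = "en (adom (cdom \<phi>))" and ?u = "en (acod (cdom \<phi>))"
  have *: "adom (cdom \<psi>) = adom (cdom \<phi>)" "acod (cdom \<psi>) = acod (cdom \<phi>)"
    using assms by simp_all
  have "law (ccod \<psi>) \<bullet> ((und2 \<psi> \<bullet> und2 \<phi>) \<star> \<iota> ?t)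
      = law (ccod \<psi>) \<bullet> ((und2 \<psi> \<star> \<iota> ?t) \<bullet> (und2 \<phi> \<star> \<iota> ?t))"
    using assms * by simp
  also have "\<dots> = (\<iota> ?u \<star> und2 \<psi>) \<bullet> (law (ccod \<phi>) \<bullet> (und2 \<phi> \<star> \<iota> ?t))"
    using monad_cel_law[OF assms(1)] assms * by (intro vcomp_eq_extend) simp_all
  also have "\<dots> = (\<iota> ?u \<star> (und2 \<psi> \<bullet> und2 \<phi>)) \<bullet> law (cdom \<phi>)"
    using monad_cel_law[OF assms(2)] assms * by simp
  finally show ?thesis
    using assms * by (simp add: monad_cel_def[of B "Tra _ _ _"] hom2_def)
qed

lemma monad_hcomp:
  assumes "monad_cel B \<psi>" "monad_cel B \<phi>" "adom (cdom \<psi>) = acod (cdom \<phi>)"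
  shows "monad_cel B (Tra (monad_comp1 B (cdom \<psi>) (cdom \<phi>)) (monad_comp1 B (ccod \<psi>) (ccod \<phi>))
    (und2 \<psi> \<star> und2 \<phi>))"
proof -
  let ?t = "en (adom (cdom \<phi>))" and ?u = "en (acod (cdom \<phi>))" and ?v = "en (acod (cdom \<psi>))"
  let ?f = "und1 (cdom \<phi>)" and ?f' = "und1 (ccod \<phi>)" and ?g = "und1 (cdom \<psi>)" and ?g' = "und1 (ccod \<psi>)"
  have "(law (ccod \<psi>) \<star> \<iota> ?f') \<bullet> (\<iota> ?g' \<star> law (ccod \<phi>)) \<bullet> (und2 \<psi> \<star> und2 \<phi> \<star> \<iota> ?t)
      = (law (ccod \<psi>) \<star> \<iota> ?f') \<bullet> (und2 \<psi> \<star> (law (ccod \<phi>) \<bullet> (und2 \<phi> \<star> \<iota> ?t)))"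
    using assms interchange'[of "\<iota> ?g'" "und2 \<psi>" "law (ccod \<phi>)" "und2 \<phi> \<star> \<iota> ?t"] by simp
  also have "\<dots> = (law (ccod \<psi>) \<star> \<iota> ?f') \<bullet> (und2 \<psi> \<star> ((\<iota> ?u \<star> und2 \<phi>) \<bullet> law (cdom \<phi>)))"
    using monad_cel_law[OF assms(2)] by simp
  also have "\<dots> = (law (ccod \<psi>) \<star> \<iota> ?f') \<bullet> ((und2 \<psi> \<star> \<iota> ?u \<star> und2 \<phi>) \<bullet> (\<iota> ?g \<star> law (cdom \<phi>)))"
    using assms interchange'[of "und2 \<psi>" "\<iota> ?g" "\<iota> ?u \<star> und2 \<phi>" "law (cdom \<phi>)"] by simp
  also have "\<dots> = ((law (ccod \<psi>) \<bullet> (und2 \<psi> \<star> \<iota> ?u)) \<star> und2 \<phi>) \<bullet> (\<iota> ?g \<star> law (cdom \<phi>))"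
    using assms interchange'[of "law (ccod \<psi>)" "und2 \<psi> \<star> \<iota> ?u" "\<iota> ?f'" "und2 \<phi>"] by simp
  also have "\<dots> = (((\<iota> ?v \<star> und2 \<psi>) \<bullet> law (cdom \<psi>)) \<star> und2 \<phi>) \<bullet> (\<iota> ?g \<star> law (cdom \<phi>))"
    using monad_cel_law[OF assms(1)] assms by simp
  also have "\<dots> = (\<iota> ?v \<star> und2 \<psi> \<star> und2 \<phi>) \<bullet> ((law (cdom \<psi>) \<star> \<iota> ?f) \<bullet> (\<iota> ?g \<star> law (cdom \<phi>)))"
    using assms interchange'[of "\<iota> ?v \<star> und2 \<psi>" "law (cdom \<psi>)" "und2 \<phi>" "\<iota> ?f"] by simp
  finally show ?thesis
    using assms by (simp add: monad_cel_def[of B "Tra _ _ _"] hom2_def)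
qed

lemma monad_comp1_assoc:
  assumes "monad_arr B F" "monad_arr B G" "monad_arr B H" "adom F = acod G" "adom G = acod H"
  shows "monad_comp1 B (monad_comp1 B F G) H = monad_comp1 B F (monad_comp1 B G H)"
  by (rule monad_arr_eqI) (use assms in simp_all)

lemma monad_comp1_unit:
  assumes "monad_arr B F"
  shows "acod F = Y \<Longrightarrow> monad_comp1 B (monad_id1 B Y) F = F"
    and "adom F = X \<Longrightarrow> monad_comp1 B F (monad_id1 B X) = F"
  by (rule monad_arr_eqI; use assms in force)+

lemma monad_cel_eqI:
  "monad_cel B \<phi> \<Longrightarrow> Tra (cdom \<phi>) (ccod \<phi>) (und2 \<phi>) = \<phi>"
  by (metis monad_cel_def)

lemma monad_id2: "monad_arr B F \<Longrightarrow> monad_cel B (Tra F F (\<iota> (und1 F)))"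
  by (simp add: monad_cel_def hom2_def)

lemma strict_2_category_monads: "strict_2_category (monads B)"
proof unfold_locales
  fix F assume "F \<in> cell1 (monads B)"
  then show "id2 (monads B) F \<in> hom2 (monads B) F F"
    by (simp add: hom2_def monad_id2)
next
  fix X Y F assume "F \<in> hom1 (monads B) X Y"
  then show "comp1 (monads B) (id1 (monads B) Y) F = F" "comp1 (monads B) F (id1 (monads B) X) = F"
    by (simp_all add: hom1_def monad_comp1_unit)
next
  fix X Y F G \<phi>
  assume "\<phi> \<in> hom2 (monads B) F G" "F \<in> hom1 (monads B) X Y"
  then show "hcomp (monads B) (id2 (monads B) (id1 (monads B) Y)) \<phi> = \<phi>"
    "hcomp (monads B) \<phi> (id2 (monads B) (id1 (monads B) X)) = \<phi>"
    by (auto simp: hom1_def hom2_def monad_comp1_unit monad_cel_eqI)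
next
  fix \<alpha> \<beta> \<gamma> \<delta> and f f' f'' g g' g''
  assume "\<alpha> \<in> hom2 (monads B) f' f''" "\<beta> \<in> hom2 (monads B) f f'"
    "\<gamma> \<in> hom2 (monads B) g' g''" "\<delta> \<in> hom2 (monads B) g g'"
    "src1 (monads B) f = tgt1 (monads B) g"
  then show "hcomp (monads B) (vcomp (monads B) \<alpha> \<beta>) (vcomp (monads B) \<gamma> \<delta>) =
    vcomp (monads B) (hcomp (monads B) \<alpha> \<gamma>) (hcomp (monads B) \<beta> \<delta>)"
    by (auto simp: hom2_def interchange')
qed (auto simp: hom1_def hom2_def monad_vcomp monad_hcomp monad_comp1_assoc monad_cel_eqI)

end

section \<open>Iterating the law of a monad opfunctor\<close>

text \<open>A monad opfunctor gives a lax transformation between the 2-functors on \<open>deloop_simplex\<close>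
  that classify the two monads; \<open>law_n\<close> is its component at the ordinal with \<open>n\<close> elements.\<close>

primrec law_n :: "('o, 'm, 'c) two_cat \<Rightarrow> 'o \<Rightarrow> 'm \<Rightarrow> 'm \<Rightarrow> 'm \<Rightarrow> 'c \<Rightarrow> nat \<Rightarrow> 'c" where
  "law_n B a t u f \<sigma> 0 = id2 B f"
| "law_n B a t u f \<sigma> (Suc n) =
    vcomp B (hcomp B (id2 B u) (law_n B a t u f \<sigma> n)) (hcomp B \<sigma> (id2 B (pow1 B a t n)))"

context monad_opfunctor
begin

abbreviation "lawn \<equiv> law_n B a t u f \<sigma>"

lemma lawn [simp]: "lawn n \<in> cell2 B" "src2 B (lawn n) = f \<cdot> S.pow n" "tgt2 B (lawn n) = T.pow n \<cdot> f"
  by (induction n) simp_all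

lemma lawn_add: "lawn (m + n) = (\<iota> (T.pow m) \<star> lawn n) \<bullet> (lawn m \<star> \<iota> (S.pow n))"
  by (induction m) simp_all

text \<open>The axioms of a monad opfunctor are naturality for the two generators of \<open>\<Delta>\<^sub>\<alpha>\<close>, and naturality
  is inherited by composites.\<close>

lemma lawn_natural:
  assumes "\<psi> \<in> cell2 deloop_simplex"
  shows "lawn (fst \<psi>) \<bullet> (\<iota> f \<star> S.mon \<psi>) = (T.mon \<psi> \<star> \<iota> f) \<bullet> lawn (length (snd \<psi>))"
  using assms
proof (induction rule: deloop_induct)
  case unit
  show ?case by (simp add: law_unit)
next
  case mult
  show ?case by (simp add: law_mult)
next
  case (ident m)
  show ?case by simp
next
  case (vcomp \<phi> \<psi>)
  obtain m xs k ys where [simp]: "\<phi> = (m, xs)" "\<psi> = (k, ys)" by fastforce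
  have [simp]: "k = length xs" "(m, xs) \<in> cell2 deloop_simplex" "(length xs, ys) \<in> cell2 deloop_simplex"
    using vcomp by simp_all
  have "lawn m \<bullet> (\<iota> f \<star> S.mon (m, map ((!) xs) ys))
      = lawn m \<bullet> ((\<iota> f \<star> S.mon (m, xs)) \<bullet> (\<iota> f \<star> S.mon (k, ys)))"
    using vcomp by (simp add: S.mon_vcomp)
  also have "\<dots> = (T.mon (m, xs) \<star> \<iota> f) \<bullet> (lawn k \<bullet> (\<iota> f \<star> S.mon (k, ys)))"
    using vcomp by (intro vcomp_eq_extend) simp_all
  also have "\<dots> = (T.mon (m, map ((!) xs) ys) \<star> \<iota> f) \<bullet> lawn (length ys)"
    using vcomp by (simp add: T.mon_vcomp)
  finally show ?case by simp
next
  case (hcomp \<phi> \<psi>)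
  obtain m xs n ys where [simp]: "\<phi> = (m, xs)" "\<psi> = (n, ys)" by fastforce
  have [simp]: "(m, xs) \<in> cell2 deloop_simplex" "(n, ys) \<in> cell2 deloop_simplex"
    using hcomp by simp_all
  let ?p = "length xs" and ?q = "length ys"
  have "lawn (m + n) \<bullet> (\<iota> f \<star> S.mon (m + n, xs @ map ((+) m) ys))
      = (\<iota> (T.pow m) \<star> lawn n) \<bullet> ((lawn m \<bullet> (\<iota> f \<star> S.mon (m, xs))) \<star> S.mon (n, ys))"
    using interchange'[of "lawn m" "\<iota> f \<star> S.mon (m, xs)" "\<iota> (S.pow n)" "S.mon (n, ys)"]
    by (simp add: S.mon_hcomp lawn_add)
  also have "\<dots> = (\<iota> (T.pow m) \<star> lawn n) \<bullet> (((T.mon (m, xs) \<star> \<iota> f) \<bullet> lawn ?p) \<star> S.mon (n, ys))"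
    using hcomp by simp
  also have "\<dots> = (T.mon (m, xs) \<star> (lawn n \<bullet> (\<iota> f \<star> S.mon (n, ys)))) \<bullet> (lawn ?p \<star> \<iota> (S.pow ?q))"
    using interchange'[of "T.mon (m, xs) \<star> \<iota> f" "lawn ?p" "S.mon (n, ys)" "\<iota> (S.pow ?q)"]
      interchange'[of "\<iota> (T.pow m)" "T.mon (m, xs)" "lawn n" "\<iota> f \<star> S.mon (n, ys)"]
    by simp
  also have "\<dots> = (T.mon (m, xs) \<star> ((T.mon (n, ys) \<star> \<iota> f) \<bullet> lawn ?q)) \<bullet> (lawn ?p \<star> \<iota> (S.pow ?q))"
    using hcomp by simp
  also have "\<dots> = (T.mon (m + n, xs @ map ((+) m) ys) \<star> \<iota> f) \<bullet> lawn (?p + ?q)"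
    using interchange'[of "T.mon (m, xs)" "\<iota> (T.pow ?p)" "T.mon (n, ys) \<star> \<iota> f" "lawn ?q"]
    by (simp add: T.mon_hcomp lawn_add)
  finally show ?case by simp
qed

end

lemma (in monad_in) law_n_id: "law_n B a t t (\<one> a) (\<iota> t) n = \<iota> (pow n)"
  by (induction n) simp_all

lemma law_n_comp:
  fixes B (structure)
  assumes F: "monad_opfunctor B a t \<eta> \<mu> b u \<eta>' \<mu>' f \<sigma>"
    and G: "monad_opfunctor B b u \<eta>' \<mu>' c v \<eta>'' \<mu>'' g \<tau>"
  shows "law_n B a t v (g \<cdot> f) ((\<tau> \<star> \<iota> f) \<bullet> (\<iota> g \<star> \<sigma>)) n =
    (law_n B b u v g \<tau> n \<star> \<iota> f) \<bullet> (\<iota> g \<star> law_n B a t u f \<sigma> n)"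
proof -
  interpret F: monad_opfunctor B a t \<eta> \<mu> b u \<eta>' \<mu>' f \<sigma> by fact
  interpret G: monad_opfunctor B b u \<eta>' \<mu>' c v \<eta>'' \<mu>'' g \<tau> by fact
  show ?thesis
  proof (induction n)
    case (Suc n)
    have "law_n B a t v (g \<cdot> f) ((\<tau> \<star> \<iota> f) \<bullet> (\<iota> g \<star> \<sigma>)) (Suc n) =
      (\<iota> v \<star> (G.lawn n \<star> \<iota> f)) \<bullet> ((\<iota> (v \<cdot> g) \<star> F.lawn n) \<bullet>
        ((\<tau> \<star> \<iota> (f \<cdot> F.S.pow n)) \<bullet> (\<iota> g \<star> \<sigma> \<star> \<iota> (F.S.pow n))))"
      by (simp add: Suc)
    also have "(\<iota> (v \<cdot> g) \<star> F.lawn n) \<bullet> ((\<tau> \<star> \<iota> (f \<cdot> F.S.pow n)) \<bullet> (\<iota> g \<star> \<sigma> \<star> \<iota> (F.S.pow n))) =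
      (\<tau> \<star> \<iota> (F.T.pow n \<cdot> f)) \<bullet> ((\<iota> (g \<cdot> u) \<star> F.lawn n) \<bullet> (\<iota> g \<star> \<sigma> \<star> \<iota> (F.S.pow n)))"
      by (rule F.vcomp_eq_extend[OF F.slide[symmetric]]) simp_all
    finally show ?case by simp
  qed simp
qed

lemma law_n_natural:
  fixes B (structure)
  assumes F: "monad_opfunctor B a t \<eta> \<mu> b u \<eta>' \<mu>' f \<sigma>"
    and G: "monad_opfunctor B a t \<eta> \<mu> b u \<eta>' \<mu>' g \<tau>"
    and \<phi>: "\<phi> \<in> hom2 B f g" "\<tau> \<bullet> (\<phi> \<star> \<iota> t) = (\<iota> u \<star> \<phi>) \<bullet> \<sigma>"
  shows "law_n B a t u g \<tau> n \<bullet> (\<phi> \<star> \<iota> (pow1 B a t n)) =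
    (\<iota> (pow1 B b u n) \<star> \<phi>) \<bullet> law_n B a t u f \<sigma> n"
proof -
  interpret F: monad_opfunctor B a t \<eta> \<mu> b u \<eta>' \<mu>' f \<sigma> by fact
  interpret G: monad_opfunctor B a t \<eta> \<mu> b u \<eta>' \<mu>' g \<tau> by fact
  have [simp]: "\<phi> \<in> cell2 B" "src2 B \<phi> = f" "tgt2 B \<phi> = g" using \<phi>(1) by (auto simp: hom2_def)
  show ?thesis
  proof (induction n)
    case (Suc n)
    have "G.lawn (Suc n) \<bullet> (\<phi> \<star> \<iota> (F.S.pow (Suc n))) =
      (\<iota> u \<star> G.lawn n) \<bullet> ((\<tau> \<bullet> (\<phi> \<star> \<iota> t)) \<star> \<iota> (F.S.pow n))" by simp
    also have "\<dots> = (\<iota> u \<star> (G.lawn n \<bullet> (\<phi> \<star> \<iota> (F.S.pow n)))) \<bullet> (\<sigma> \<star> \<iota> (F.S.pow n))"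
      by (simp add: \<phi>(2))
    also have "\<dots> = (\<iota> (F.T.pow (Suc n)) \<star> \<phi>) \<bullet> F.lawn (Suc n)" by (simp add: Suc)
    finally show ?case .
  qed simp
qed

section \<open>Strict 2-functors\<close>

lemma functor_eqI:
  assumes "F \<in> strict_2_functors A B" "G \<in> strict_2_functors A B"
    "\<And>a. a \<in> cell0 A \<Longrightarrow> map0 F a = map0 G a"
    "\<And>f. f \<in> cell1 A \<Longrightarrow> map1 F f = map1 G f"
    "\<And>\<alpha>. \<alpha> \<in> cell2 A \<Longrightarrow> map2 F \<alpha> = map2 G \<alpha>"
  shows "F = G"
proof -
  have "map0 H \<in> cell0 A \<rightarrow>\<^sub>E cell0 B \<and> map1 H \<in> cell1 A \<rightarrow>\<^sub>E cell1 B \<and> map2 H \<in> cell2 A \<rightarrow>\<^sub>E cell2 B"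
    if "H \<in> strict_2_functors A B" for H
    using that unfolding strict_2_functors_def by blast
  then have "map0 F = map0 G" "map1 F = map1 G" "map2 F = map2 G"
    using assms by (meson PiE_ext)+
  then show ?thesis by simp
qed

locale strict_2_functor = A: strict_2_category A + B: strict_2_category B
  for A :: "('o, 'm, 'c) two_cat" and B :: "('p, 'n, 'd) two_cat" +
  fixes F :: "('o, 'm, 'c, 'p, 'n, 'd) two_fun"
  assumes F: "F \<in> strict_2_functors A B"
begin

lemma map0 [simp]: "a \<in> cell0 A \<Longrightarrow> map0 F a \<in> cell0 B"
  using F unfolding strict_2_functors_def by auto

lemma map1 [simp]: "f \<in> cell1 A \<Longrightarrow> map1 F f \<in> cell1 B"
  "f \<in> cell1 A \<Longrightarrow> src1 B (map1 F f) = map0 F (src1 A f)"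
  "f \<in> cell1 A \<Longrightarrow> tgt1 B (map1 F f) = map0 F (tgt1 A f)"
  using F unfolding strict_2_functors_def by auto

lemma map2 [simp]: "\<alpha> \<in> cell2 A \<Longrightarrow> map2 F \<alpha> \<in> cell2 B"
  "\<alpha> \<in> cell2 A \<Longrightarrow> src2 B (map2 F \<alpha>) = map1 F (src2 A \<alpha>)"
  "\<alpha> \<in> cell2 A \<Longrightarrow> tgt2 B (map2 F \<alpha>) = map1 F (tgt2 A \<alpha>)"
  using F unfolding strict_2_functors_def by auto

lemma map1_id: "a \<in> cell0 A \<Longrightarrow> map1 F (id1 A a) = id1 B (map0 F a)"
  using F unfolding strict_2_functors_def by auto

lemma map1_comp: "f \<in> cell1 A \<Longrightarrow> g \<in> cell1 A \<Longrightarrow> src1 A f = tgt1 A g \<Longrightarrow>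
    map1 F (comp1 A f g) = comp1 B (map1 F f) (map1 F g)"
  using F unfolding strict_2_functors_def by auto

lemma map2_id: "f \<in> cell1 A \<Longrightarrow> map2 F (id2 A f) = id2 B (map1 F f)"
  using F unfolding strict_2_functors_def by auto

lemma map2_vcomp: "\<alpha> \<in> cell2 A \<Longrightarrow> \<beta> \<in> cell2 A \<Longrightarrow> src2 A \<alpha> = tgt2 A \<beta> \<Longrightarrow>
    map2 F (vcomp A \<alpha> \<beta>) = vcomp B (map2 F \<alpha>) (map2 F \<beta>)"
  using F unfolding strict_2_functors_def by auto

lemma map2_hcomp: "\<alpha> \<in> cell2 A \<Longrightarrow> \<beta> \<in> cell2 A \<Longrightarrow> src1 A (src2 A \<alpha>) = tgt1 A (src2 A \<beta>) \<Longrightarrow>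
    map2 F (hcomp A \<alpha> \<beta>) = hcomp B (map2 F \<alpha>) (map2 F \<beta>)"
  using F unfolding strict_2_functors_def by auto

lemmas preserves = map1_id map1_comp map2_id map2_vcomp map2_hcomp

end

lemmas functor_simps = strict_2_functor.map0 strict_2_functor.map1 strict_2_functor.map2
  strict_2_functor.preserves

section \<open>The Gray tensor product\<close>

locale gray_product = gray_data B C + B: strict_2_category B + C: strict_2_category C
  for B :: "('o, 'm, 'c) two_cat" and C :: "('p, 'n, 'd) two_cat"
begin

lemmas closed [simp] = B.src1_closed B.tgt1_closed B.src2_closed B.tgt2_closed
  C.src1_closed C.tgt1_closed C.src2_closed C.tgt2_closed

lemma wf1_obj: "wf1 e \<Longrightarrow> esrc1 e \<in> cell0 B \<times> cell0 C \<and> etgt1 e \<in> cell0 B \<times> cell0 C"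
  by (induction e) auto

lemma eq1_wf: "eq1 e d \<Longrightarrow> wf1 e \<and> wf1 d \<and> esrc1 e = esrc1 d \<and> etgt1 e = etgt1 d"
  by (induction rule: eq1.induct) (auto dest: wf1_obj)

lemma wf2_globular:
  "wf2 x \<Longrightarrow> wf1 (esrc2 x) \<and> wf1 (etgt2 x) \<and>
    esrc1 (etgt2 x) = esrc1 (esrc2 x) \<and> etgt1 (etgt2 x) = etgt1 (esrc2 x)"
  by (induction x)
    (auto simp: B.src_globular B.tgt_globular C.src_globular C.tgt_globular
      dest!: eq1_wf)

lemma eq1_Comp_left: "eq1 e e' \<Longrightarrow> wf1 d \<Longrightarrow> esrc1 e = etgt1 d \<Longrightarrow> eq1 (Comp1 e d) (Comp1 e' d)"
  by (auto intro: eq1_comp eq1_refl)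

lemma eq1_Comp_right: "eq1 d d' \<Longrightarrow> wf1 e \<Longrightarrow> esrc1 e = etgt1 d \<Longrightarrow> eq1 (Comp1 e d) (Comp1 e d')"
  by (auto intro: eq1_comp eq1_refl)

lemma eq2_wf:
  "eq2 x y \<Longrightarrow> wf2 x \<and> wf2 y \<and> eq1 (esrc2 x) (esrc2 y) \<and> eq1 (etgt2 x) (etgt2 y)"
proof (induction rule: eq2.induct)
  case (eq2_sym x y)
  then show ?case by (auto intro: eq1_sym)
next
  case (eq2_trans x y z)
  then show ?case by (auto intro: eq1_trans)
next
  case (eq2_vcomp x x' y y')
  then show ?case by (auto intro: eq1_trans eq1_sym)
next
  case (eq2_hcomp x x' y y')
  then have "eq1 (esrc2 x) (esrc2 x')" "eq1 (esrc2 y) (esrc2 y')" by simp_all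
  then have "esrc1 (esrc2 x') = etgt1 (esrc2 y')"
    using eq2_hcomp.hyps eq1_wf by (metis wf2.simps(6))
  with eq2_hcomp show ?case by (auto intro!: eq1_comp simp: wf2_globular)
next
  case (eq2_hassoc x y z)
  then show ?case by (auto intro!: eq1_assoc simp: wf2_globular)
next
  case (eq2_hunit_left x b c)
  then show ?case using wf1_obj[of "esrc2 x"] by (auto intro!: eq1_unit_left simp: wf2_globular)
next
  case (eq2_hunit_right x b c)
  then show ?case using wf1_obj[of "esrc2 x"] by (auto intro!: eq1_unit_right simp: wf2_globular)
next
  case (eq2_interchange x x' y y')
  then have *: "wf2 x" "wf2 x'" "wf2 y" "wf2 y'" "eq1 (esrc2 x) (etgt2 x')" "eq1 (esrc2 y) (etgt2 y')"
    "esrc1 (esrc2 x') = etgt1 (esrc2 y')" by auto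
  then have "esrc1 (esrc2 x) = etgt1 (esrc2 y)"
    using eq1_wf[OF *(5)] eq1_wf[OF *(6)] wf2_globular by simp
  with * show ?case by (auto intro!: eq1_refl eq1_comp simp: wf2_globular)
next
  case (eq2_left_hcomp \<phi> \<phi>' c)
  then show ?case
    by (auto intro!: eq1_left_comp simp: B.src_globular B.tgt_globular)
next
  case (eq2_right_hcomp \<psi> \<psi>' b)
  then show ?case
    by (auto intro!: eq1_right_comp simp: C.src_globular C.tgt_globular)
next
  case (eq2_swap_id_right f c)
  then have *: "eq1 (Right1 b (id1 C c)) (Ident1 b c)" if "b \<in> cell0 B" for b
    using that by (intro eq1_right_id)
  have "eq1 (Comp1 (Left1 f c) (Right1 (src1 B f) (id1 C c))) (Left1 f c)"
    by (rule eq1_trans[OF eq1_Comp_right[OF *]])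
      (use eq2_swap_id_right in \<open>auto intro!: eq1_unit_right\<close>)
  moreover have "eq1 (Comp1 (Right1 (tgt1 B f) (id1 C c)) (Left1 f c)) (Left1 f c)"
    by (rule eq1_trans[OF eq1_Comp_left[OF *]])
      (use eq2_swap_id_right in \<open>auto intro!: eq1_unit_left\<close>)
  ultimately show ?case using eq2_swap_id_right by simp
next
  case (eq2_swap_id_left b g)
  then have *: "eq1 (Left1 (id1 B b) c) (Ident1 b c)" if "c \<in> cell0 C" for c
    using that by (intro eq1_left_id)
  have "eq1 (Comp1 (Left1 (id1 B b) (tgt1 C g)) (Right1 b g)) (Right1 b g)"
    by (rule eq1_trans[OF eq1_Comp_left[OF *]])
      (use eq2_swap_id_left in \<open>auto intro!: eq1_unit_left\<close>)
  moreover have "eq1 (Comp1 (Right1 b g) (Left1 (id1 B b) (src1 C g))) (Right1 b g)"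
    by (rule eq1_trans[OF eq1_Comp_right[OF *]])
      (use eq2_swap_id_left in \<open>auto intro!: eq1_unit_right\<close>)
  ultimately show ?case using eq2_swap_id_left by simp
next
  case (eq2_swap_comp_left f f' g)
  let ?L = "\<lambda>f. Left1 f (tgt1 C g)" and ?L' = "\<lambda>f. Left1 f (src1 C g)" and ?R = "\<lambda>f. Right1 (src1 B f) g"
    and ?R' = "Right1 (tgt1 B f) g"
  have "eq1 (Comp1 (?L (comp1 B f f')) (?R f')) (Comp1 (?L f) (Comp1 (?L f') (?R f')))"
    by (rule eq1_trans[OF eq1_Comp_left[OF eq1_sym[OF eq1_left_comp]] eq1_assoc])
      (use eq2_swap_comp_left in auto)
  moreover have "eq1 (Comp1 ?R' (?L' (comp1 B f f'))) (Comp1 (Comp1 ?R' (?L' f)) (?L' f'))"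
    by (rule eq1_trans[OF eq1_Comp_right[OF eq1_sym[OF eq1_left_comp]] eq1_sym[OF eq1_assoc]])
      (use eq2_swap_comp_left in auto)
  moreover have "eq1 (Comp1 (Comp1 (?L f) (?R f)) (?L' f')) (Comp1 (?L f) (Comp1 (?R f) (?L' f')))"
    by (rule eq1_assoc) (use eq2_swap_comp_left in auto)
  ultimately show ?case using eq2_swap_comp_left by auto
next
  case (eq2_swap_comp_right f g g')
  let ?R = "\<lambda>g. Right1 (src1 B f) g" and ?R' = "\<lambda>g. Right1 (tgt1 B f) g" and ?L = "Left1 f (tgt1 C g)"
    and ?L' = "\<lambda>g. Left1 f (src1 C g)"
  have "eq1 (Comp1 ?L (?R (comp1 C g g'))) (Comp1 (Comp1 ?L (?R g)) (?R g'))"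
    by (rule eq1_trans[OF eq1_Comp_right[OF eq1_sym[OF eq1_right_comp]] eq1_sym[OF eq1_assoc]])
      (use eq2_swap_comp_right in auto)
  moreover have "eq1 (Comp1 (?R' (comp1 C g g')) (?L' g')) (Comp1 (?R' g) (Comp1 (?R' g') (?L' g')))"
    by (rule eq1_trans[OF eq1_Comp_left[OF eq1_sym[OF eq1_right_comp]] eq1_assoc])
      (use eq2_swap_comp_right in auto)
  moreover have "eq1 (Comp1 (?R' g) (Comp1 (?L' g) (?R g'))) (Comp1 (Comp1 (?R' g) (?L' g)) (?R g'))"
    by (rule eq1_sym[OF eq1_assoc]) (use eq2_swap_comp_right in auto)
  ultimately show ?case using eq2_swap_comp_right by auto
next
  case (eq2_swap_natural \<phi> f f' \<psi> g g')
  then show ?case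
    by (auto simp: hom2_def B.src_globular B.tgt_globular C.src_globular
        C.tgt_globular intro!: eq1_refl)
qed (auto intro!: eq1_refl dest: eq1_wf simp: wf2_globular)

lemma cls1_eq_iff: "wf1 e \<Longrightarrow> cls1 e = cls1 d \<longleftrightarrow> eq1 e d"
  unfolding cls1_def
    by (metis (mono_tags, lifting) Collect_cong eq1_refl eq1_sym eq1_trans mem_Collect_eq)

lemma cls2_eq_iff: "wf2 x \<Longrightarrow> cls2 x = cls2 y \<longleftrightarrow> eq2 x y"
  unfolding cls2_def
    by (metis (mono_tags, lifting) Collect_cong eq2_refl eq2_sym eq2_trans mem_Collect_eq)

lemma rep_cls1: "wf1 e \<Longrightarrow> eq1 e (rep (cls1 e))"
  unfolding rep_def cls1_def by (metis (mono_tags, lifting) eq1_refl mem_Collect_eq someI_ex)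

lemma rep_cls2: "wf2 x \<Longrightarrow> eq2 x (rep (cls2 x))"
  unfolding rep_def cls2_def by (metis (mono_tags, lifting) eq2_refl mem_Collect_eq someI_ex)

lemma gray_cells: "cell0 gray = cell0 B \<times> cell0 C" "cell1 gray = cls1 ` {e. wf1 e}"
  "cell2 gray = cls2 ` {x. wf2 x}"
  by (simp_all add: gray_def)

lemma gray_cls1 [simp]:
  "wf1 e \<Longrightarrow> cls1 e \<in> cell1 gray"
  "wf1 e \<Longrightarrow> src1 gray (cls1 e) = esrc1 e"
  "wf1 e \<Longrightarrow> tgt1 gray (cls1 e) = etgt1 e"
  using rep_cls1[of e] eq1_wf by (auto simp: gray_def)

lemma gray_cls2 [simp]:
  "wf2 x \<Longrightarrow> cls2 x \<in> cell2 gray"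
  "wf2 x \<Longrightarrow> src2 gray (cls2 x) = cls1 (esrc2 x)"
  "wf2 x \<Longrightarrow> tgt2 gray (cls2 x) = cls1 (etgt2 x)"
  using eq2_wf[OF rep_cls2[of x]] wf2_globular[of x] cls1_eq_iff by (auto simp: gray_def)

lemma gray_id1 [simp]: "id1 gray (b, c) = cls1 (Ident1 b c)"
  by (simp add: gray_def)

lemma gray_comp1 [simp]:
  assumes "wf1 e" "wf1 d" "esrc1 e = etgt1 d"
  shows "comp1 gray (cls1 e) (cls1 d) = cls1 (Comp1 e d)"
proof -
  have "eq1 (Comp1 e d) (Comp1 (rep (cls1 e)) (rep (cls1 d)))"
    using assms by (intro eq1_comp rep_cls1)
  with assms show ?thesis by (simp add: gray_def cls1_eq_iff[of "Comp1 e d", symmetric])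
qed

lemma gray_id2 [simp]:
  assumes "wf1 e"
  shows "id2 gray (cls1 e) = cls2 (Ident2 e)"
  using eq2_ident[OF rep_cls1[OF assms]] assms
    by (simp add: gray_def cls2_eq_iff[of "Ident2 e", symmetric])

lemma gray_vcomp [simp]:
  assumes "wf2 x" "wf2 y" "eq1 (esrc2 x) (etgt2 y)"
  shows "vcomp gray (cls2 x) (cls2 y) = cls2 (VComp x y)"
proof -
  have "eq2 (VComp x y) (VComp (rep (cls2 x)) (rep (cls2 y)))"
    using assms by (intro eq2_vcomp rep_cls2) simp_all
  with assms show ?thesis by (simp add: gray_def cls2_eq_iff[of "VComp x y", symmetric])
qed

lemma gray_hcomp [simp]:
  assumes "wf2 x" "wf2 y" "esrc1 (esrc2 x) = etgt1 (esrc2 y)"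
  shows "hcomp gray (cls2 x) (cls2 y) = cls2 (HComp x y)"
proof -
  have "eq2 (HComp x y) (HComp (rep (cls2 x)) (rep (cls2 y)))"
    using assms by (intro eq2_hcomp rep_cls2) simp_all
  with assms show ?thesis by (simp add: gray_def cls2_eq_iff[of "HComp x y", symmetric])
qed

end

context gray_product
begin

lemma cls1_eqI: "eq1 e d \<Longrightarrow> cls1 e = cls1 d"
  using eq1_wf cls1_eq_iff by blast

lemma cls2_eqI: "eq2 x y \<Longrightarrow> cls2 x = cls2 y"
  using eq2_wf cls2_eq_iff by blast

lemma hom1_grayE:
  assumes "X \<in> hom1 gray p q"
  obtains e where "X = cls1 e" "wf1 e" "esrc1 e = p" "etgt1 e = q"
  using assms by (auto simp: hom1_def gray_cells)

lemma hom1_grayI: "wf1 e \<Longrightarrow> esrc1 e = p \<Longrightarrow> etgt1 e = q \<Longrightarrow> cls1 e \<in> hom1 gray p q"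
  by (simp add: hom1_def)

lemma hom2_grayE:
  assumes "\<Xi> \<in> hom2 gray X Y"
  obtains x where "\<Xi> = cls2 x" "wf2 x" "X = cls1 (esrc2 x)" "Y = cls1 (etgt2 x)"
  using assms by (auto simp: hom2_def gray_cells)

lemma hom2_grayI:
  "wf2 x \<Longrightarrow> cls1 (esrc2 x) = X \<Longrightarrow> cls1 (etgt2 x) = Y \<Longrightarrow> cls2 x \<in> hom2 gray X Y"
  by (simp add: hom2_def)

lemma hom2_gray_vcomp:
  assumes "\<Xi> \<in> hom2 gray Y Z" "\<Theta> \<in> hom2 gray X Y"
  obtains x y where "\<Xi> = cls2 x" "\<Theta> = cls2 y" "wf2 x" "wf2 y" "eq1 (esrc2 x) (etgt2 y)"
    "X = cls1 (esrc2 y)" "Y = cls1 (esrc2 x)" "Z = cls1 (etgt2 x)"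
  using assms wf2_globular by (elim hom2_grayE) (metis cls1_eq_iff)

lemma strict_2_category_gray: "strict_2_category gray"
proof unfold_locales
  fix X assume "X \<in> cell1 gray"
  then show "src1 gray X \<in> cell0 gray" "tgt1 gray X \<in> cell0 gray"
    using wf1_obj by (auto simp: gray_cells gray_cls1(2,3))
next
  fix \<Xi> assume "\<Xi> \<in> cell2 gray"
  then show "src2 gray \<Xi> \<in> cell1 gray" "tgt2 gray \<Xi> \<in> cell1 gray"
    "src1 gray (src2 gray \<Xi>) = src1 gray (tgt2 gray \<Xi>)"
    "tgt1 gray (src2 gray \<Xi>) = tgt1 gray (tgt2 gray \<Xi>)"
    using wf2_globular by (auto simp: gray_cells(3))
next
  fix p assume "p \<in> cell0 gray"
  then show "id1 gray p \<in> hom1 gray p p"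
    by (cases p) (auto simp: hom1_def gray_cells(1))
next
  fix X Y p q r assume "X \<in> hom1 gray q r" "Y \<in> hom1 gray p q"
  then show "comp1 gray X Y \<in> hom1 gray p r"
    by (auto elim!: hom1_grayE intro!: hom1_grayI)
next
  fix X Y Z p q r s assume "X \<in> hom1 gray r s" "Y \<in> hom1 gray q r" "Z \<in> hom1 gray p q"
  then show "comp1 gray (comp1 gray X Y) Z = comp1 gray X (comp1 gray Y Z)"
    by (elim hom1_grayE) (simp add: cls1_eq_iff eq1_assoc)
next
  fix X p q assume "X \<in> hom1 gray p q"
  then obtain e where e: "X = cls1 e" "wf1 e" "esrc1 e = p" "etgt1 e = q" by (rule hom1_grayE)
  then show "comp1 gray (id1 gray q) X = X" "comp1 gray X (id1 gray p) = X"
    using wf1_obj[of e] by (cases p; cases q; simp add: cls1_eq_iff eq1_unit_left eq1_unit_right)+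
next
  fix X assume "X \<in> cell1 gray"
  then show "id2 gray X \<in> hom2 gray X X"
    by (auto simp: gray_cells(2) intro!: hom2_grayI)
next
  fix \<Xi> \<Theta> X Y Z assume "\<Xi> \<in> hom2 gray Y Z" "\<Theta> \<in> hom2 gray X Y"
  then show "vcomp gray \<Xi> \<Theta> \<in> hom2 gray X Z"
    by (rule hom2_gray_vcomp) (auto intro!: hom2_grayI)
next
  fix \<Xi> \<Theta> \<Phi> W X Y Z assume "\<Xi> \<in> hom2 gray Y Z" "\<Theta> \<in> hom2 gray X Y" "\<Phi> \<in> hom2 gray W X"
  from this(1) obtain x where x: "\<Xi> = cls2 x" "wf2 x" "Y = cls1 (esrc2 x)" by (rule hom2_grayE)
  from \<open>\<Theta> \<in> _\<close> obtain y where y: "\<Theta> = cls2 y" "wf2 y" "X = cls1 (esrc2 y)" "Y = cls1 (etgt2 y)"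
    by (rule hom2_grayE)
  from \<open>\<Phi> \<in> _\<close> obtain z where z: "\<Phi> = cls2 z" "wf2 z" "X = cls1 (etgt2 z)" by (rule hom2_grayE)
  have "eq1 (esrc2 x) (etgt2 y)" "eq1 (esrc2 y) (etgt2 z)"
    using x y z wf2_globular[of x] wf2_globular[of y] by (simp_all add: cls1_eq_iff[symmetric])
  with x y z show "vcomp gray (vcomp gray \<Xi> \<Theta>) \<Phi> = vcomp gray \<Xi> (vcomp gray \<Theta> \<Phi>)"
    by (simp add: cls2_eq_iff eq2_vassoc)
next
  fix \<Xi> X Y assume "\<Xi> \<in> hom2 gray X Y"
  then obtain x where x: "\<Xi> = cls2 x" "wf2 x" "X = cls1 (esrc2 x)" "Y = cls1 (etgt2 x)"
    by (auto elim: hom2_grayE)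
  then show "vcomp gray (id2 gray Y) \<Xi> = \<Xi>" "vcomp gray \<Xi> (id2 gray X) = \<Xi>"
    using wf2_globular[of x] by (simp_all add: cls2_eq_iff eq2_vunit_left eq2_vunit_right eq1_refl)
next
  fix \<Xi> \<Theta> X X' Y Y'
  assume "\<Xi> \<in> hom2 gray X X'" "\<Theta> \<in> hom2 gray Y Y'" "src1 gray X = tgt1 gray Y"
  then show "hcomp gray \<Xi> \<Theta> \<in> hom2 gray (comp1 gray X Y) (comp1 gray X' Y')"
    by (auto simp: wf2_globular elim!: hom2_grayE intro!: hom2_grayI)
next
  fix \<Xi> \<Theta> \<Phi> X X' Y Y' Z Z'
  assume "\<Xi> \<in> hom2 gray X X'" "\<Theta> \<in> hom2 gray Y Y'" "\<Phi> \<in> hom2 gray Z Z'"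
    "src1 gray X = tgt1 gray Y" "src1 gray Y = tgt1 gray Z"
  then show "hcomp gray (hcomp gray \<Xi> \<Theta>) \<Phi> = hcomp gray \<Xi> (hcomp gray \<Theta> \<Phi>)"
    by (elim hom2_grayE) (simp add: wf2_globular cls2_eq_iff eq2_hassoc)
next
  fix \<Xi> X Y p q assume *: "\<Xi> \<in> hom2 gray X Y" "X \<in> hom1 gray p q"
  then obtain x where x: "\<Xi> = cls2 x" "wf2 x" "X = cls1 (esrc2 x)" "Y = cls1 (etgt2 x)"
    by (auto elim: hom2_grayE)
  with * have "esrc1 (esrc2 x) = p" "etgt1 (esrc2 x) = q"
    using wf2_globular[of x] by (auto simp: hom1_def)
  with x show "hcomp gray (id2 gray (id1 gray q)) \<Xi> = \<Xi>" "hcomp gray \<Xi> (id2 gray (id1 gray p)) = \<Xi>"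
    using wf2_globular[of x] wf1_obj[of "esrc2 x"]
    by (cases p; cases q; simp add: cls2_eq_iff eq2_hunit_left eq2_hunit_right)+
next
  fix X Y p q r assume "X \<in> hom1 gray q r" "Y \<in> hom1 gray p q"
  then show "hcomp gray (id2 gray X) (id2 gray Y) = id2 gray (comp1 gray X Y)"
    by (elim hom1_grayE) (simp add: cls2_eq_iff eq2_hident)
next
  fix \<Xi> \<Theta> \<Phi> \<Psi> X X' X'' Y Y' Y''
  assume *: "\<Xi> \<in> hom2 gray X' X''" "\<Theta> \<in> hom2 gray X X'" "\<Phi> \<in> hom2 gray Y' Y''" "\<Psi> \<in> hom2 gray Y Y'"
    "src1 gray X = tgt1 gray Y"
  obtain x y where x: "\<Xi> = cls2 x" "\<Theta> = cls2 y" "wf2 x" "wf2 y" "eq1 (esrc2 x) (etgt2 y)"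
      "X = cls1 (esrc2 y)"
    using *(1,2) by (rule hom2_gray_vcomp)
  obtain z w where z: "\<Phi> = cls2 z" "\<Psi> = cls2 w" "wf2 z" "wf2 w" "eq1 (esrc2 z) (etgt2 w)"
      "Y = cls1 (esrc2 w)"
    using *(3,4) by (rule hom2_gray_vcomp)
  have "esrc1 (esrc2 y) = etgt1 (esrc2 w)"
    using *(5) x(4,6) z(4,6) wf2_globular by simp
  moreover from this have "esrc1 (esrc2 x) = etgt1 (esrc2 z)"
    using eq1_wf[OF x(5)] eq1_wf[OF z(5)] wf2_globular x(4) z(4) by simp
  ultimately show "hcomp gray (vcomp gray \<Xi> \<Theta>) (vcomp gray \<Phi> \<Psi>) =
      vcomp gray (hcomp gray \<Xi> \<Phi>) (hcomp gray \<Theta> \<Psi>)"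
    using x z by (simp add: cls2_eq_iff eq2_interchange eq1_comp)
qed

end

section \<open>The universal property of the Gray tensor product\<close>

text \<open>The values on the generators of a 2-functor out of the tensor product, subject to the images of
  the relations: a 2-functor in each variable and a 2-cell for each swap.\<close>

locale gray_cone = gray_product B C + D: strict_2_category D
  for B :: "('o, 'm, 'c) two_cat" and C :: "('p, 'n, 'd) two_cat" and D :: "('q, 'k, 'e) two_cat" +
  fixes L :: "'p \<Rightarrow> ('o, 'm, 'c, 'q, 'k, 'e) two_fun"
    and R :: "'o \<Rightarrow> ('p, 'n, 'd, 'q, 'k, 'e) two_fun"
    and S :: "'m \<Rightarrow> 'n \<Rightarrow> 'e"
  assumes L: "c \<in> cell0 C \<Longrightarrow> L c \<in> strict_2_functors B D"
    and R: "b \<in> cell0 B \<Longrightarrow> R b \<in> strict_2_functors C D"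
    and agree: "b \<in> cell0 B \<Longrightarrow> c \<in> cell0 C \<Longrightarrow> map0 (R b) c = map0 (L c) b"
    and S: "f \<in> cell1 B \<Longrightarrow> g \<in> cell1 C \<Longrightarrow> S f g \<in>
      hom2 D (comp1 D (map1 (L (tgt1 C g)) f) (map1 (R (src1 B f)) g))
        (comp1 D (map1 (R (tgt1 B f)) g) (map1 (L (src1 C g)) f))"
    and S_id_right: "f \<in> cell1 B \<Longrightarrow> c \<in> cell0 C \<Longrightarrow> S f (id1 C c) = id2 D (map1 (L c) f)"
    and S_id_left: "b \<in> cell0 B \<Longrightarrow> g \<in> cell1 C \<Longrightarrow> S (id1 B b) g = id2 D (map1 (R b) g)"
    and S_comp_left: "f \<in> cell1 B \<Longrightarrow> f' \<in> cell1 B \<Longrightarrow> src1 B f = tgt1 B f' \<Longrightarrow> g \<in> cell1 C \<Longrightarrow>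
      S (comp1 B f f') g = vcomp D (hcomp D (S f g) (id2 D (map1 (L (src1 C g)) f')))
        (hcomp D (id2 D (map1 (L (tgt1 C g)) f)) (S f' g))"
    and S_comp_right: "f \<in> cell1 B \<Longrightarrow> g \<in> cell1 C \<Longrightarrow> g' \<in> cell1 C \<Longrightarrow> src1 C g = tgt1 C g' \<Longrightarrow>
      S f (comp1 C g g') = vcomp D (hcomp D (id2 D (map1 (R (tgt1 B f)) g)) (S f g'))
        (hcomp D (S f g) (id2 D (map1 (R (src1 B f)) g')))"
    and S_natural: "\<phi> \<in> hom2 B f f' \<Longrightarrow> \<psi> \<in> hom2 C g g' \<Longrightarrow>
      vcomp D (S f' g') (hcomp D (map2 (L (tgt1 C g)) \<phi>) (map2 (R (src1 B f)) \<psi>)) =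
      vcomp D (hcomp D (map2 (R (tgt1 B f)) \<psi>) (map2 (L (src1 C g)) \<phi>)) (S f g)"
begin

lemma L': "c \<in> cell0 C \<Longrightarrow> strict_2_functor B D (L c)"
  by (intro strict_2_functor.intro strict_2_functor_axioms.intro L B.strict_2_category_axioms
      D.strict_2_category_axioms)

lemma R': "b \<in> cell0 B \<Longrightarrow> strict_2_functor C D (R b)"
  by (intro strict_2_functor.intro strict_2_functor_axioms.intro R C.strict_2_category_axioms
      D.strict_2_category_axioms)

lemmas L_simps [simp] = functor_simps[OF L']
lemmas R_simps [simp] = functor_simps[OF R']

lemma S_simps [simp]:
  assumes "f \<in> cell1 B" "g \<in> cell1 C"
  shows "S f g \<in> cell2 D"
    "src2 D (S f g) = comp1 D (map1 (L (tgt1 C g)) f) (map1 (R (src1 B f)) g)"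
    "tgt2 D (S f g) = comp1 D (map1 (R (tgt1 B f)) g) (map1 (L (src1 C g)) f)"
  using S[OF assms] by (auto simp: hom2_def)

primrec ev1 :: "('o, 'm, 'p, 'n) expr1 \<Rightarrow> 'k" where
  "ev1 (Left1 f c) = map1 (L c) f"
| "ev1 (Right1 b g) = map1 (R b) g"
| "ev1 (Ident1 b c) = id1 D (map0 (L c) b)"
| "ev1 (Comp1 e d) = comp1 D (ev1 e) (ev1 d)"

primrec ev2 :: "('o, 'm, 'c, 'p, 'n, 'd) expr2 \<Rightarrow> 'e" where
  "ev2 (Left2 \<phi> c) = map2 (L c) \<phi>"
| "ev2 (Right2 b \<psi>) = map2 (R b) \<psi>"
| "ev2 (Swap f g) = S f g"
| "ev2 (Ident2 e) = id2 D (ev1 e)"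
| "ev2 (VComp x y) = vcomp D (ev2 x) (ev2 y)"
| "ev2 (HComp x y) = hcomp D (ev2 x) (ev2 y)"

definition ev0 :: "'o \<times> 'p \<Rightarrow> 'q" where
  "ev0 p = map0 (L (snd p)) (fst p)"

lemma ev1 [simp]:
  "wf1 e \<Longrightarrow> ev1 e \<in> cell1 D"
  "wf1 e \<Longrightarrow> src1 D (ev1 e) = ev0 (esrc1 e)"
  "wf1 e \<Longrightarrow> tgt1 D (ev1 e) = ev0 (etgt1 e)"
  by (induction e) (simp_all add: ev0_def agree)

lemma ev1_eq: "eq1 e d \<Longrightarrow> ev1 e = ev1 d"
proof (induction rule: eq1.induct)
  case (eq1_assoc e d k)
  then show ?case by (auto intro!: D.comp1_assoc')
next
  case (eq1_unit_left e b c)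
  then show ?case by (simp add: ev0_def)
next
  case (eq1_unit_right e b c)
  then show ?case by (simp add: ev0_def)
qed (simp_all add: agree)

lemma ev2 [simp]:
  "wf2 x \<Longrightarrow> ev2 x \<in> cell2 D"
  "wf2 x \<Longrightarrow> src2 D (ev2 x) = ev1 (esrc2 x)"
  "wf2 x \<Longrightarrow> tgt2 D (ev2 x) = ev1 (etgt2 x)"
proof (induction x)
  case (VComp x y)
  case 1 with VComp show ?case using ev1_eq by auto
  case 2 with VComp show ?case using ev1_eq by auto
  case 3 with VComp show ?case using ev1_eq by auto
next
  case (HComp x y)
  case 1 with HComp show ?case using wf2_globular by auto
  case 2 with HComp show ?case using wf2_globular by auto
  case 3 with HComp show ?case using wf2_globular by auto
qed simp_all

lemma ev2_eq: "eq2 x y \<Longrightarrow> ev2 x = ev2 y"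
proof (induction rule: eq2.induct)
  case (eq2_vassoc x y z)
  then show ?case using ev1_eq by (auto intro!: D.vcomp_assoc')
next
  case (eq2_hassoc x y z)
  then show ?case by (auto simp: wf2_globular intro!: D.hcomp_assoc')
next
  case (eq2_hunit_left x b c)
  then show ?case by (simp add: ev0_def wf2_globular)
next
  case (eq2_hunit_right x b c)
  then show ?case by (simp add: ev0_def wf2_globular)
next
  case (eq2_interchange x x' y y')
  then have "ev1 (esrc2 x) = ev1 (etgt2 x')" "ev1 (esrc2 y) = ev1 (etgt2 y')"
    using ev1_eq by auto
  with eq2_interchange show ?case by (auto simp: wf2_globular intro!: D.interchange')
next
  case (eq2_swap_natural \<phi> f f' \<psi> g g')
  then show ?case using S_natural by simp
qed (simp_all add: ev1_eq S_id_left S_id_right S_comp_left S_comp_right)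

definition induced :: "('o \<times> 'p, ('o, 'm, 'p, 'n) expr1 set, ('o, 'm, 'c, 'p, 'n, 'd) expr2 set,
    'q, 'k, 'e) two_fun" where
  "induced = \<lparr>map0 = restrict ev0 (cell0 gray),
    map1 = (\<lambda>X\<in>cell1 gray. ev1 (rep X)), map2 = (\<lambda>\<Xi>\<in>cell2 gray. ev2 (rep \<Xi>))\<rparr>"

lemma induced_simps [simp]:
  "b \<in> cell0 B \<Longrightarrow> c \<in> cell0 C \<Longrightarrow> map0 induced (b, c) = map0 (L c) b"
  "wf1 e \<Longrightarrow> map1 induced (cls1 e) = ev1 e"
  "wf2 x \<Longrightarrow> map2 induced (cls2 x) = ev2 x"
  using ev1_eq[OF rep_cls1[of e]] ev2_eq[OF rep_cls2[of x]]
  by (auto simp: induced_def ev0_def gray_cells(1))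

lemma induced: "induced \<in> strict_2_functors gray D"
proof -
  have map0: "map0 induced p = ev0 p" if "p \<in> cell0 B \<times> cell0 C" for p
    using that by (auto simp: ev0_def)
  have ext: "map0 induced \<in> extensional (cell0 gray)" "map1 induced \<in> extensional (cell1 gray)"
    "map2 induced \<in> extensional (cell2 gray)"
    by (simp_all add: induced_def)
  have *: "map0 induced \<in> cell0 gray \<rightarrow>\<^sub>E cell0 D" "map1 induced \<in> cell1 gray \<rightarrow>\<^sub>E cell1 D"
    "map2 induced \<in> cell2 gray \<rightarrow>\<^sub>E cell2 D"
    using ext by (auto simp: PiE_iff gray_cells)
  show ?thesis
    unfolding strict_2_functors_def mem_Collect_eq
    apply (intro conjI * ballI impI)
    subgoal by (auto simp: gray_cells(2) map0[OF conjunct1[OF wf1_obj]])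
    subgoal by (auto simp: gray_cells(2) map0[OF conjunct2[OF wf1_obj]])
    subgoal by (auto simp: gray_cells(3) wf2_globular)
    subgoal by (auto simp: gray_cells(3) wf2_globular)
    subgoal by (auto simp: gray_cells(1))
    subgoal by (auto simp: gray_cells(2))
    subgoal by (auto simp: gray_cells(2))
    subgoal using wf2_globular cls1_eq_iff by (auto simp: gray_cells(3))
    subgoal using wf2_globular by (auto simp: gray_cells(3))
    done
qed

end

lemma (in gray_product) gray_functor_eqI:
  assumes D: "strict_2_category D"
    and H: "H \<in> strict_2_functors gray D" "H' \<in> strict_2_functors gray D"
    and L1: "\<And>f c. f \<in> cell1 B \<Longrightarrow> c \<in> cell0 C \<Longrightarrow> map1 H (cls1 (Left1 f c)) = map1 H' (cls1 (Left1 f c))"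
    and R1: "\<And>b g. b \<in> cell0 B \<Longrightarrow> g \<in> cell1 C \<Longrightarrow> map1 H (cls1 (Right1 b g)) = map1 H' (cls1 (Right1 b g))"
    and L2: "\<And>\<phi> c. \<phi> \<in> cell2 B \<Longrightarrow> c \<in> cell0 C \<Longrightarrow> map2 H (cls2 (Left2 \<phi> c)) = map2 H' (cls2 (Left2 \<phi> c))"
    and R2: "\<And>b \<psi>. b \<in> cell0 B \<Longrightarrow> \<psi> \<in> cell2 C \<Longrightarrow> map2 H (cls2 (Right2 b \<psi>)) = map2 H' (cls2 (Right2 b \<psi>))"
    and S: "\<And>f g. f \<in> cell1 B \<Longrightarrow> g \<in> cell1 C \<Longrightarrow> map2 H (cls2 (Swap f g)) = map2 H' (cls2 (Swap f g))"
  shows "H = H'"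
proof -
  interpret G: strict_2_category gray by (rule strict_2_category_gray)
  interpret D: strict_2_category D by (rule D)
  interpret H: strict_2_functor gray D H by unfold_locales (rule H)
  interpret H': strict_2_functor gray D H' by unfold_locales (rule H)
  have 0: "map0 H p = map0 H' p" if "p \<in> cell0 gray" for p
  proof -
    obtain b c where p: "p = (b, c)" "b \<in> cell0 B" "c \<in> cell0 C" using \<open>p \<in> cell0 gray\<close>
      by (auto simp: gray_cells)
    have "src1 gray (cls1 (Left1 (id1 B b) c)) = p" using p by simp
    then show ?thesis
      using L1[of "id1 B b" c] H.map1(2)[of "cls1 (Left1 (id1 B b) c)"] 
        H'.map1(2)[of "cls1 (Left1 (id1 B b) c)"] p
      by simp
  qed
  have 1: "map1 H (cls1 e) = map1 H' (cls1 e)" if "wf1 e" for e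
    using that
  proof (induction e)
    case (Ident1 b c)
    then show ?case
      using H.map1_id[of "(b, c)"] H'.map1_id[of "(b, c)"] 0 by (simp add: gray_cells)
  next
    case (Comp1 e d)
    then show ?case
      using H.map1_comp[of "cls1 e" "cls1 d"] H'.map1_comp[of "cls1 e" "cls1 d"] by simp
  qed (simp_all add: L1 R1)
  have 2: "map2 H (cls2 x) = map2 H' (cls2 x)" if "wf2 x" for x
    using that
  proof (induction x)
    case (Ident2 e)
    then show ?case
      using H.map2_id[of "cls1 e"] H'.map2_id[of "cls1 e"] 1 by simp
  next
    case (VComp x y)
    then show ?case
      using H.map2_vcomp[of "cls2 x" "cls2 y"] H'.map2_vcomp[of "cls2 x" "cls2 y"]
      by (auto dest: cls1_eqI)
  next
    case (HComp x y)
    then show ?case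
      using H.map2_hcomp[of "cls2 x" "cls2 y"] H'.map2_hcomp[of "cls2 x" "cls2 y"]
      by (simp add: wf2_globular)
  qed (simp_all add: L2 R2 S)
  show ?thesis
    by (rule functor_eqI[OF H]) (use 0 1 2 in \<open>auto simp: gray_cells\<close>)
qed

section \<open>Functors out of a Gray tensor product, in terms of generators\<close>

text \<open>Conversely, a 2-functor on the tensor product has values on the generators which satisfy the
  images of the relations.\<close>

locale gray_functor = gray_product B C + D: strict_2_category D
  for B :: "('o, 'm, 'c) two_cat" and C :: "('p, 'n, 'd) two_cat" and D :: "('q, 'k, 'e) two_cat" +
  fixes H
  assumes H: "H \<in> strict_2_functors gray D"
begin

sublocale H: strict_2_functor gray D H
  by (intro strict_2_functor.intro strict_2_functor_axioms.intro H strict_2_category_gray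
      D.strict_2_category_axioms)

definition h1 where "h1 e = map1 H (cls1 e)"
definition h2 where "h2 x = map2 H (cls2 x)"

lemma h0 [simp]: "b \<in> cell0 B \<Longrightarrow> c \<in> cell0 C \<Longrightarrow> map0 H (b, c) \<in> cell0 D"
  by (simp add: gray_cells)

lemma h1 [simp]:
  "wf1 e \<Longrightarrow> h1 e \<in> cell1 D"
  "wf1 e \<Longrightarrow> src1 D (h1 e) = map0 H (esrc1 e)"
  "wf1 e \<Longrightarrow> tgt1 D (h1 e) = map0 H (etgt1 e)"
  by (simp_all add: h1_def)

lemma h2 [simp]:
  "wf2 x \<Longrightarrow> h2 x \<in> cell2 D"
  "wf2 x \<Longrightarrow> src2 D (h2 x) = h1 (esrc2 x)"
  "wf2 x \<Longrightarrow> tgt2 D (h2 x) = h1 (etgt2 x)"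
  by (simp_all add: h1_def h2_def)

lemma h1_eq: "eq1 e d \<Longrightarrow> h1 e = h1 d"
  by (simp add: h1_def cls1_eqI)

lemma h2_eq: "eq2 x y \<Longrightarrow> h2 x = h2 y"
  by (simp add: h2_def cls2_eqI)

lemma h1_Ident1 [simp]: "b \<in> cell0 B \<Longrightarrow> c \<in> cell0 C \<Longrightarrow> h1 (Ident1 b c) = id1 D (map0 H (b, c))"
  using H.map1_id[of "(b, c)"] by (simp add: h1_def gray_cells)

lemma h1_Comp1 [simp]:
  "wf1 e \<Longrightarrow> wf1 d \<Longrightarrow> esrc1 e = etgt1 d \<Longrightarrow> h1 (Comp1 e d) = comp1 D (h1 e) (h1 d)"
  using H.map1_comp[of "cls1 e" "cls1 d"] by (simp add: h1_def)

lemma h2_Ident2 [simp]: "wf1 e \<Longrightarrow> h2 (Ident2 e) = id2 D (h1 e)"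
  using H.map2_id[of "cls1 e"] by (simp add: h1_def h2_def)

lemma h2_VComp:
  "wf2 x \<Longrightarrow> wf2 y \<Longrightarrow> eq1 (esrc2 x) (etgt2 y) \<Longrightarrow> h2 (VComp x y) = vcomp D (h2 x) (h2 y)"
  using H.map2_vcomp[of "cls2 x" "cls2 y"] by (simp add: h2_def cls1_eqI)

lemma h2_HComp:
  "wf2 x \<Longrightarrow> wf2 y \<Longrightarrow> esrc1 (esrc2 x) = etgt1 (esrc2 y) \<Longrightarrow>
    h2 (HComp x y) = hcomp D (h2 x) (h2 y)"
  using H.map2_hcomp[of "cls2 x" "cls2 y"] by (simp add: h2_def wf2_globular)

lemma h1_Left1_comp: "f \<in> cell1 B \<Longrightarrow> f' \<in> cell1 B \<Longrightarrow> src1 B f = tgt1 B f' \<Longrightarrow> c \<in> cell0 C \<Longrightarrow>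
    h1 (Left1 (comp1 B f f') c) = comp1 D (h1 (Left1 f c)) (h1 (Left1 f' c))"
  using h1_eq[OF eq1_left_comp[of f f' c]] by simp

lemma h1_Right1_comp: "g \<in> cell1 C \<Longrightarrow> g' \<in> cell1 C \<Longrightarrow> src1 C g = tgt1 C g' \<Longrightarrow> b \<in> cell0 B \<Longrightarrow>
    h1 (Right1 b (comp1 C g g')) = comp1 D (h1 (Right1 b g)) (h1 (Right1 b g'))"
  using h1_eq[OF eq1_right_comp[of g g' b]] by simp

lemma h1_Left1_id: "b \<in> cell0 B \<Longrightarrow> c \<in> cell0 C \<Longrightarrow> h1 (Left1 (id1 B b) c) = id1 D (map0 H (b, c))"
  using h1_eq[OF eq1_left_id[of b c]] by simp

lemma h1_Right1_id: "b \<in> cell0 B \<Longrightarrow> c \<in> cell0 C \<Longrightarrow> h1 (Right1 b (id1 C c)) = id1 D (map0 H (b, c))"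
  using h1_eq[OF eq1_right_id[of b c]] by simp

lemma h2_Left2_vcomp: "\<phi> \<in> cell2 B \<Longrightarrow> \<phi>' \<in> cell2 B \<Longrightarrow> src2 B \<phi> = tgt2 B \<phi>' \<Longrightarrow> c \<in> cell0 C \<Longrightarrow>
    h2 (Left2 (vcomp B \<phi> \<phi>') c) = vcomp D (h2 (Left2 \<phi> c)) (h2 (Left2 \<phi>' c))"
  using h2_eq[OF eq2_left_vcomp[of \<phi> \<phi>' c]] by (simp add: h2_VComp eq1_refl)

lemma h2_Left2_hcomp: "\<phi> \<in> cell2 B \<Longrightarrow> \<phi>' \<in> cell2 B \<Longrightarrow> src1 B (src2 B \<phi>) = tgt1 B (src2 B \<phi>') \<Longrightarrow>
    c \<in> cell0 C \<Longrightarrow> h2 (Left2 (hcomp B \<phi> \<phi>') c) = hcomp D (h2 (Left2 \<phi> c)) (h2 (Left2 \<phi>' c))"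
  using h2_eq[OF eq2_left_hcomp[of \<phi> \<phi>' c]] by (simp add: h2_HComp)

lemma h2_Left2_id: "f \<in> cell1 B \<Longrightarrow> c \<in> cell0 C \<Longrightarrow> h2 (Left2 (id2 B f) c) = id2 D (h1 (Left1 f c))"
  using h2_eq[OF eq2_left_id[of f c]] by simp

lemma h2_Right2_vcomp: "\<psi> \<in> cell2 C \<Longrightarrow> \<psi>' \<in> cell2 C \<Longrightarrow> src2 C \<psi> = tgt2 C \<psi>' \<Longrightarrow> b \<in> cell0 B \<Longrightarrow>
    h2 (Right2 b (vcomp C \<psi> \<psi>')) = vcomp D (h2 (Right2 b \<psi>)) (h2 (Right2 b \<psi>'))"
  using h2_eq[OF eq2_right_vcomp[of \<psi> \<psi>' b]] by (simp add: h2_VComp eq1_refl)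

lemma h2_Right2_hcomp: "\<psi> \<in> cell2 C \<Longrightarrow> \<psi>' \<in> cell2 C \<Longrightarrow> src1 C (src2 C \<psi>) = tgt1 C (src2 C \<psi>') \<Longrightarrow>
    b \<in> cell0 B \<Longrightarrow> h2 (Right2 b (hcomp C \<psi> \<psi>')) = hcomp D (h2 (Right2 b \<psi>)) (h2 (Right2 b \<psi>'))"
  using h2_eq[OF eq2_right_hcomp[of \<psi> \<psi>' b]] by (simp add: h2_HComp)

lemma h2_Right2_id: "b \<in> cell0 B \<Longrightarrow> g \<in> cell1 C \<Longrightarrow> h2 (Right2 b (id2 C g)) = id2 D (h1 (Right1 b g))"
  using h2_eq[OF eq2_right_id[of b g]] by simp

lemma h2_Swap_id_right: "f \<in> cell1 B \<Longrightarrow> c \<in> cell0 C \<Longrightarrow> h2 (Swap f (id1 C c)) = id2 D (h1 (Left1 f c))"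
  using h2_eq[OF eq2_swap_id_right[of f c]] by simp

lemma h2_Swap_id_left: "b \<in> cell0 B \<Longrightarrow> g \<in> cell1 C \<Longrightarrow> h2 (Swap (id1 B b) g) = id2 D (h1 (Right1 b g))"
  using h2_eq[OF eq2_swap_id_left[of b g]] by simp

lemma h2_Swap_comp_left:
  assumes "f \<in> cell1 B" "f' \<in> cell1 B" "src1 B f = tgt1 B f'" "g \<in> cell1 C"
  shows "h2 (Swap (comp1 B f f') g) =
    vcomp D (hcomp D (h2 (Swap f g)) (id2 D (h1 (Left1 f' (src1 C g)))))
      (hcomp D (id2 D (h1 (Left1 f (tgt1 C g)))) (h2 (Swap f' g)))"
proof -
  note e = eq2_swap_comp_left[OF assms]
  have "wf2 (VComp (HComp (Swap f g) (Ident2 (Left1 f' (src1 C g))))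
               (HComp (Ident2 (Left1 f (tgt1 C g))) (Swap f' g)))"
    using eq2_wf[OF e] by blast
  then show ?thesis using h2_eq[OF e] assms by (simp add: h2_VComp h2_HComp)
qed

lemma h2_Swap_comp_right:
  assumes "f \<in> cell1 B" "g \<in> cell1 C" "g' \<in> cell1 C" "src1 C g = tgt1 C g'"
  shows "h2 (Swap f (comp1 C g g')) =
    vcomp D (hcomp D (id2 D (h1 (Right1 (tgt1 B f) g))) (h2 (Swap f g')))
      (hcomp D (h2 (Swap f g)) (id2 D (h1 (Right1 (src1 B f) g'))))"
proof -
  note e = eq2_swap_comp_right[OF assms]
  have "wf2 (VComp (HComp (Ident2 (Right1 (tgt1 B f) g)) (Swap f g'))
               (HComp (Swap f g) (Ident2 (Right1 (src1 B f) g'))))"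
    using eq2_wf[OF e] by blast
  then show ?thesis using h2_eq[OF e] assms by (simp add: h2_VComp h2_HComp)
qed

lemma h2_Swap_natural:
  assumes "\<phi> \<in> cell2 B" "\<psi> \<in> cell2 C"
  shows "vcomp D (h2 (Swap (tgt2 B \<phi>) (tgt2 C \<psi>)))
      (hcomp D (h2 (Left2 \<phi> (tgt1 C (src2 C \<psi>)))) (h2 (Right2 (src1 B (src2 B \<phi>)) \<psi>))) =
    vcomp D (hcomp D (h2 (Right2 (tgt1 B (src2 B \<phi>)) \<psi>)) (h2 (Left2 \<phi> (src1 C (src2 C \<psi>)))))
      (h2 (Swap (src2 B \<phi>) (src2 C \<psi>)))"
proof -
  have e: "eq2 (VComp (Swap (tgt2 B \<phi>) (tgt2 C \<psi>))
        (HComp (Left2 \<phi> (tgt1 C (src2 C \<psi>))) (Right2 (src1 B (src2 B \<phi>)) \<psi>)))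
      (VComp (HComp (Right2 (tgt1 B (src2 B \<phi>)) \<psi>) (Left2 \<phi> (src1 C (src2 C \<psi>))))
        (Swap (src2 B \<phi>) (src2 C \<psi>)))" (is "eq2 ?x ?y")
    using assms by (intro eq2_swap_natural) (simp_all add: hom2_def)
  have "wf2 ?x" "wf2 ?y" using eq2_wf[OF e] by blast+
  then show ?thesis using h2_eq[OF e] assms by (simp add: h2_VComp h2_HComp)
qed

end

section \<open>Transposition\<close>

text \<open>An object of \<open>C\<close> is sent to the monad that is the restriction of \<open>H\<close> to the second factor; the
  swaps with the one-element ordinal make every 1-cell of \<open>C\<close> a monad opfunctor.\<close>

definition transpose0 ::
  "('p, 'n, 'd) two_cat \<Rightarrow>
    ('p \<times> unit, ('p, 'n, unit, nat) expr1 set, ('p, 'n, 'd, unit, nat, monotone_map) expr2 set,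
      ('o, 'm, 'c) obj, ('o, 'm, 'c) arr, ('o, 'm, 'c) cel) two_fun \<Rightarrow> 'p \<Rightarrow> ('o, 'm, 'c) obj" where
  "transpose0 C H b = Mon (map0 H (b, ()))
    (map1 H (gray_data.cls1 C deloop_simplex (Right1 b 1)))
    (map2 H (gray_data.cls2 C deloop_simplex (Right2 b (1, []))))
    (map2 H (gray_data.cls2 C deloop_simplex (Right2 b (1, [0, 0]))))"

definition transpose1 where
  "transpose1 C H f = Opf (transpose0 C H (src1 C f)) (transpose0 C H (tgt1 C f))
    (map1 H (gray_data.cls1 C deloop_simplex (Left1 f ())))
    (map2 H (gray_data.cls2 C deloop_simplex (Swap f 1)))"

definition transpose2 where
  "transpose2 C H \<phi> = Tra (transpose1 C H (src2 C \<phi>)) (transpose1 C H (tgt2 C \<phi>))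
    (map2 H (gray_data.cls2 C deloop_simplex (Left2 \<phi> ())))"

definition adjunct where
  "adjunct C H = \<lparr>map0 = restrict (transpose0 C H) (cell0 C),
    map1 = restrict (transpose1 C H) (cell1 C), map2 = restrict (transpose2 C H) (cell2 C)\<rparr>"

locale mnd_functor = gray_functor C deloop_simplex B H
  for C :: "('p, 'n, 'd) two_cat" and B :: "('o, 'm, 'c) tower" (structure) and H
begin

abbreviation "t b \<equiv> h1 (Right1 b 1)"
abbreviation "r b \<psi> \<equiv> h2 (Right2 b \<psi>)"

lemma transpose_simps:
  "transpose0 C H b = Mon (map0 H (b, ())) (t b) (r b (1, [])) (r b (1, [0, 0]))"
  "transpose1 C H f = Opf (transpose0 C H (src1 C f)) (transpose0 C H (tgt1 C f))
    (h1 (Left1 f ())) (h2 (Swap f 1))"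
  "transpose2 C H \<phi> = Tra (transpose1 C H (src2 C \<phi>)) (transpose1 C H (tgt2 C \<phi>)) (h2 (Left2 \<phi> ()))"
  by (simp_all add: transpose0_def transpose1_def transpose2_def h1_def h2_def)

declare D.strict_2_category_axioms [simp]

lemma transpose_sel [simp]:
  "ob (transpose0 C H b) = map0 H (b, ())" "en (transpose0 C H b) = t b"
  "unt (transpose0 C H b) = r b (1, [])" "mlt (transpose0 C H b) = r b (1, [0, 0])"
  "adom (transpose1 C H f) = transpose0 C H (src1 C f)"
  "acod (transpose1 C H f) = transpose0 C H (tgt1 C f)"
  "und1 (transpose1 C H f) = h1 (Left1 f ())" "law (transpose1 C H f) = h2 (Swap f 1)"
  "cdom (transpose2 C H \<phi>) = transpose1 C H (src2 C \<phi>)"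
  "ccod (transpose2 C H \<phi>) = transpose1 C H (tgt2 C \<phi>)" "und2 (transpose2 C H \<phi>) = h2 (Left2 \<phi> ())"
  by (simp_all add: transpose_simps)

lemma t_0 [simp]: "b \<in> cell0 C \<Longrightarrow> h1 (Right1 b 0) = \<one> (map0 H (b, ()))"
  and t_Suc: "b \<in> cell0 C \<Longrightarrow> h1 (Right1 b (Suc m)) = t b \<cdot> h1 (Right1 b m)"
  using h1_Right1_id[of b "()"] h1_Right1_comp[of 1 m b] by simp_all

lemma transpose0: 
  assumes b: "b \<in> cell0 C"
  shows "monad_obj B (transpose0 C H b)"
proof -
  let ?\<eta> = "(1, []) :: monotone_map" and ?\<mu> = "(1, [0, 0]) :: monotone_map"
  have id: "r b (Suc 0, [0]) = \<iota> (t b)" using h2_Right2_id[of b 1] b by simp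
  have v: "r b (vcomp deloop_simplex \<psi> \<psi>') = r b \<psi> \<bullet> r b \<psi>'"
    if "\<psi> \<in> cell2 deloop_simplex" "\<psi>' \<in> cell2 deloop_simplex" "length (snd \<psi>) = fst \<psi>'" for \<psi> \<psi>'
    using h2_Right2_vcomp[of \<psi> \<psi>' b] that b by simp
  have h: "r b (hcomp deloop_simplex \<psi> \<psi>') = r b \<psi> \<star> r b \<psi>'"
    if "\<psi> \<in> cell2 deloop_simplex" "\<psi>' \<in> cell2 deloop_simplex" for \<psi> \<psi>'
    using h2_Right2_hcomp[of \<psi> \<psi>' b] that b by simp
  have "monad_in B (map0 H (b, ())) (t b) (r b ?\<eta>) (r b ?\<mu>)"
  proof
    show "map0 H (b, ()) \<in> cell0 B" "t b \<in> hom1 B (map0 H (b, ())) (map0 H (b, ()))"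
      using b by (simp_all add: hom1_def)
    show "r b ?\<eta> \<in> hom2 B (\<one> (map0 H (b, ()))) (t b)" "r b ?\<mu> \<in> hom2 B (t b \<cdot> t b) (t b)"
      using b t_Suc[of b 1] by (simp_all add: hom2_def)
    show "r b ?\<mu> \<bullet> (r b ?\<eta> \<star> \<iota> (t b)) = \<iota> (t b)"
      using v[of ?\<mu> "hcomp deloop_simplex ?\<eta> (1, [0])"] h[of ?\<eta> "(1, [0])"]
        by (simp add: id cell2_deloop)
    show "r b ?\<mu> \<bullet> (\<iota> (t b) \<star> r b ?\<eta>) = \<iota> (t b)"
      using v[of ?\<mu> "hcomp deloop_simplex (1, [0]) ?\<eta>"] h[of "(1, [0])" ?\<eta>]
        by (simp add: id cell2_deloop)
    show "r b ?\<mu> \<bullet> (r b ?\<mu> \<star> \<iota> (t b)) = r b ?\<mu> \<bullet> (\<iota> (t b) \<star> r b ?\<mu>)"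
      using v[of ?\<mu> "hcomp deloop_simplex ?\<mu> (1, [0])"] h[of ?\<mu> "(1, [0])"]
        v[of ?\<mu> "hcomp deloop_simplex (1, [0]) ?\<mu>"] h[of "(1, [0])" ?\<mu>] by (simp add: id cell2_deloop)
  qed
  then show ?thesis by (simp add: monad_obj_def transpose_simps)
qed

lemma transpose1:
  assumes f: "f \<in> cell1 C"
  shows "monad_arr B (transpose1 C H f)"
proof -
  let ?a = "src1 C f" and ?b = "tgt1 C f"
  let ?f = "h1 (Left1 f ())" and ?\<sigma> = "h2 (Swap f 1)"
  have obj: "monad_in B (map0 H (b, ())) (t b) (r b (1, [])) (r b (1, [0, 0]))" if "b \<in> cell0 C" for b
    using monad_objD[OF D.strict_2_category_axioms transpose0[OF that]] by (simp add: transpose_simps)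
  \<comment> \<open>the axioms of a monad opfunctor are naturality of the swaps of \<open>f\<close> for \<open>0 \<rightarrow> 1\<close> and \<open>2 \<rightarrow> 1\<close>\<close>
  have natural: "h2 (Swap f (fst \<psi>)) \<bullet> (\<iota> ?f \<star> r ?a \<psi>) = (r ?b \<psi> \<star> \<iota> ?f) \<bullet> h2 (Swap f (length (snd \<psi>)))"
    if "\<psi> \<in> cell2 deloop_simplex" for \<psi>
    using h2_Swap_natural[of "id2 C f" \<psi>] that f by (simp add: h2_Left2_id)
  have swap2: "h2 (Swap f 2) = (\<iota> (t ?b) \<star> ?\<sigma>) \<bullet> (?\<sigma> \<star> \<iota> (t ?a))"
    using h2_Swap_comp_right[of f 1 1] f by (simp add: numeral_2_eq_2)
  have swap0: "h2 (Swap f 0) = \<iota> ?f"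
    using h2_Swap_id_right[of f "()"] f by simp
  have "monad_opfunctor B (map0 H (?a, ())) (t ?a) (r ?a (1, [])) (r ?a (1, [0, 0]))
      (map0 H (?b, ())) (t ?b) (r ?b (1, [])) (r ?b (1, [0, 0])) ?f ?\<sigma>"
  proof (intro monad_opfunctor.intro monad_opfunctor_axioms.intro obj)
    show "?f \<in> hom1 B (map0 H (?a, ())) (map0 H (?b, ()))" using f by (simp add: hom1_def)
    show "?\<sigma> \<in> hom2 B (?f \<cdot> t ?a) (t ?b \<cdot> ?f)" using f by (simp add: hom2_def)
    show "?\<sigma> \<bullet> (\<iota> ?f \<star> r ?a (1, [])) = r ?b (1, []) \<star> \<iota> ?f"
      using natural[of "(1, [])"] f by (simp add: swap0)
    show "?\<sigma> \<bullet> (\<iota> ?f \<star> r ?a (1, [0, 0])) =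
      (r ?b (1, [0, 0]) \<star> \<iota> ?f) \<bullet> (\<iota> (t ?b) \<star> ?\<sigma>) \<bullet> (?\<sigma> \<star> \<iota> (t ?a))"
      using natural[of "(1, [0, 0])"] f t_Suc[of ?b 1] t_Suc[of ?a 1]
        by (simp add: swap2 flip: numeral_2_eq_2)
  qed (use f in simp_all)
  with f show ?thesis by (simp add: monad_arr_def transpose_simps(2) transpose0)
qed

lemma transpose2:
  assumes \<phi>: "\<phi> \<in> cell2 C"
  shows "monad_cel B (transpose2 C H \<phi>)"
proof -
  let ?a = "src1 C (src2 C \<phi>)" and ?b = "tgt1 C (src2 C \<phi>)"
  have "monad_arr B (transpose1 C H (src2 C \<phi>))" "monad_arr B (transpose1 C H (tgt2 C \<phi>))"
    using \<phi> by (simp_all add: transpose1)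
  moreover have "src1 C (tgt2 C \<phi>) = ?a" "tgt1 C (tgt2 C \<phi>) = ?b"
    using \<phi> by (simp_all add: B.src_globular B.tgt_globular)
  moreover have "h2 (Swap (tgt2 C \<phi>) 1) \<bullet> (h2 (Left2 \<phi> ()) \<star> \<iota> (t ?a)) =
      (\<iota> (t ?b) \<star> h2 (Left2 \<phi> ())) \<bullet> h2 (Swap (src2 C \<phi>) 1)"
    using h2_Swap_natural[of \<phi> "id2 deloop_simplex 1"] \<phi> h2_Right2_id[of _ 1]
      by (simp add: cell2_deloop)
  ultimately show ?thesis
    using \<phi> by (simp add: monad_cel_def transpose_simps(3) hom2_def)
qed

lemma adjunct: "adjunct C H \<in> strict_2_functors C (monads B)"
proof -
  have id: "transpose1 C H (id1 C b) = monad_id1 B (transpose0 C H b)" if "b \<in> cell0 C" for b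
    using that h2_Swap_id_left[of b 1]
    by (simp add: transpose_simps(2) monad_id1_def h1_Left1_id)
  have comp: "transpose1 C H (comp1 C f g) = monad_comp1 B (transpose1 C H f) (transpose1 C H g)"
    if "f \<in> cell1 C" "g \<in> cell1 C" "src1 C f = tgt1 C g" for f g
    using that h2_Swap_comp_left[of f g 1]
    by (simp add: transpose_simps(2) monad_comp1_def h1_Left1_comp)
  have *: "map0 (adjunct C H) \<in> cell0 C \<rightarrow>\<^sub>E cell0 (monads B)"
    "map1 (adjunct C H) \<in> cell1 C \<rightarrow>\<^sub>E cell1 (monads B)"
    "map2 (adjunct C H) \<in> cell2 C \<rightarrow>\<^sub>E cell2 (monads B)"
    by (auto simp: adjunct_def transpose0 transpose1 transpose2)
  show ?thesis
    unfolding strict_2_functors_def mem_Collect_eq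
    apply (intro conjI * ballI impI)
    subgoal by (simp add: adjunct_def)
    subgoal by (simp add: adjunct_def)
    subgoal by (simp add: adjunct_def transpose_simps(3))
    subgoal by (simp add: adjunct_def transpose_simps(3))
    subgoal by (simp add: adjunct_def id)
    subgoal by (simp add: adjunct_def comp)
    subgoal by (simp add: adjunct_def transpose_simps(3) h2_Left2_id)
    subgoal by (simp add: adjunct_def transpose_simps(3) h2_Left2_vcomp)
    subgoal
      by (simp add: adjunct_def transpose_simps(3) h2_Left2_hcomp comp B.src_globular B.tgt_globular)
    done
qed

end

text \<open>All swaps \<open>\<gamma>\<^bsub>f,m\<^esub>\<close> are determined by \<open>\<gamma>\<^bsub>f,1\<^esub>\<close>, because \<open>m\<close> is a sum of copies of \<open>1\<close>.\<close>

lemma transpose_inj: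
  assumes C: "strict_2_category C" and B: "strict_2_category B"
    and H: "H \<in> strict_2_functors (mnd C) B" "H' \<in> strict_2_functors (mnd C) B"
    and eq: "adjunct C H = adjunct C H'"
  shows "H = H'"
proof -
  interpret C: strict_2_category C by (rule C)
  interpret deloop: strict_2_category deloop_simplex by (rule strict_2_category_deloop)
  interpret B: strict_2_category B by (rule B)
  interpret I: mnd_functor C B H by unfold_locales (rule H(1)[unfolded mnd_def])
  interpret J: mnd_functor C B H' by unfold_locales (rule H(2)[unfolded mnd_def])
  have 0: "transpose0 C H b = transpose0 C H' b" if "b \<in> cell0 C" for b
    using fun_cong[OF arg_cong[OF eq, of map0], of b] that by (simp add: adjunct_def)
  have 1: "transpose1 C H f = transpose1 C H' f" if "f \<in> cell1 C" for f
    using fun_cong[OF arg_cong[OF eq, of map1], of f] that by (simp add: adjunct_def)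
  have 2: "transpose2 C H \<phi> = transpose2 C H' \<phi>" if "\<phi> \<in> cell2 C" for \<phi>
    using fun_cong[OF arg_cong[OF eq, of map2], of \<phi>] that by (simp add: adjunct_def)
  have base: "I.t b = J.t b" "I.r b (1, []) = J.r b (1, [])" "I.r b (1, [0, 0]) = J.r b (1, [0, 0])"
    "map0 H (b, ()) = map0 H' (b, ())" if "b \<in> cell0 C" for b
    using 0[OF that] by (simp_all add: I.transpose_simps(1) J.transpose_simps(1))
  have L1: "I.h1 (Left1 f c) = J.h1 (Left1 f c)" and S1: "I.h2 (Swap f 1) = J.h2 (Swap f 1)"
    if "f \<in> cell1 C" for f and c :: unit
    using 1[OF that] by (simp_all add: I.transpose_simps(2) J.transpose_simps(2))
  have L2: "I.h2 (Left2 \<phi> c) = J.h2 (Left2 \<phi> c)" if "\<phi> \<in> cell2 C" for \<phi> and c :: unit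
    using 2[OF that] by (simp add: I.transpose_simps(3) J.transpose_simps(3))
  have R1: "I.h1 (Right1 b m) = J.h1 (Right1 b m)" if "b \<in> cell0 C" for b m
    using that base[OF that] by (induction m) (simp_all only: I.t_0 J.t_0 I.t_Suc J.t_Suc)
  have R2: "I.r b \<psi> = J.r b \<psi>" if b: "b \<in> cell0 C" and "\<psi> \<in> cell2 deloop_simplex" for b \<psi>
    using that(2)
  proof (induction rule: deloop_induct)
    case (ident m)
    show ?case using I.h2_Right2_id[of b m] J.h2_Right2_id[of b m] R1 b by simp
  next
    case (vcomp \<phi> \<psi>)
    then show ?case using I.h2_Right2_vcomp[of \<phi> \<psi> b] J.h2_Right2_vcomp[of \<phi> \<psi> b] b by simp
  next
    case (hcomp \<phi> \<psi>)
    then show ?case using I.h2_Right2_hcomp[of \<phi> \<psi> b] J.h2_Right2_hcomp[of \<phi> \<psi> b] b by simp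
  qed (use b base in simp_all)
  have S: "I.h2 (Swap f m) = J.h2 (Swap f m)" if f: "f \<in> cell1 C" for f m
  proof (induction m)
    case 0
    show ?case using I.h2_Swap_id_right[of f "()"] J.h2_Swap_id_right[of f "()"] L1 f by simp
  next
    case (Suc m)
    then show ?case
      using I.h2_Swap_comp_right[of f 1 m] J.h2_Swap_comp_right[of f 1 m] S1[OF f] R1 f by simp
  qed
  show ?thesis
    by (rule I.gray_functor_eqI[OF B H[unfolded mnd_def]])
      (simp_all only: L1 R1 L2 R2 S
        flip: I.h1_def J.h1_def I.h2_def J.h2_def)
qed

definition monad_functor ::
  "('o, 'm, 'c) tower \<Rightarrow> ('o, 'm, 'c) obj \<Rightarrow> 
    (unit, nat, monotone_map, ('o, 'm, 'c) obj, ('o, 'm, 'c) arr, ('o, 'm, 'c) cel) two_fun" where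
  "monad_functor B X = \<lparr>map0 = (\<lambda>_. ob X), map1 = pow1 B (ob X) (en X),
    map2 = (\<lambda>\<psi>\<in>cell2 deloop_simplex. monad_map B (ob X) (en X) (unt X) (mlt X) \<psi>)\<rparr>"

lemma monad_functor:
  assumes B: "strict_2_category B" and X: "monad_obj B X"
  shows "monad_functor B X \<in> strict_2_functors deloop_simplex B"
proof -
  interpret monad_in B "ob X" "en X" "unt X" "mlt X" by (rule monad_objD[OF B X])
  have v: "(fst \<phi>, map ((!) (snd \<phi>)) (snd \<psi>)) \<in> cell2 deloop_simplex"
    "mon (fst \<phi>, map ((!) (snd \<phi>)) (snd \<psi>)) = mon \<phi> \<bullet>\<^bsub>B\<^esub> mon \<psi>"
    if "\<phi> \<in> cell2 deloop_simplex" "\<psi> \<in> cell2 deloop_simplex" "length (snd \<phi>) = fst \<psi>" for \<phi> \<psi>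
    using that mon_vcomp[of "fst \<phi>" "snd \<phi>" "snd \<psi>"] vcomp_deloop_closed[of "fst \<phi>" "snd \<phi>" "snd \<psi>"]
    by auto
  have h: "(fst \<phi> + fst \<psi>, snd \<phi> @ map ((+) (fst \<phi>)) (snd \<psi>)) \<in> cell2 deloop_simplex"
    "mon (fst \<phi> + fst \<psi>, snd \<phi> @ map ((+) (fst \<phi>)) (snd \<psi>)) = mon \<phi> \<star>\<^bsub>B\<^esub> mon \<psi>"
    if "\<phi> \<in> cell2 deloop_simplex" "\<psi> \<in> cell2 deloop_simplex" for \<phi> \<psi>
    using that mon_hcomp[of "fst \<phi>" "snd \<phi>" "fst \<psi>" "snd \<psi>"]
      hcomp_deloop_closed[of "fst \<phi>" "snd \<phi>" "fst \<psi>" "snd \<psi>"] by auto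
  show ?thesis
    unfolding strict_2_functors_def mem_Collect_eq
    by (intro conjI ballI impI) (auto simp: monad_functor_def v h)
qed

locale into_monads = strict_2_functor C "monads B" K + B: strict_2_category B
  for C :: "('p, 'n, 'd) two_cat" and B :: "('o, 'm, 'c) tower" (structure) and K
begin

declare B.strict_2_category_axioms [simp]

lemma K [simp]: "b \<in> cell0 C \<Longrightarrow> monad_obj B (map0 K b)"
  "f \<in> cell1 C \<Longrightarrow> monad_arr B (map1 K f)"
  "f \<in> cell1 C \<Longrightarrow> adom (map1 K f) = map0 K (src1 C f)"
  "f \<in> cell1 C \<Longrightarrow> acod (map1 K f) = map0 K (tgt1 C f)"
  "\<phi> \<in> cell2 C \<Longrightarrow> monad_cel B (map2 K \<phi>)"
  "\<phi> \<in> cell2 C \<Longrightarrow> cdom (map2 K \<phi>) = map1 K (src2 C \<phi>)"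
  "\<phi> \<in> cell2 C \<Longrightarrow> ccod (map2 K \<phi>) = map1 K (tgt2 C \<phi>)"
  using map0 map1 map2 by simp_all

definition underlying where
  "underlying = \<lparr>map0 = (\<lambda>b\<in>cell0 C. ob (map0 K b)), map1 = (\<lambda>f\<in>cell1 C. und1 (map1 K f)),
    map2 = (\<lambda>\<phi>\<in>cell2 C. und2 (map2 K \<phi>))\<rparr>"

lemmas closed [simp] = A.src1_closed A.tgt1_closed A.src2_closed A.tgt2_closed

lemma underlying: "underlying \<in> strict_2_functors C B"
  unfolding strict_2_functors_def mem_Collect_eq
  by (intro conjI ballI impI) (auto simp: underlying_def preserves)

definition swaps where
  "swaps f m = law_n B (ob (map0 K (src1 C f))) (en (map0 K (src1 C f))) (en (map0 K (tgt1 C f)))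
    (und1 (map1 K f)) (law (map1 K f)) m"

lemma opfunctor:
  assumes "f \<in> cell1 C" "map0 K (src1 C f) = X" "map0 K (tgt1 C f) = Y"
  shows "monad_opfunctor B (ob X) (en X) (unt X) (mlt X) (ob Y) (en Y) (unt Y) (mlt Y)
    (und1 (map1 K f)) (law (map1 K f))"
  using monad_arrD[OF B.strict_2_category_axioms K(2)[OF assms(1)]] assms by simp

lemma swaps [simp]:
  assumes "f \<in> cell1 C"
  shows "swaps f m \<in> cell2 B"
    "src2 B (swaps f m) =
      und1 (map1 K f) \<cdot> pow1 B (ob (map0 K (src1 C f))) (en (map0 K (src1 C f))) m"
    "tgt2 B (swaps f m) =
      pow1 B (ob (map0 K (tgt1 C f))) (en (map0 K (tgt1 C f))) m \<cdot> und1 (map1 K f)"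
  using monad_opfunctor.lawn[OF opfunctor[OF assms refl refl]] by (simp_all add: swaps_def)

lemma swaps_natural:
  assumes \<phi>: "\<phi> \<in> hom2 C f f'" and \<psi>: "\<psi> \<in> hom2 deloop_simplex m m'"
  defines "X \<equiv> map0 K (src1 C f)" and "Y \<equiv> map0 K (tgt1 C f)"
  shows "swaps f' m' \<bullet> (und2 (map2 K \<phi>) \<star> monad_map B (ob X) (en X) (unt X) (mlt X) \<psi>) =
    (monad_map B (ob Y) (en Y) (unt Y) (mlt Y) \<psi> \<star> und2 (map2 K \<phi>)) \<bullet> swaps f m"
proof -
  have \<psi>': "\<psi> \<in> cell2 deloop_simplex" "length (snd \<psi>) = m" "fst \<psi> = m'"
    using \<psi> by (simp_all add: hom2_def)
  have \<phi>': "\<phi> \<in> cell2 C" "src2 C \<phi> = f" "tgt2 C \<phi> = f'" using \<phi> by (auto simp: hom2_def)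
  then have f: "f \<in> cell1 C" "f' \<in> cell1 C" by auto
  have XY: "map0 K (src1 C f') = X" "map0 K (tgt1 C f') = Y"
    using A.src_globular[OF \<phi>'(1)] A.tgt_globular[OF \<phi>'(1)] \<phi>' by (simp_all add: X_def Y_def)
  interpret F: monad_opfunctor B "ob X" "en X" "unt X" "mlt X" "ob Y" "en Y" "unt Y" "mlt Y"
      "und1 (map1 K f)" "law (map1 K f)"
    by (rule opfunctor[OF f(1)]) (simp_all add: X_def Y_def)
  interpret G: monad_opfunctor B "ob X" "en X" "unt X" "mlt X" "ob Y" "en Y" "unt Y" "mlt Y"
      "und1 (map1 K f')" "law (map1 K f')"
    by (rule opfunctor[OF f(2)]) (simp_all add: XY)
  let ?\<phi> = "und2 (map2 K \<phi>)"
  have c: "?\<phi> \<in> cell2 B" "src2 B ?\<phi> = und1 (map1 K f)" "tgt2 B ?\<phi> = und1 (map1 K f')"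
    using \<phi>' by simp_all
  have nat: "G.lawn m \<bullet> (?\<phi> \<star> \<iota> (F.S.pow m)) = (\<iota> (F.T.pow m) \<star> ?\<phi>) \<bullet> F.lawn m"
    using monad_cel_law[OF B.strict_2_category_axioms K(5)[OF \<phi>'(1)]] c \<phi>' f X_def Y_def
    by (intro law_n_natural[OF F.monad_opfunctor_axioms G.monad_opfunctor_axioms])
      (simp_all add: hom2_def)
  have s: "swaps f m = F.lawn m" "swaps f' m' = G.lawn m'"
    by (simp_all add: swaps_def XY X_def Y_def)
  have "G.lawn m' \<bullet> (?\<phi> \<star> F.S.mon \<psi>) =
      G.lawn m' \<bullet> ((\<iota> (und1 (map1 K f')) \<star> F.S.mon \<psi>) \<bullet> (?\<phi> \<star> \<iota> (F.S.pow m)))"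
    using B.exchange(2)[of ?\<phi> "F.S.mon \<psi>"] c \<psi>' by simp
  also have "\<dots> = (F.T.mon \<psi> \<star> \<iota> (und1 (map1 K f'))) \<bullet> (G.lawn m \<bullet> (?\<phi> \<star> \<iota> (F.S.pow m)))"
    using G.lawn_natural[OF \<psi>'(1)] \<psi>' c by (intro B.vcomp_eq_extend) simp_all
  also have "\<dots> = (F.T.mon \<psi> \<star> \<iota> (und1 (map1 K f'))) \<bullet> ((\<iota> (F.T.pow m) \<star> ?\<phi>) \<bullet> F.lawn m)"
    by (simp only: nat)
  also have "\<dots> = ((F.T.mon \<psi> \<star> \<iota> (und1 (map1 K f'))) \<bullet> (\<iota> (F.T.pow m) \<star> ?\<phi>)) \<bullet> F.lawn m"
    using \<psi>' c by simp
  also have "\<dots> = (F.T.mon \<psi> \<star> ?\<phi>) \<bullet> F.lawn m"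
    using B.exchange(1)[of "F.T.mon \<psi>" ?\<phi>] c \<psi>' by simp
  finally show ?thesis by (simp only: s)
qed

text \<open>The images of the relations of the tensor product are the laws of the iterates \<open>law_n\<close>.\<close>

lemma cone: "gray_cone C deloop_simplex B (\<lambda>_. underlying) (\<lambda>b. monad_functor B (map0 K b)) swaps"
proof (intro gray_cone.intro gray_product.intro gray_cone_axioms.intro A.strict_2_category_axioms
    strict_2_category_deloop B.strict_2_category_axioms)
  fix f and c :: unit assume f: "f \<in> cell1 C"
  then show "swaps f (id1 deloop_simplex c) = \<iota> (map1 underlying f)"
    by (simp add: swaps_def underlying_def)
next
  fix b and m :: nat assume "b \<in> cell0 C"
  then show "swaps (id1 C b) m = \<iota> (map1 (monad_functor B (map0 K b)) m)"
    using monad_in.law_n_id[OF monad_objD[OF B.strict_2_category_axioms K(1)]]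
    by (simp add: swaps_def preserves monad_functor_def)
next
  fix f f' and m :: nat
  assume "f \<in> cell1 C" "f' \<in> cell1 C" "src1 C f = tgt1 C f'"
  then show "swaps (comp1 C f f') m =
      (swaps f m \<star> \<iota> (map1 underlying f')) \<bullet> (\<iota> (map1 underlying f) \<star> swaps f' m)"
    using law_n_comp[OF opfunctor[OF _ refl refl, of f'] opfunctor[of f "map0 K (tgt1 C f')"]]
    by (simp add: swaps_def preserves underlying_def)
next
  fix f and m m' :: nat assume f: "f \<in> cell1 C"
  show "swaps f (comp1 deloop_simplex m m') =
      (\<iota> (map1 (monad_functor B (map0 K (tgt1 C f))) m) \<star> swaps f m') \<bullet>
      (swaps f m \<star> \<iota> (map1 (monad_functor B (map0 K (src1 C f))) m'))"
    using monad_opfunctor.lawn_add[OF opfunctor[OF f refl refl], of m m']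
    by (simp add: swaps_def monad_functor_def)
next
  fix \<phi> f f' \<psi> m m' assume "\<phi> \<in> hom2 C f f'" "\<psi> \<in> hom2 deloop_simplex m m'"
  then show "swaps f' m' \<bullet> (map2 underlying \<phi> \<star> map2 (monad_functor B (map0 K (src1 C f))) \<psi>) =
      (map2 (monad_functor B (map0 K (tgt1 C f))) \<psi> \<star> map2 underlying \<phi>) \<bullet> swaps f m"
    using swaps_natural[of \<phi> f f' \<psi> m m'] by (simp add: underlying_def monad_functor_def hom2_def)
qed (simp_all add: underlying monad_functor, simp_all add: underlying_def monad_functor_def hom2_def)

lemma ex_transpose: "\<exists>H \<in> strict_2_functors (mnd C) B. adjunct C H = K"
proof -
  interpret cone: gray_cone C deloop_simplex B "\<lambda>_. underlying" "\<lambda>b. monad_functor B (map0 K b)" swaps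
    by (rule cone)
  have H: "cone.induced \<in> strict_2_functors cone.gray B" by (rule cone.induced)
  then interpret H: mnd_functor C B cone.induced by unfold_locales
  have [simp]: "H.h1 e = cone.ev1 e" if "cone.wf1 e" for e using that by (simp add: H.h1_def)
  have [simp]: "H.h2 x = cone.ev2 x" if "cone.wf2 x" for x using that by (simp add: H.h2_def)
  have 0: "transpose0 C cone.induced b = map0 K b" if "b \<in> cell0 C" for b
  proof -
    interpret monad_in B "ob (map0 K b)" "en (map0 K b)" "unt (map0 K b)" "mlt (map0 K b)"
      using that by (intro monad_objD) simp_all
    have "map0 K b = Mon (ob (map0 K b)) (en (map0 K b)) (unt (map0 K b)) (mlt (map0 K b))"
      using K(1)[OF that] unfolding monad_obj_def by blast
    then show ?thesis
      using that by (simp add: H.transpose_simps(1)) (simp add: underlying_def monad_functor_def)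
  qed
  have 1: "transpose1 C cone.induced f = map1 K f" if f: "f \<in> cell1 C" for f
  proof -
    interpret monad_opfunctor B "ob (map0 K (src1 C f))" "en (map0 K (src1 C f))"
        "unt (map0 K (src1 C f))" "mlt (map0 K (src1 C f))"
        "ob (map0 K (tgt1 C f))" "en (map0 K (tgt1 C f))"
        "unt (map0 K (tgt1 C f))" "mlt (map0 K (tgt1 C f))" "und1 (map1 K f)" "law (map1 K f)"
      by (rule opfunctor[OF f refl refl])
    have "map1 K f = Opf (adom (map1 K f)) (acod (map1 K f)) (und1 (map1 K f)) (law (map1 K f))"
      using K(2)[OF f] unfolding monad_arr_def by blast
    moreover have "swaps f 1 = law (map1 K f)" by (simp add: swaps_def)
    ultimately show ?thesis
      using f by (simp add: H.transpose_simps(2) 0) (simp add: underlying_def)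
  qed
  have 2: "transpose2 C cone.induced \<phi> = map2 K \<phi>" if \<phi>: "\<phi> \<in> cell2 C" for \<phi>
  proof -
    have "Tra (cdom (map2 K \<phi>)) (ccod (map2 K \<phi>)) (und2 (map2 K \<phi>)) = map2 K \<phi>"
      using K(5)[OF \<phi>] unfolding monad_cel_def by metis
    then show ?thesis
      using \<phi> by (simp add: H.transpose_simps(3) 1) (simp add: underlying_def)
  qed
  have "adjunct C cone.induced = K"
    by (rule functor_eqI[OF H.adjunct F]) (simp_all add: adjunct_def 0 1 2)
  with H show ?thesis by (auto simp: mnd_def)
qed

end

theorem bij_betw_transpose:
  assumes C: "strict_2_category C" and B: "strict_2_category B"
  shows "bij_betw (adjunct C) (strict_2_functors (mnd C) B) (strict_2_functors C (monads B))"
proof (rule bij_betwI')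
  fix H H' assume "H \<in> strict_2_functors (mnd C) B" "H' \<in> strict_2_functors (mnd C) B"
  then show "adjunct C H = adjunct C H' \<longleftrightarrow> H = H'" using transpose_inj[OF C B] by blast
next
  fix H assume "H \<in> strict_2_functors (mnd C) B"
  then have "mnd_functor C B H"
    by (intro mnd_functor.intro gray_functor.intro gray_product.intro gray_functor_axioms.intro C B
        strict_2_category_deloop) (simp add: mnd_def)
  then show "adjunct C H \<in> strict_2_functors C (monads B)" by (rule mnd_functor.adjunct)
next
  fix K assume "K \<in> strict_2_functors C (monads B)"
  then have "into_monads C B K"
    by (intro into_monads.intro strict_2_functor.intro strict_2_functor_axioms.intro C B
        strict_2_category_monads)
  from into_monads.ex_transpose[OF this]
  show "\<exists>H \<in> strict_2_functors (mnd C) B. K = adjunct C H" by blast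
qed

section \<open>Composition of 2-functors and transport of structure\<close>

definition compose where
  "compose A G F = \<lparr>map0 = (\<lambda>a\<in>cell0 A. map0 G (map0 F a)), map1 = (\<lambda>f\<in>cell1 A. map1 G (map1 F f)),
    map2 = (\<lambda>\<alpha>\<in>cell2 A. map2 G (map2 F \<alpha>))\<rparr>"

lemma compose_simps [simp]:
  "a \<in> cell0 A \<Longrightarrow> map0 (compose A G F) a = map0 G (map0 F a)"
  "f \<in> cell1 A \<Longrightarrow> map1 (compose A G F) f = map1 G (map1 F f)"
  "\<alpha> \<in> cell2 A \<Longrightarrow> map2 (compose A G F) \<alpha> = map2 G (map2 F \<alpha>)"
  by (simp_all add: compose_def)

lemma strict_2_functorI:
  "strict_2_category A \<Longrightarrow> strict_2_category B \<Longrightarrow> F \<in> strict_2_functors A B \<Longrightarrow> strict_2_functor A B F"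
  by (intro strict_2_functor.intro strict_2_functor_axioms.intro)

lemma compose_functor:
  assumes "strict_2_functor A B F" "strict_2_functor B C G"
  shows "strict_2_functor A C (compose A G F)"
proof -
  interpret F: strict_2_functor A B F by fact
  interpret G: strict_2_functor B C G by fact
  have "compose A G F \<in> strict_2_functors A C"
    unfolding strict_2_functors_def mem_Collect_eq
    by (intro conjI ballI impI)
      (auto simp: compose_def F.preserves G.preserves F.A.src1_closed F.A.tgt1_closed
        F.A.src2_closed F.A.tgt2_closed)
  then show ?thesis
    by (intro strict_2_functorI F.A.strict_2_category_axioms G.B.strict_2_category_axioms)
qed

text \<open>Renaming of cells by \<open>u\<close> with partial inverse \<open>v\<close>. Both the numbering of the iterates
  \<open>mnd_power\<close> and the embedding of an arbitrary target into the types \<open>obj\<close>, \<open>arr\<close>, \<open>cel\<close> are of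
  this form.\<close>

definition transport ::
  "('o \<Rightarrow> 'p) \<Rightarrow> ('m \<Rightarrow> 'n) \<Rightarrow> ('c \<Rightarrow> 'd) \<Rightarrow> ('p \<Rightarrow> 'o) \<Rightarrow> ('n \<Rightarrow> 'm) \<Rightarrow> ('d \<Rightarrow> 'c) \<Rightarrow>
    ('o, 'm, 'c) two_cat \<Rightarrow> ('p, 'n, 'd) two_cat" where
  "transport u0 u1 u2 v0 v1 v2 A = \<lparr>
     cell0 = u0 ` cell0 A, cell1 = u1 ` cell1 A, cell2 = u2 ` cell2 A,
     src1 = (\<lambda>f. u0 (src1 A (v1 f))), tgt1 = (\<lambda>f. u0 (tgt1 A (v1 f))),
     src2 = (\<lambda>\<alpha>. u1 (src2 A (v2 \<alpha>))), tgt2 = (\<lambda>\<alpha>. u1 (tgt2 A (v2 \<alpha>))),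
     id1 = (\<lambda>a. u1 (id1 A (v0 a))),
     comp1 = (\<lambda>f g. u1 (comp1 A (v1 f) (v1 g))),
     id2 = (\<lambda>f. u2 (id2 A (v1 f))),
     vcomp = (\<lambda>\<alpha> \<beta>. u2 (vcomp A (v2 \<alpha>) (v2 \<beta>))),
     hcomp = (\<lambda>\<alpha> \<beta>. u2 (hcomp A (v2 \<alpha>) (v2 \<beta>)))\<rparr>"

locale transported = A: strict_2_category A
  for A :: "('o, 'm, 'c) two_cat" +
  fixes u0 :: "'o \<Rightarrow> 'p" and u1 :: "'m \<Rightarrow> 'n" and u2 :: "'c \<Rightarrow> 'd" and v0 v1 v2
  assumes inverse [simp]: "a \<in> cell0 A \<Longrightarrow> v0 (u0 a) = a" "f \<in> cell1 A \<Longrightarrow> v1 (u1 f) = f"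
    "\<alpha> \<in> cell2 A \<Longrightarrow> v2 (u2 \<alpha>) = \<alpha>"
begin

abbreviation "T \<equiv> transport u0 u1 u2 v0 v1 v2 A"

lemma T_simps [simp]:
  "cell0 T = u0 ` cell0 A" "cell1 T = u1 ` cell1 A" "cell2 T = u2 ` cell2 A"
  "f \<in> cell1 A \<Longrightarrow> src1 T (u1 f) = u0 (src1 A f)"
  "f \<in> cell1 A \<Longrightarrow> tgt1 T (u1 f) = u0 (tgt1 A f)"
  "\<alpha> \<in> cell2 A \<Longrightarrow> src2 T (u2 \<alpha>) = u1 (src2 A \<alpha>)"
  "\<alpha> \<in> cell2 A \<Longrightarrow> tgt2 T (u2 \<alpha>) = u1 (tgt2 A \<alpha>)"
  "a \<in> cell0 A \<Longrightarrow> id1 T (u0 a) = u1 (id1 A a)"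
  "f \<in> cell1 A \<Longrightarrow> g \<in> cell1 A \<Longrightarrow> comp1 T (u1 f) (u1 g) = u1 (comp1 A f g)"
  "f \<in> cell1 A \<Longrightarrow> id2 T (u1 f) = u2 (id2 A f)"
  "\<alpha> \<in> cell2 A \<Longrightarrow> \<beta> \<in> cell2 A \<Longrightarrow> vcomp T (u2 \<alpha>) (u2 \<beta>) = u2 (vcomp A \<alpha> \<beta>)"
  "\<alpha> \<in> cell2 A \<Longrightarrow> \<beta> \<in> cell2 A \<Longrightarrow> hcomp T (u2 \<alpha>) (u2 \<beta>) = u2 (hcomp A \<alpha> \<beta>)"
  by (simp_all add: transport_def)

lemmas closed [simp] = A.src1_closed A.tgt1_closed A.src2_closed A.tgt2_closed

lemma u_eq_iff [simp]:
  "a \<in> cell0 A \<Longrightarrow> b \<in> cell0 A \<Longrightarrow> u0 a = u0 b \<longleftrightarrow> a = b"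
  "f \<in> cell1 A \<Longrightarrow> g \<in> cell1 A \<Longrightarrow> u1 f = u1 g \<longleftrightarrow> f = g"
  "\<alpha> \<in> cell2 A \<Longrightarrow> \<beta> \<in> cell2 A \<Longrightarrow> u2 \<alpha> = u2 \<beta> \<longleftrightarrow> \<alpha> = \<beta>"
  by (metis inverse)+

lemma strict_2_category_T: "strict_2_category T"
proof unfold_locales
  fix x assume "x \<in> cell2 T"
  then show "src1 T (src2 T x) = src1 T (tgt2 T x)" "tgt1 T (src2 T x) = tgt1 T (tgt2 T x)"
    using A.src_globular A.tgt_globular by auto
next
  fix x y z w p p' p'' q q' q''
  assume *: "x \<in> hom2 T p' p''" "y \<in> hom2 T p p'" "z \<in> hom2 T q' q''" "w \<in> hom2 T q q'"
    "src1 T p = tgt1 T q"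
  then obtain \<alpha> \<beta> \<gamma> \<delta> where cells: "\<alpha> \<in> cell2 A" "\<beta> \<in> cell2 A" "\<gamma> \<in> cell2 A" "\<delta> \<in> cell2 A"
    and [simp]: "x = u2 \<alpha>" "y = u2 \<beta>" "z = u2 \<gamma>" "w = u2 \<delta>"
    by (auto simp: hom2_def)
  have "src2 A \<alpha> = tgt2 A \<beta>" "src2 A \<gamma> = tgt2 A \<delta>" "src1 A (src2 A \<beta>) = tgt1 A (src2 A \<delta>)"
    using * cells by (auto simp: hom2_def)
  moreover from this have "src1 A (src2 A \<alpha>) = tgt1 A (src2 A \<gamma>)"
    using cells A.src_globular[of \<beta>] A.tgt_globular[of \<delta>] by simp
  ultimately show "hcomp T (vcomp T x y) (vcomp T z w) = vcomp T (hcomp T x z) (hcomp T y w)"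
    using cells by (simp add: A.interchange')
qed (auto simp: hom1_def hom2_def)

definition to_T where
  "to_T = \<lparr>map0 = restrict u0 (cell0 A), map1 = restrict u1 (cell1 A), map2 = restrict u2 (cell2 A)\<rparr>"

definition from_T where
  "from_T = \<lparr>map0 = restrict v0 (cell0 T), map1 = restrict v1 (cell1 T), map2 = restrict v2 (cell2 T)\<rparr>"

lemma to_T_simps [simp]: "a \<in> cell0 A \<Longrightarrow> map0 to_T a = u0 a" "f \<in> cell1 A \<Longrightarrow> map1 to_T f = u1 f"
  "\<alpha> \<in> cell2 A \<Longrightarrow> map2 to_T \<alpha> = u2 \<alpha>"
  by (simp_all add: to_T_def)

lemma from_T_simps [simp]: "a \<in> cell0 A \<Longrightarrow> map0 from_T (u0 a) = a" "f \<in> cell1 A \<Longrightarrow> map1 from_T (u1 f) = f"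
  "\<alpha> \<in> cell2 A \<Longrightarrow> map2 from_T (u2 \<alpha>) = \<alpha>"
  by (simp_all add: from_T_def)

lemma to_T: "strict_2_functor A T to_T"
  by (intro strict_2_functorI A.strict_2_category_axioms strict_2_category_T)
    (auto simp: strict_2_functors_def to_T_def)

lemma from_T: "strict_2_functor T A from_T"
  by (intro strict_2_functorI A.strict_2_category_axioms strict_2_category_T)
    (auto simp: strict_2_functors_def from_T_def)

end

lemma bij_betw_precompose:
  assumes U: "strict_2_functor A T U" and V: "strict_2_functor T A V" and B: "strict_2_category B"
    and VU: "\<And>a. a \<in> cell0 A \<Longrightarrow> map0 V (map0 U a) = a" "\<And>f. f \<in> cell1 A \<Longrightarrow> map1 V (map1 U f) = f"
      "\<And>\<alpha>. \<alpha> \<in> cell2 A \<Longrightarrow> map2 V (map2 U \<alpha>) = \<alpha>"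
    and UV: "\<And>a. a \<in> cell0 T \<Longrightarrow> map0 U (map0 V a) = a" "\<And>f. f \<in> cell1 T \<Longrightarrow> map1 U (map1 V f) = f"
      "\<And>\<alpha>. \<alpha> \<in> cell2 T \<Longrightarrow> map2 U (map2 V \<alpha>) = \<alpha>"
  shows "bij_betw (\<lambda>D. compose A D U) (strict_2_functors T B) (strict_2_functors A B)"
proof -
  interpret U: strict_2_functor A T U by fact
  interpret V: strict_2_functor T A V by fact
  have 1: "compose A D U \<in> strict_2_functors A B" if "D \<in> strict_2_functors T B" for D
    using compose_functor[OF U strict_2_functorI[OF _ B that]] U.B.strict_2_category_axioms
    by (simp add: strict_2_functor_def strict_2_functor_axioms_def)
  have 2: "compose T D V \<in> strict_2_functors T B" if "D \<in> strict_2_functors A B" for D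
    using compose_functor[OF V strict_2_functorI[OF _ B that]] U.A.strict_2_category_axioms
    by (simp add: strict_2_functor_def strict_2_functor_axioms_def)
  show ?thesis
  proof (rule bij_betw_byWitness[where f' = "\<lambda>D. compose T D V"])
    show "\<forall>D\<in>strict_2_functors T B. compose T (compose A D U) V = D"
      by (intro ballI functor_eqI[OF 2[OF 1]]) (simp_all add: UV)
    show "\<forall>D\<in>strict_2_functors A B. compose A (compose T D V) U = D"
      by (intro ballI functor_eqI[OF 1[OF 2]]) (simp_all add: VU)
  qed (use 1 2 in auto)
qed

lemma bij_betw_postcompose:
  assumes U: "strict_2_functor A T U" and V: "strict_2_functor T A V" and B: "strict_2_category B"
    and VU: "\<And>a. a \<in> cell0 A \<Longrightarrow> map0 V (map0 U a) = a" "\<And>f. f \<in> cell1 A \<Longrightarrow> map1 V (map1 U f) = f"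
      "\<And>\<alpha>. \<alpha> \<in> cell2 A \<Longrightarrow> map2 V (map2 U \<alpha>) = \<alpha>"
    and UV: "\<And>a. a \<in> cell0 T \<Longrightarrow> map0 U (map0 V a) = a" "\<And>f. f \<in> cell1 T \<Longrightarrow> map1 U (map1 V f) = f"
      "\<And>\<alpha>. \<alpha> \<in> cell2 T \<Longrightarrow> map2 U (map2 V \<alpha>) = \<alpha>"
  shows "bij_betw (compose B U) (strict_2_functors B A) (strict_2_functors B T)"
proof -
  interpret U: strict_2_functor A T U by fact
  interpret V: strict_2_functor T A V by fact
  note cats = U.B.strict_2_category_axioms U.A.strict_2_category_axioms
  have 1: "compose B U D \<in> strict_2_functors B T" if "D \<in> strict_2_functors B A" for D
    using compose_functor[OF strict_2_functorI[OF B cats(2) that] U]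
    by (simp add: strict_2_functor_def strict_2_functor_axioms_def)
  have 2: "compose B V D \<in> strict_2_functors B A" if "D \<in> strict_2_functors B T" for D
    using compose_functor[OF strict_2_functorI[OF B cats(1) that] V]
    by (simp add: strict_2_functor_def strict_2_functor_axioms_def)
  note fA = strict_2_functorI[OF B cats(2)] and fT = strict_2_functorI[OF B cats(1)]
  show ?thesis
  proof (rule bij_betw_byWitness[where f' = "compose B V"])
    show "\<forall>D\<in>strict_2_functors B A. compose B V (compose B U D) = D"
      by (intro ballI functor_eqI[OF 2[OF 1]])
        (simp_all add: VU strict_2_functor.map0[OF fA] strict_2_functor.map1(1)[OF fA]
          strict_2_functor.map2(1)[OF fA])
    show "\<forall>D\<in>strict_2_functors B T. compose B U (compose B V D) = D"
      by (intro ballI functor_eqI[OF 1[OF 2]])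
        (simp_all add: UV strict_2_functor.map0[OF fT] strict_2_functor.map1(1)[OF fT]
          strict_2_functor.map2(1)[OF fT])
  qed (use 1 2 in auto)
qed

section \<open>The iterates of the monad construction\<close>

instance expr1 :: (countable, countable, countable, countable) countable
  by countable_datatype

instance expr2 :: (countable, countable, countable, countable, countable, countable) countable
  by countable_datatype

lemma numbered_transport: "numbered C = transport (num0 C) (num1 C) (num2 C)
    (inv_into (cell0 C) (num0 C)) (inv_into (cell1 C) (num1 C)) (inv_into (cell2 C) (num2 C)) C"
  by (simp add: numbered_def transport_def Let_def)

abbreviation numbering :: "('o, 'm, 'c) two_cat \<Rightarrow> bool" where
  "numbering C \<equiv> transported C (num0 C) (num1 C) (num2 C)
    (inv_into (cell0 C) (num0 C)) (inv_into (cell1 C) (num1 C)) (inv_into (cell2 C) (num2 C))"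

lemma numbering:
  assumes "strict_2_category C" "countable (cell0 C)" "countable (cell1 C)" "countable (cell2 C)"
  shows "numbering C"
proof -
  interpret strict_2_category C by fact
  show ?thesis
    using assms by unfold_locales (simp_all add: num0_def num1_def num2_def inj_on_to_nat_on)
qed

lemma strict_2_category_terminal: "strict_2_category terminal_2cat"
  by unfold_locales (simp_all add: terminal_2cat_def hom1_def hom2_def)

lemma strict_2_category_mnd:
  assumes "strict_2_category C"
  shows "strict_2_category (mnd C)"
  unfolding mnd_def
  by (intro gray_product.strict_2_category_gray gray_product.intro assms strict_2_category_deloop)

text \<open>There are only countably many formal composites, so renaming them to natural numbers is
  injective and yields an isomorphic 2-category.\<close>

lemma countable_mnd:
  fixes C :: "('o::countable, 'm::countable, 'c::countable) two_cat"
  shows "countable (cell0 (mnd C))" "countable (cell1 (mnd C))" "countable (cell2 (mnd C))"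
  by (simp_all add: mnd_def gray_data.gray_def)

lemma numbering_mnd:
  fixes C :: "('o::countable, 'm::countable, 'c::countable) two_cat"
  shows "strict_2_category C \<Longrightarrow> numbering (mnd C)"
  by (intro numbering strict_2_category_mnd countable_mnd)

lemma numbering_terminal: "numbering terminal_2cat"
  by (intro numbering strict_2_category_terminal) simp_all

lemma mnd_power_terminal_0: "mnd_power_terminal 0 = numbered terminal_2cat"
  by (simp add: mnd_power_terminal_def mnd_power_def)

lemma mnd_power_terminal_Suc: "mnd_power_terminal (Suc n) = numbered (mnd (mnd_power_terminal n))"
  by (simp add: mnd_power_terminal_def mnd_power_def)

lemma strict_2_category_mnd_power: "strict_2_category (mnd_power_terminal n)"
proof (induction n)
  case 0
  show ?case
    unfolding mnd_power_terminal_0 numbered_transport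
    by (rule transported.strict_2_category_T[OF numbering_terminal])
next
  case (Suc n)
  show ?case
    unfolding mnd_power_terminal_Suc numbered_transport[of "mnd _"]
    by (rule transported.strict_2_category_T[OF numbering_mnd[OF Suc]])
qed

locale iterate =
  fixes n :: nat
begin

abbreviation "P \<equiv> mnd_power_terminal n"

sublocale gray_product P deloop_simplex
  by (intro gray_product.intro strict_2_category_mnd_power strict_2_category_deloop)

sublocale num: transported gray "num0 gray" "num1 gray" "num2 gray"
    "inv_into (cell0 gray) (num0 gray)" "inv_into (cell1 gray) (num1 gray)"
    "inv_into (cell2 gray) (num2 gray)"
  using numbering_mnd[OF strict_2_category_mnd_power, of n] by (simp add: mnd_def)

lemma P_Suc: "mnd_power_terminal (Suc n) = num.T"
  by (simp add: mnd_power_terminal_Suc numbered_transport mnd_def)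

lemma base_Suc: "base (Suc n) = num0 gray (base n, ())"
  by (simp add: Let_def mnd_def)

lemma copy1_Suc: "copy1 (Suc n) i f =
    num1 gray (cls1 (if i = Suc n then Right1 (base n) f else Left1 (copy1 n i f) ()))"
  by (simp add: Let_def mnd_def)

lemma copy2_Suc: "copy2 (Suc n) i \<phi> =
    num2 gray (cls2 (if i = Suc n then Right2 (base n) \<phi> else Left2 (copy2 n i \<phi>) ()))"
  by (simp add: Let_def mnd_def)

lemma swap_Suc: "swap (Suc n) i j f g =
    num2 gray (cls2 (if j = Suc n then Swap (copy1 n i f) g else Left2 (swap n i j f g) ()))"
  by (simp add: Let_def mnd_def)

end

lemma mnd_power_terminal_0_cells:
  "cell0 (mnd_power_terminal 0) = {base 0}"
  "cell1 (mnd_power_terminal 0) = {id1 (mnd_power_terminal 0) (base 0)}"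
  "cell2 (mnd_power_terminal 0) = {id2 (mnd_power_terminal 0) (id1 (mnd_power_terminal 0) (base 0))}"
proof -
  interpret transported terminal_2cat "num0 terminal_2cat" "num1 terminal_2cat" "num2 terminal_2cat"
    "inv_into (cell0 terminal_2cat) (num0 terminal_2cat)" "inv_into (cell1 terminal_2cat) (num1 terminal_2cat)"
    "inv_into (cell2 terminal_2cat) (num2 terminal_2cat)"
    by (rule numbering_terminal)
  have T: "mnd_power_terminal 0 = T" by (simp add: mnd_power_terminal_0 numbered_transport)
  have cells: "cell0 terminal_2cat = {()}" "cell1 terminal_2cat = {()}" "cell2 terminal_2cat = {()}"
    and ops: "id1 terminal_2cat () = ()" "id2 terminal_2cat () = ()"
    by (auto simp: terminal_2cat_def)
  then have units: "() \<in> cell0 terminal_2cat" "() \<in> cell1 terminal_2cat" by simp_all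
  have base: "base 0 = num0 terminal_2cat ()" by simp
  have id1: "id1 T (base 0) = num1 terminal_2cat ()"
    unfolding base T_simps(8)[OF units(1)] ops(1) by (rule refl)
  show "cell0 (mnd_power_terminal 0) = {base 0}"
    unfolding T T_simps(1) base by (simp only: cells image_insert image_empty)
  show "cell1 (mnd_power_terminal 0) = {id1 (mnd_power_terminal 0) (base 0)}"
    unfolding T T_simps(2) id1 by (simp only: cells image_insert image_empty)
  show "cell2 (mnd_power_terminal 0) = {id2 (mnd_power_terminal 0) (id1 (mnd_power_terminal 0) (base 0))}"
    unfolding T T_simps(3) id1 T_simps(10)[OF units(2)] ops(2)
      by (simp only: cells image_insert image_empty)
qed

lemma base_closed [simp]: "base n \<in> cell0 (mnd_power_terminal n)"
proof (induction n)
  case 0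
  show ?case using mnd_power_terminal_0_cells(1) by blast
next
  case (Suc n)
  interpret iterate n .
  show ?case using Suc by (simp only: P_Suc base_Suc num.T_simps) (simp add: gray_cells)
qed

lemma copy1_closed [simp]:
  assumes "1 \<le> i" "i \<le> n"
  shows "copy1 n i f \<in> cell1 (mnd_power_terminal n)"
  using assms
proof (induction n)
  case (Suc n)
  interpret iterate n .
  from Suc show ?case by (cases "i = Suc n") (simp_all only: P_Suc copy1_Suc num.T_simps, simp_all)
qed simp

lemma copy2_closed [simp]:
  assumes "1 \<le> i" "i \<le> n" "\<phi> \<in> cell2 deloop_simplex"
  shows "copy2 n i \<phi> \<in> cell2 (mnd_power_terminal n)"
  using assms
proof (induction n)
  case (Suc n)
  interpret iterate n .
  from Suc show ?case by (cases "i = Suc n") (simp_all only: P_Suc copy2_Suc num.T_simps, simp_all)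
qed simp

lemma swap_closed [simp]:
  assumes "1 \<le> i" "i < j" "j \<le> n"
  shows "swap n i j f g \<in> cell2 (mnd_power_terminal n)"
  using assms
proof (induction n)
  case (Suc n)
  interpret iterate n .
  from Suc show ?case by (cases "j = Suc n") (simp_all only: P_Suc swap_Suc num.T_simps, simp_all)
qed simp

section \<open>Distributive laws in the 2-category of monads\<close>

context
  fixes B :: "('o, 'm, 'c) tower" (structure)
  assumes B: "strict_2_category B"
begin

interpretation strict_2_category B by (rule B)
interpretation M: strict_2_category "monads B" by (rule strict_2_category_monads[OF B])

lemma monads_und0 [simp]:
  assumes "X \<in> cell0 (monads B)"
  shows "ob X \<in> cell0 B" "en X \<in> cell1 B" "src1 B (en X) = ob X" "tgt1 B (en X) = ob X"
  using assms B by simp_all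

lemma monads_und1 [simp]:
  assumes "F \<in> cell1 (monads B)"
  shows "und1 F \<in> cell1 B" "src1 B (und1 F) = ob (src1 (monads B) F)"
    "tgt1 B (und1 F) = ob (tgt1 (monads B) F)"
    "law F \<in> cell2 B" "src2 B (law F) = und1 F \<cdot> en (src1 (monads B) F)"
    "tgt2 B (law F) = en (tgt1 (monads B) F) \<cdot> und1 F"
  using assms B by simp_all

lemma monads_und2 [simp]:
  assumes "\<phi> \<in> cell2 (monads B)"
  shows "und2 \<phi> \<in> cell2 B" "src2 B (und2 \<phi>) = und1 (src2 (monads B) \<phi>)"
    "tgt2 B (und2 \<phi>) = und1 (tgt2 (monads B) \<phi>)"
  using assms B by simp_all

lemma monads_und_ops [simp]:
  "und1 (id1 (monads B) X) = \<one> (ob X)"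
  "law (id1 (monads B) X) = \<iota> (en X)"
  "und1 (comp1 (monads B) G F) = und1 G \<cdot> und1 F"
  "law (comp1 (monads B) G F) = (law G \<star> \<iota> (und1 F)) \<bullet> (\<iota> (und1 G) \<star> law F)"
  "und2 (id2 (monads B) F) = \<iota> (und1 F)"
  "und2 (vcomp (monads B) \<psi> \<phi>) = und2 \<psi> \<bullet> und2 \<phi>"
  "und2 (hcomp (monads B) \<psi> \<phi>) = und2 \<psi> \<star> und2 \<phi>"
  using B by simp_all

lemma monads_cel_eq_iff:
  assumes "\<phi> \<in> cell2 (monads B)" "\<psi> \<in> cell2 (monads B)"
    "src2 (monads B) \<phi> = src2 (monads B) \<psi>" "tgt2 (monads B) \<phi> = tgt2 (monads B) \<psi>"
  shows "\<phi> = \<psi> \<longleftrightarrow> und2 \<phi> = und2 \<psi>"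
  using assms monad_cel_eqI[OF B] unfolding monads_simps mem_Collect_eq by metis

lemma hom1_monads: "F \<in> hom1 (monads B) X Y \<longleftrightarrow> (\<exists>f \<sigma>. F = Opf X Y f \<sigma> \<and>
    X \<in> cell0 (monads B) \<and> Y \<in> cell0 (monads B) \<and>
    monad_opfunctor B (ob X) (en X) (unt X) (mlt X) (ob Y) (en Y) (unt Y) (mlt Y) f \<sigma>)"
    (is "?l \<longleftrightarrow> ?r")
proof
  assume ?l
  then have "monad_arr B F" and XY: "X = adom F" "Y = acod F" by (simp_all add: hom1_def)
  then show ?r unfolding XY monads_simps mem_Collect_eq by (metis monad_arr_def)
next
  assume ?r
  then show ?l by (elim exE) (simp add: hom1_def monad_arr_def)
qed

lemma hom2_monads: "\<phi> \<in> hom2 (monads B) F G \<longleftrightarrow> (\<exists>\<alpha>. \<phi> = Tra F G \<alpha> \<and>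
    F \<in> cell1 (monads B) \<and> G \<in> cell1 (monads B) \<and>
    src1 (monads B) F = src1 (monads B) G \<and> tgt1 (monads B) F = tgt1 (monads B) G \<and>
    \<alpha> \<in> hom2 B (und1 F) (und1 G) \<and>
    law G \<bullet> (\<alpha> \<star> \<iota> (en (src1 (monads B) F))) = (\<iota> (en (tgt1 (monads B) F)) \<star> \<alpha>) \<bullet> law F)"
    (is "?l \<longleftrightarrow> ?r")
proof
  assume ?l
  then have "monad_cel B \<phi>" and FG: "F = cdom \<phi>" "G = ccod \<phi>" by (simp_all add: hom2_def)
  then show ?r unfolding FG monads_simps mem_Collect_eq
    unfolding monad_cel_def by (intro exI[of _ "und2 \<phi>"]) blast
next
  assume ?r
  then show ?l
    unfolding hom2_def monads_simps mem_Collect_eq monad_cel_def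
      by (elim exE conjE) (hypsubst, unfold cel.sel, blast)
qed

declare monads_simps [simp del]

text \<open>Once all cells have the right types, an equation between 2-cells of \<open>monads B\<close> can be checked on
  the underlying 2-cells.\<close>

lemma monad_on_monads_iff:
  assumes X: "X \<in> cell0 (monads B)" and F: "F \<in> hom1 (monads B) X X"
    and E: "E \<in> hom2 (monads B) (id1 (monads B) X) F"
    and N: "N \<in> hom2 (monads B) (comp1 (monads B) F F) F"
  shows "monad_on (monads B) X F E N \<longleftrightarrow> monad_on B (ob X) (und1 F) (und2 E) (und2 N)"
proof -
  have *: "F \<in> cell1 (monads B)" "src1 (monads B) F = X" "tgt1 (monads B) F = X"
    "E \<in> cell2 (monads B)" "src2 (monads B) E = id1 (monads B) X" "tgt2 (monads B) E = F"
    "N \<in> cell2 (monads B)" "src2 (monads B) N = comp1 (monads B) F F" "tgt2 (monads B) N = F"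
    using F E N by (auto simp: hom1_def hom2_def)
  have "ob X \<in> cell0 B" "und1 F \<in> hom1 B (ob X) (ob X)" "und2 E \<in> hom2 B (\<one> (ob X)) (und1 F)"
    "und2 N \<in> hom2 B (und1 F \<cdot> und1 F) (und1 F)"
    using X * by (auto simp: hom1_def hom2_def)
  then show ?thesis
    using assms * by (simp add: monad_on_def monads_cel_eq_iff)
qed

lemma distributive_law_monads_iff:
  assumes F: "monad_on (monads B) X F E N" and G: "monad_on (monads B) X G E' N'"
    and S: "S \<in> hom2 (monads B) (comp1 (monads B) F G) (comp1 (monads B) G F)"
  shows "distributive_law (monads B) X F E N G E' N' S \<longleftrightarrow>
    distributive_law B (ob X) (und1 F) (und2 E) (und2 N) (und1 G) (und2 E') (und2 N') (und2 S)"
proof -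
  interpret F: monad_on "monads B" X F E N by fact
  interpret G: monad_on "monads B" X G E' N' by fact
  have *: "F \<in> cell1 (monads B)" "src1 (monads B) F = X" "tgt1 (monads B) F = X"
    "E \<in> cell2 (monads B)" "src2 (monads B) E = id1 (monads B) X" "tgt2 (monads B) E = F"
    "N \<in> cell2 (monads B)" "src2 (monads B) N = comp1 (monads B) F F" "tgt2 (monads B) N = F"
    "G \<in> cell1 (monads B)" "src1 (monads B) G = X" "tgt1 (monads B) G = X"
    "E' \<in> cell2 (monads B)" "src2 (monads B) E' = id1 (monads B) X" "tgt2 (monads B) E' = G"
    "N' \<in> cell2 (monads B)" "src2 (monads B) N' = comp1 (monads B) G G" "tgt2 (monads B) N' = G"
    "S \<in> cell2 (monads B)" "src2 (monads B) S = comp1 (monads B) F G" "tgt2 (monads B) S = comp1 (monads B) G F"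
    using S F.endo F.unit F.mult G.endo G.unit G.mult by (auto simp: hom1_def hom2_def)
  have "monad_on B (ob X) (und1 F) (und2 E) (und2 N)" "monad_on B (ob X) (und1 G) (und2 E') (und2 N')"
    using F G monad_on_monads_iff[OF F.object F.endo F.unit F.mult]
      monad_on_monads_iff[OF G.object G.endo G.unit G.mult] by simp_all
  moreover have "und2 S \<in> hom2 B (und1 F \<cdot> und1 G) (und1 G \<cdot> und1 F)"
    using * by (simp add: hom2_def)
  ultimately show ?thesis
    using F G S F.object *
      by (simp add: distributive_law_def distributive_law_axioms_def monads_cel_eq_iff)
qed

lemma yang_baxter_monads_iff:
  assumes "F i \<in> hom1 (monads B) X X" "F j \<in> hom1 (monads B) X X" "F k \<in> hom1 (monads B) X X"
    and "S (i, j) \<in> hom2 (monads B) (comp1 (monads B) (F i) (F j)) (comp1 (monads B) (F j) (F i))"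
    "S (i, k) \<in> hom2 (monads B) (comp1 (monads B) (F i) (F k)) (comp1 (monads B) (F k) (F i))"
    "S (j, k) \<in> hom2 (monads B) (comp1 (monads B) (F j) (F k)) (comp1 (monads B) (F k) (F j))"
    and eq: "t i = und1 (F i)" "t j = und1 (F j)" "t k = und1 (F k)"
      "\<sigma> (i, j) = und2 (S (i, j))" "\<sigma> (i, k) = und2 (S (i, k))" "\<sigma> (j, k) = und2 (S (j, k))"
  shows "yang_baxter (monads B) F S i j k \<longleftrightarrow> yang_baxter B t \<sigma> i j k"
  using assms(1-6) unfolding yang_baxter_def eq
  by (simp add: hom1_def hom2_def monads_cel_eq_iff)

text \<open>The axioms of a distributive law of \<open>f\<close> over the monad \<open>X\<close> are the conditions for \<open>f\<close>, \<open>\<eta>\<close> and \<open>\<mu>\<close>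
  to be cells of \<open>monads B\<close>.\<close>

lemma monad_on_monads_typing:
  assumes X: "X \<in> cell0 (monads B)" and F: "F = Opf X X f \<sigma>"
  shows "F \<in> hom1 (monads B) X X \<and> Tra (id1 (monads B) X) F \<eta> \<in> hom2 (monads B) (id1 (monads B) X) F \<and>
      Tra (comp1 (monads B) F F) F \<mu> \<in> hom2 (monads B) (comp1 (monads B) F F) F \<and>
      monad_on B (ob X) f \<eta> \<mu> \<longleftrightarrow>
    distributive_law B (ob X) f \<eta> \<mu> (en X) (unt X) (mlt X) \<sigma>" (is "?l \<longleftrightarrow> ?r")
proof -
  have M: "monad_in B (ob X) (en X) (unt X) (mlt X)"
    using X monad_objD[OF B] by (simp add: monads_simps)
  interpret M: monad_in B "ob X" "en X" "unt X" "mlt X" by (rule M)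
  have [simp]: "und1 F = f" "law F = \<sigma>" by (simp_all add: F)
  show ?thesis
  proof
    assume ?l
    then have F0: "F \<in> hom1 (monads B) X X" by blast
    then have F1: "F \<in> cell1 (monads B)" "src1 (monads B) F = X" "tgt1 (monads B) F = X"
      by (simp_all add: hom1_def)
    have o: "monad_opfunctor B (ob X) (en X) (unt X) (mlt X) (ob X) (en X) (unt X) (mlt X) f \<sigma>"
      using F0 unfolding hom1_monads by (simp add: F)
    interpret o: monad_opfunctor B "ob X" "en X" "unt X" "mlt X" "ob X" "en X" "unt X" "mlt X" f \<sigma>
      by (rule o)
    interpret T: monad_on B "ob X" f \<eta> \<mu> using \<open>?l\<close> by blast
    have e: "\<eta> \<in> cell2 B" "src2 B \<eta> = \<one> (ob X)" "tgt2 B \<eta> = f"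
      "\<mu> \<in> cell2 B" "src2 B \<mu> = f \<cdot> f" "tgt2 B \<mu> = f"
      using T.unit T.mult by (auto simp: hom2_def)
    have "\<sigma> \<bullet> (\<eta> \<star> \<iota> (en X)) = (\<iota> (en X) \<star> \<eta>) \<bullet> \<iota> (en X)"
      "\<sigma> \<bullet> (\<mu> \<star> \<iota> (en X)) = (\<iota> (en X) \<star> \<mu>) \<bullet> ((\<sigma> \<star> \<iota> f) \<bullet> (\<iota> f \<star> \<sigma>))"
      using \<open>?l\<close> X F1 unfolding hom2_monads by simp_all
    then show ?r
      using o.law o.law_unit o.law_mult e X
      by (intro distributive_law.intro distributive_law_axioms.intro T.monad_on_axioms M.monad_on_axioms)
        simp_all
  next
    assume ?r
    then interpret D: distributive_law B "ob X" f \<eta> \<mu> "en X" "unt X" "mlt X" \<sigma> .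
    have e: "f \<in> cell1 B" "src1 B f = ob X" "tgt1 B f = ob X"
      "\<eta> \<in> cell2 B" "src2 B \<eta> = \<one> (ob X)" "tgt2 B \<eta> = f"
      "\<mu> \<in> cell2 B" "src2 B \<mu> = f \<cdot> f" "tgt2 B \<mu> = f"
      "\<sigma> \<in> cell2 B" "src2 B \<sigma> = f \<cdot> en X" "tgt2 B \<sigma> = en X \<cdot> f"
      using D.S.endo D.S.unit D.S.mult D.cell by (auto simp: hom1_def hom2_def)
    have "monad_opfunctor B (ob X) (en X) (unt X) (mlt X) (ob X) (en X) (unt X) (mlt X) f \<sigma>"
      using D.S.endo D.cell D.unit_t D.mult_t
        by (intro monad_opfunctor.intro monad_opfunctor_axioms.intro M B)
    then have F1: "F \<in> hom1 (monads B) X X" using X by (auto simp: hom1_monads F)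
    then have F2: "F \<in> cell1 (monads B)" "src1 (monads B) F = X" "tgt1 (monads B) F = X"
      by (auto simp: hom1_def)
    have "\<sigma> \<bullet> (\<eta> \<star> \<iota> (en X)) = (\<iota> (en X) \<star> \<eta>) \<bullet> \<iota> (en X)"
      "\<sigma> \<bullet> (\<mu> \<star> \<iota> (en X)) = (\<iota> (en X) \<star> \<mu>) \<bullet> ((\<sigma> \<star> \<iota> f) \<bullet> (\<iota> f \<star> \<sigma>))"
      using D.unit_s D.mult_s e X by simp_all
    then show ?l
      using F1 F2 X D.S.monad_on_axioms D.S.unit D.S.mult by (simp add: hom2_monads)
  qed
qed

text \<open>The equation is the Yang-Baxter equation for \<open>\<tau>\<close> and the laws of \<open>F\<close> and \<open>G\<close> over \<open>X\<close>.\<close>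

lemma swap_monads_typing:
  assumes "F \<in> hom1 (monads B) X X" "G \<in> hom1 (monads B) X X"
  shows "Tra (comp1 (monads B) F G) (comp1 (monads B) G F) \<tau> \<in>
      hom2 (monads B) (comp1 (monads B) F G) (comp1 (monads B) G F) \<longleftrightarrow>
    \<tau> \<in> hom2 B (und1 F \<cdot> und1 G) (und1 G \<cdot> und1 F) \<and>
    (\<iota> (en X) \<star> \<tau>) \<bullet> (law F \<star> \<iota> (und1 G)) \<bullet> (\<iota> (und1 F) \<star> law G) =
    (law G \<star> \<iota> (und1 F)) \<bullet> (\<iota> (und1 G) \<star> law F) \<bullet> (\<tau> \<star> \<iota> (en X))"
proof -
  have *: "F \<in> cell1 (monads B)" "src1 (monads B) F = X" "tgt1 (monads B) F = X"
    "G \<in> cell1 (monads B)" "src1 (monads B) G = X" "tgt1 (monads B) G = X"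
    "X \<in> cell0 (monads B)"
    using assms M.src1_closed by (auto simp: hom1_def)
  show ?thesis
    using * by (auto simp: hom2_monads) (auto simp: hom2_def)
qed

end

section \<open>Combining data in the 2-category of monads with the base monad\<close>

type_synonym ('o, 'm, 'c) law_data = "'o \<times> (nat \<Rightarrow> 'm) \<times> (nat \<Rightarrow> 'c) \<times> (nat \<Rightarrow> 'c) \<times> (nat \<times> nat \<Rightarrow> 'c)"

type_synonym ('o, 'm, 'c) tower_data =
  "(('o, 'm, 'c) obj, ('o, 'm, 'c) arr, ('o, 'm, 'c) cel) law_data"

text \<open>The passage from \<open>n\<close>-fold laws in \<open>monads B\<close> to \<open>(n + 1)\<close>-fold laws in \<open>B\<close>. Only underlying cells
  are kept, since the sources and targets stored in cells of \<open>monads B\<close> can be recovered.\<close>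

definition flatten_data :: "nat \<Rightarrow> ('o, 'm, 'c) tower_data \<Rightarrow> ('o, 'm, 'c) tower_data" where
  "flatten_data n = (\<lambda>(X, F, E, N, S).
    (ob X,
     \<lambda>i\<in>{1..Suc n}. if i = Suc n then en X else und1 (F i),
     \<lambda>i\<in>{1..Suc n}. if i = Suc n then unt X else und2 (E i),
     \<lambda>i\<in>{1..Suc n}. if i = Suc n then mlt X else und2 (N i),
     \<lambda>(i, j)\<in>pairs_below (Suc n). if j = Suc n then law (F i) else und2 (S (i, j))))"

definition lift_data :: "nat \<Rightarrow> ('o, 'm, 'c) tower \<Rightarrow> ('o, 'm, 'c) tower_data \<Rightarrow> ('o, 'm, 'c) tower_data" where
  "lift_data n B = (\<lambda>(a, t, \<eta>, \<mu>, \<sigma>).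
    let X = Mon a (t (Suc n)) (\<eta> (Suc n)) (\<mu> (Suc n)); F = (\<lambda>i\<in>{1..n}. Opf X X (t i) (\<sigma> (i, Suc n)))
    in (X, F,
      \<lambda>i\<in>{1..n}. Tra (id1 (monads B) X) (F i) (\<eta> i),
      \<lambda>i\<in>{1..n}. Tra (comp1 (monads B) (F i) (F i)) (F i) (\<mu> i),
      \<lambda>(i, j)\<in>pairs_below n. Tra (comp1 (monads B) (F i) (F j)) (comp1 (monads B) (F j) (F i)) (\<sigma> (i, j))))"

text \<open>The sources and targets stored in the cells of \<open>monads B\<close> are the prescribed ones, without any
  equation being imposed. On such families \<open>flatten_data\<close> is injective, and both directions of the
  correspondence of axioms can be proved for the same family.\<close>

definition formal_data :: "nat \<Rightarrow> ('o, 'm, 'c) tower \<Rightarrow> ('o, 'm, 'c) tower_data \<Rightarrow> bool" where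
  "formal_data n B = (\<lambda>(X, F, E, N, S).
    X = Mon (ob X) (en X) (unt X) (mlt X) \<and>
    F \<in> extensional {1..n} \<and> E \<in> extensional {1..n} \<and> N \<in> extensional {1..n} \<and>
    S \<in> extensional (pairs_below n) \<and>
    (\<forall>i\<in>{1..n}. F i = Opf X X (und1 (F i)) (law (F i)) \<and>
      E i = Tra (id1 (monads B) X) (F i) (und2 (E i)) \<and>
      N i = Tra (comp1 (monads B) (F i) (F i)) (F i) (und2 (N i))) \<and>
    (\<forall>i j. (i, j) \<in> pairs_below n \<longrightarrow> S (i, j) =
      Tra (comp1 (monads B) (F i) (F j)) (comp1 (monads B) (F j) (F i)) (und2 (S (i, j)))))"

lemma formal_lift_data: "formal_data n B (lift_data n B y)"
  by (cases y) (auto simp: formal_data_def lift_data_def Let_def pairs_below_def)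

lemma flatten_lift_data:
  assumes "y \<in> dist_law_data (Suc n) B"
  shows "flatten_data n (lift_data n B y) = y"
proof -
  obtain a t \<eta> \<mu> \<sigma> where y: "y = (a, t, \<eta>, \<mu>, \<sigma>)" by (cases y)
  have ext: "t \<in> extensional {1..Suc n}" "\<eta> \<in> extensional {1..Suc n}" "\<mu> \<in> extensional {1..Suc n}"
    "\<sigma> \<in> extensional (pairs_below (Suc n))"
    using assms unfolding y dist_law_data_def by auto
  define X where "X = Mon a (t (Suc n)) (\<eta> (Suc n)) (\<mu> (Suc n))"
  define F where "F = (\<lambda>i\<in>{1..n}. Opf X X (t i) (\<sigma> (i, Suc n)))"
  define E where "E = (\<lambda>i\<in>{1..n}. Tra (id1 (monads B) X) (F i) (\<eta> i))"
  define N where "N = (\<lambda>i\<in>{1..n}. Tra (comp1 (monads B) (F i) (F i)) (F i) (\<mu> i))"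
  define S where "S = (\<lambda>(i, j)\<in>pairs_below n.
    Tra (comp1 (monads B) (F i) (F j)) (comp1 (monads B) (F j) (F i)) (\<sigma> (i, j)))"
  have lift: "lift_data n B y = (X, F, E, N, S)"
    by (simp only: y lift_data_def Let_def prod.case X_def F_def E_def N_def S_def)
  have "(\<lambda>i\<in>{1..Suc n}. if i = Suc n then en X else und1 (F i)) = t"
    by (rule extensionalityI[OF _ ext(1)]) (auto simp: X_def F_def)
  moreover have "(\<lambda>i\<in>{1..Suc n}. if i = Suc n then unt X else und2 (E i)) = \<eta>"
    by (rule extensionalityI[OF _ ext(2)]) (auto simp: X_def E_def)
  moreover have "(\<lambda>i\<in>{1..Suc n}. if i = Suc n then mlt X else und2 (N i)) = \<mu>"
    by (rule extensionalityI[OF _ ext(3)]) (auto simp: X_def N_def)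
  moreover have "(\<lambda>(i, j)\<in>pairs_below (Suc n). if j = Suc n then law (F i) else und2 (S (i, j))) = \<sigma>"
    by (rule extensionalityI[OF _ ext(4)]) (auto simp: F_def S_def pairs_below_def)
  moreover have "ob X = a" by (simp add: X_def)
  ultimately show ?thesis unfolding lift flatten_data_def prod.case by (simp only: y)
qed

lemma flatten_data_inj:
  assumes x: "formal_data n B x" and x': "formal_data n B x'" and eq: "flatten_data n x = flatten_data n x'"
  shows "x = x'"
proof -
  obtain X F E N S X' F' E' N' S' where xs: "x = (X, F, E, N, S)" "x' = (X', F', E', N', S')"
    by (metis prod_cases5)
  note f = x[unfolded xs formal_data_def prod.case] and f' = x'[unfolded xs formal_data_def prod.case]
  note e = eq[unfolded xs flatten_data_def prod.case prod.inject]
  have 1: "(if i = Suc n then en X else und1 (F i)) = (if i = Suc n then en X' else und1 (F' i))"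
    "(if i = Suc n then unt X else und2 (E i)) = (if i = Suc n then unt X' else und2 (E' i))"
    "(if i = Suc n then mlt X else und2 (N i)) = (if i = Suc n then mlt X' else und2 (N' i))"
    if "i \<in> {1..Suc n}" for i
    using e[THEN conjunct2, THEN conjunct1, THEN fun_cong, of i]
      e[THEN conjunct2, THEN conjunct2, THEN conjunct1, THEN fun_cong, of i]
      e[THEN conjunct2, THEN conjunct2, THEN conjunct2, THEN conjunct1, THEN fun_cong, of i] that
    by (simp_all only: restrict_apply' )
  have 2: "(if j = Suc n then law (F i) else und2 (S (i, j))) = (if j = Suc n then law (F' i) else und2 (S' (i, j)))"
    if "(i, j) \<in> pairs_below (Suc n)" for i j
    using e[THEN conjunct2, THEN conjunct2, THEN conjunct2, THEN conjunct2, THEN fun_cong, of "(i, j)"] that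
    by (simp only: restrict_apply' prod.case)
  have X: "X = X'"
    using 1[of "Suc n"] e f f' by (metis atLeastAtMost_iff le_add1 order_refl plus_1_eq_Suc)
  have F: "F i = F' i" if "i \<in> {1..n}" for i
    using 1(1)[of i] 2[of i "Suc n"] that f f' X by (fastforce simp: pairs_below_def)
  have E: "E i = E' i" and N: "N i = N' i" if "i \<in> {1..n}" for i
  proof -
    have "und2 (E i) = und2 (E' i)" "und2 (N i) = und2 (N' i)" using 1(2,3)[of i] that by auto
    then show "E i = E' i" "N i = N' i" using f f' that F[OF that] X by metis+
  qed
  have S: "S (i, j) = S' (i, j)" if "(i, j) \<in> pairs_below n" for i j
  proof -
    have "und2 (S (i, j)) = und2 (S' (i, j))"
      using 2[of i j] that by (auto simp: pairs_below_def)
    moreover have "F i = F' i" "F j = F' j" using F that by (auto simp: pairs_below_def)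
    ultimately show ?thesis using f f' that by metis
  qed
  have "F = F'" "E = E'" "N = N'" "S = S'"
    using f f' F E N S
      by (auto intro!: extensionalityI[of _ "{1..n}"] extensionalityI[of _ "pairs_below n"])
  then show ?thesis by (simp add: xs X)
qed

context
  fixes B :: "('o, 'm, 'c) tower" (structure)
  assumes B: "strict_2_category B"
begin

interpretation strict_2_category B by (rule B)
interpretation M: strict_2_category "monads B" by (rule strict_2_category_monads[OF B])

lemma monads_cell0_iff:
  "X = Mon (ob X) (en X) (unt X) (mlt X) \<Longrightarrow>
    X \<in> cell0 (monads B) \<longleftrightarrow> monad_on B (ob X) (en X) (unt X) (mlt X)"
  using B by (auto simp: monads_simps(1) monad_obj_def monad_in_def)

lemma formal_data_monads:
  assumes "x \<in> dist_law_data n (monads B)"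
  shows "formal_data n B x"
proof -
  obtain X F E N S where x: "x = (X, F, E, N, S)" by (metis prod_cases5)
  note d = assms[unfolded x dist_law_data_def mem_Collect_eq prod.case]
  have mon: "monad_on (monads B) X (F i) (E i) (N i)" if "i \<in> {1..n}" for i
    using d that by blast
  have dist: "distributive_law (monads B) X (F i) (E i) (N i) (F j) (E j) (N j) (S (i, j))"
    if "(i, j) \<in> pairs_below n" for i j
    using d that by (auto simp: pairs_below_def)
  have "X = Mon (ob X) (en X) (unt X) (mlt X)"
    using d unfolding monads_simps(1) monad_obj_def by blast
  moreover have "F i = Opf X X (und1 (F i)) (law (F i)) \<and>
      E i = Tra (id1 (monads B) X) (F i) (und2 (E i)) \<and>
      N i = Tra (comp1 (monads B) (F i) (F i)) (F i) (und2 (N i))" if "i \<in> {1..n}" for i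
    using monad_on.endo[OF mon[OF that]] monad_on.unit[OF mon[OF that]] monad_on.mult[OF mon[OF that]]
    unfolding hom1_monads[OF B] hom2_monads[OF B] by auto
  moreover have "S (i, j) =
      Tra (comp1 (monads B) (F i) (F j)) (comp1 (monads B) (F j) (F i)) (und2 (S (i, j)))"
    if "(i, j) \<in> pairs_below n" for i j
    using distributive_law.cell[OF dist[OF that]] unfolding hom2_monads[OF B] by auto
  ultimately show ?thesis using d unfolding x formal_data_def by blast
qed

lemma flatten_data_iff:
  assumes "formal_data n B x"
  shows "x \<in> dist_law_data n (monads B) \<longleftrightarrow> flatten_data n x \<in> dist_law_data (Suc n) B"
proof -
  obtain X F E N S where x: "x = (X, F, E, N, S)" by (metis prod_cases5)
  note f = assms[unfolded x formal_data_def prod.case]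
  define t where "t = (\<lambda>i\<in>{1..Suc n}. if i = Suc n then en X else und1 (F i))"
  define \<eta> where "\<eta> = (\<lambda>i\<in>{1..Suc n}. if i = Suc n then unt X else und2 (E i))"
  define \<mu> where "\<mu> = (\<lambda>i\<in>{1..Suc n}. if i = Suc n then mlt X else und2 (N i))"
  define \<sigma> where "\<sigma> = (\<lambda>(i, j)\<in>pairs_below (Suc n). if j = Suc n then law (F i) else und2 (S (i, j)))"
  have flat: "flatten_data n x = (ob X, t, \<eta>, \<mu>, \<sigma>)"
    by (simp only: x flatten_data_def t_def \<eta>_def \<mu>_def \<sigma>_def prod.case)
  have last: "t (Suc n) = en X" "\<eta> (Suc n) = unt X" "\<mu> (Suc n) = mlt X"
    by (simp_all add: t_def \<eta>_def \<mu>_def)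
  have at: "t i = und1 (F i)" "\<eta> i = und2 (E i)" "\<mu> i = und2 (N i)" "\<sigma> (i, Suc n) = law (F i)"
    if "1 \<le> i" "i \<le> n" for i
    using that by (simp_all add: t_def \<eta>_def \<mu>_def \<sigma>_def pairs_below_def)
  have \<sigma>: "\<sigma> (i, j) = und2 (S (i, j))" if "1 \<le> i" "i < j" "j \<le> n" for i j
    using that by (simp add: \<sigma>_def pairs_below_def)
  have ext: "t \<in> extensional {1..Suc n}" "\<eta> \<in> extensional {1..Suc n}" "\<mu> \<in> extensional {1..Suc n}"
    "\<sigma> \<in> extensional (pairs_below (Suc n))"
    by (simp_all add: t_def \<eta>_def \<mu>_def \<sigma>_def)
  have Xf: "X = Mon (ob X) (en X) (unt X) (mlt X)" using f by blast
  have Ff: "F i = Opf X X (und1 (F i)) (law (F i))"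
    and Ef: "E i = Tra (id1 (monads B) X) (F i) (und2 (E i))"
    and Nf: "N i = Tra (comp1 (monads B) (F i) (F i)) (F i) (und2 (N i))" if "1 \<le> i" "i \<le> n" for i
    using f that by auto
  have Sf: "S (i, j) = Tra (comp1 (monads B) (F i) (F j)) (comp1 (monads B) (F j) (F i)) (und2 (S (i, j)))"
    if "1 \<le> i" "i < j" "j \<le> n" for i j
    using f that unfolding pairs_below_def by blast
  have typing: "F i \<in> hom1 (monads B) X X \<and> E i \<in> hom2 (monads B) (id1 (monads B) X) (F i) \<and>
      N i \<in> hom2 (monads B) (comp1 (monads B) (F i) (F i)) (F i) \<and>
      monad_on B (ob X) (t i) (\<eta> i) (\<mu> i) \<longleftrightarrow>
    distributive_law B (ob X) (t i) (\<eta> i) (\<mu> i) (en X) (unt X) (mlt X) (\<sigma> (i, Suc n))"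
    if "1 \<le> i" "i \<le> n" "X \<in> cell0 (monads B)" for i
    using monad_on_monads_typing[OF B that(3) Ff[OF that(1,2)], of "und2 (E i)" "und2 (N i)"]
      Ef[OF that(1,2)] Nf[OF that(1,2)] at[OF that(1,2)] by simp
  have swaps: "S (i, j) \<in> hom2 (monads B) (comp1 (monads B) (F i) (F j)) (comp1 (monads B) (F j) (F i)) \<longleftrightarrow>
      \<sigma> (i, j) \<in> hom2 B (t i \<cdot> t j) (t j \<cdot> t i) \<and> yang_baxter B t \<sigma> i j (Suc n)"
    if "1 \<le> i" "i < j" "j \<le> n" "F i \<in> hom1 (monads B) X X" "F j \<in> hom1 (monads B) X X" for i j
    using swap_monads_typing[OF B that(4,5), of "und2 (S (i, j))"] Sf[OF that(1-3)] \<sigma>[OF that(1-3)]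
      at[of i] at[of j] that(1-3) by (simp add: yang_baxter_def last)
  show ?thesis
  proof
    assume "x \<in> dist_law_data n (monads B)"
    note d = this[unfolded x dist_law_data_def mem_Collect_eq prod.case]
    have X: "X \<in> cell0 (monads B)" using d by blast
    have mon: "monad_on (monads B) X (F i) (E i) (N i)" if "1 \<le> i" "i \<le> n" for i
      using d that by auto
    have dist: "distributive_law (monads B) X (F i) (E i) (N i) (F j) (E j) (N j) (S (i, j))"
      if "1 \<le> i" "i < j" "j \<le> n" for i j
      using d that by blast
    note hom = monad_on.endo[OF mon] monad_on.unit[OF mon] monad_on.mult[OF mon]
      and cell = distributive_law.cell[OF dist]
    have X': "monad_on B (ob X) (en X) (unt X) (mlt X)"
      using X monads_cell0_iff[OF Xf] by blast
    have mon': "monad_on B (ob X) (t i) (\<eta> i) (\<mu> i)" if "1 \<le> i" "i \<le> n" for i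
      using monad_on_monads_iff[OF B X hom[OF that]] mon[OF that] at[OF that] by simp
    have dist': "distributive_law B (ob X) (t i) (\<eta> i) (\<mu> i) (t j) (\<eta> j) (\<mu> j) (\<sigma> (i, j))"
      if "1 \<le> i" "i < j" "j \<le> Suc n" for i j
    proof (cases "j = Suc n")
      case True
      with that typing[of i] hom[of i] mon'[of i] X show ?thesis by (simp add: last)
    next
      case False
      with that have "j \<le> n" "i \<le> n" by simp_all
      with that show ?thesis
        using distributive_law_monads_iff[OF B mon mon cell, of i j] dist[of i j] at[of i] at[of j] \<sigma>[of i j]
        by simp
    qed
    have yb: "yang_baxter B t \<sigma> i j k" if "1 \<le> i" "i < j" "j < k" "k \<le> Suc n" for i j k
    proof (cases "k = Suc n")
      case True
      with that swaps[of i j] hom(1)[of i] hom(1)[of j] cell[of i j] show ?thesis by simp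
    next
      case False
      with that have "k \<le> n" "j \<le> n" "i \<le> n" "1 \<le> j" "1 \<le> k" "i < k" by simp_all
      moreover from this have "yang_baxter (monads B) F S i j k" using d that by blast
      ultimately show ?thesis
        using yang_baxter_monads_iff[OF B, of F i X j k S t \<sigma>, OF hom(1) hom(1) hom(1) cell cell cell] that at \<sigma>
          by simp
    qed
    have "monad_on B (ob X) (t i) (\<eta> i) (\<mu> i)" if "i \<in> {1..Suc n}" for i
      using that X' mon'[of i] by (cases "i = Suc n") (simp_all add: last)
    then show "flatten_data n x \<in> dist_law_data (Suc n) B"
      unfolding flat dist_law_data_def mem_Collect_eq prod.case
      using ext monad_on.object[OF X'] dist' yb by blast
  next
    assume "flatten_data n x \<in> dist_law_data (Suc n) B"
    note d = this[unfolded flat dist_law_data_def mem_Collect_eq prod.case]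
    have mon': "monad_on B (ob X) (t i) (\<eta> i) (\<mu> i)" if "1 \<le> i" "i \<le> Suc n" for i
      using d that by auto
    have dist': "distributive_law B (ob X) (t i) (\<eta> i) (\<mu> i) (t j) (\<eta> j) (\<mu> j) (\<sigma> (i, j))"
      if "1 \<le> i" "i < j" "j \<le> Suc n" for i j
      using d that by blast
    have yb: "yang_baxter B t \<sigma> i j k" if "1 \<le> i" "i < j" "j < k" "k \<le> Suc n" for i j k
      using d that by blast
    have X: "X \<in> cell0 (monads B)"
      using mon'[of "Suc n"] monads_cell0_iff[OF Xf] by (simp add: last)
    have hom: "F i \<in> hom1 (monads B) X X" "E i \<in> hom2 (monads B) (id1 (monads B) X) (F i)"
      "N i \<in> hom2 (monads B) (comp1 (monads B) (F i) (F i)) (F i)" if "1 \<le> i" "i \<le> n" for i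
      using typing[OF that X] dist'[of i "Suc n"] that by (simp_all add: last)
    have mon: "monad_on (monads B) X (F i) (E i) (N i)" if "1 \<le> i" "i \<le> n" for i
      using monad_on_monads_iff[OF B X hom[OF that]] mon'[of i] at[OF that] that by simp
    have cell: "S (i, j) \<in> hom2 (monads B) (comp1 (monads B) (F i) (F j)) (comp1 (monads B) (F j) (F i))"
      if "1 \<le> i" "i < j" "j \<le> n" for i j
      using swaps[OF that hom(1) hom(1)] that distributive_law.cell[OF dist'[of i j]] yb[of i j "Suc n"]
        by simp
    have dist: "distributive_law (monads B) X (F i) (E i) (N i) (F j) (E j) (N j) (S (i, j))"
      if "1 \<le> i" "i < j" "j \<le> n" for i j
      using distributive_law_monads_iff[OF B mon mon cell, of i j] dist'[of i j] at[of i] at[of j] \<sigma>[of i j] that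
      by simp
    have yb': "yang_baxter (monads B) F S i j k" if "1 \<le> i" "i < j" "j < k" "k \<le> n" for i j k
      using yang_baxter_monads_iff[OF B, of F i X j k S t \<sigma>, OF hom(1) hom(1) hom(1) cell cell cell]
        that at \<sigma> yb[of i j k]
      by simp
    have "monad_on (monads B) X (F i) (E i) (N i)" if "i \<in> {1..n}" for i
      using that mon by simp
    then show "x \<in> dist_law_data n (monads B)"
      unfolding x dist_law_data_def mem_Collect_eq prod.case
      using f X dist yb' by blast
  qed
qed

lemma bij_betw_flatten_data:
  "bij_betw (flatten_data n) (dist_law_data n (monads B)) (dist_law_data (Suc n) B)"
proof (rule bij_betw_imageI)
  show "inj_on (flatten_data n) (dist_law_data n (monads B))"
    using flatten_data_inj formal_data_monads by (meson inj_onI)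
  show "flatten_data n ` dist_law_data n (monads B) = dist_law_data (Suc n) B"
  proof
    show "flatten_data n ` dist_law_data n (monads B) \<subseteq> dist_law_data (Suc n) B"
      using flatten_data_iff formal_data_monads by blast
    show "dist_law_data (Suc n) B \<subseteq> flatten_data n ` dist_law_data n (monads B)"
    proof
      fix y assume y: "y \<in> dist_law_data (Suc n) B"
      note e = flatten_lift_data[OF y]
      then have "lift_data n B y \<in> dist_law_data n (monads B)"
        using flatten_data_iff[OF formal_lift_data] y by metis
      with e show "y \<in> flatten_data n ` dist_law_data n (monads B)" by (metis image_eqI)
    qed
  qed
qed

end

section \<open>Induction on the number of monads\<close>

lemma constant_functor:
  assumes A: "strict_2_category A" and B: "strict_2_category B" and a: "a \<in> cell0 B"
  shows "\<lparr>map0 = (\<lambda>_\<in>cell0 A. a), map1 = (\<lambda>_\<in>cell1 A. id1 B a), map2 = (\<lambda>_\<in>cell2 A. id2 B (id1 B a))\<rparr>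
    \<in> strict_2_functors A B"
proof -
  interpret A: strict_2_category A by (rule A)
  interpret B: strict_2_category B by (rule B)
  show ?thesis
    using a
      by (auto simp: strict_2_functors_def A.src1_closed A.tgt1_closed A.src2_closed A.tgt2_closed)
qed

lemma bij_betw_extract_0:
  assumes B: "strict_2_category B"
  shows "bij_betw (extract_data 0) (parametric_dist_laws 0 B) (dist_law_data 0 B)"
proof -
  let ?P = "mnd_power_terminal 0"
  let ?e = "\<lambda>a. (a, \<lambda>_. undefined, \<lambda>_. undefined, \<lambda>_. undefined, \<lambda>_. undefined)"
  have P: "strict_2_category ?P" by (rule strict_2_category_mnd_power)
  have pairs: "pairs_below 0 = {}" by (auto simp: pairs_below_def)
  \<comment> \<open>the families are extensional on empty index sets, hence constantly \<open>undefined\<close>\<close>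
  have data: "dist_law_data 0 B = ?e ` cell0 B"
    by (auto simp: dist_law_data_def pairs)
  have ext0: "extract_data 0 D = ?e (map0 D (base 0))"
    for D :: "(nat, nat, nat, 'a, 'b, 'c) two_fun"
    by (simp add: extract_data_def pairs restrict_def)
  show ?thesis
    unfolding parametric_dist_laws_def
  proof (rule bij_betwI')
    fix D D' assume D: "D \<in> strict_2_functors ?P B" "D' \<in> strict_2_functors ?P B"
    interpret D: strict_2_functor ?P B D by (rule strict_2_functorI[OF P B D(1)])
    interpret D': strict_2_functor ?P B D' by (rule strict_2_functorI[OF P B D(2)])
    have id: "id1 ?P (base 0) \<in> cell1 ?P" using D.A.cell1_id1 base_closed by blast
    have "D = D'" if "map0 D (base 0) = map0 D' (base 0)"
    proof (rule functor_eqI[OF D])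
      fix f assume "f \<in> cell1 ?P"
      then have "f = id1 ?P (base 0)" using mnd_power_terminal_0_cells by blast
      then show "map1 D f = map1 D' f"
        using D.map1_id[OF base_closed] D'.map1_id[OF base_closed] that by simp
    next
      fix \<alpha> assume "\<alpha> \<in> cell2 ?P"
      then have "\<alpha> = id2 ?P (id1 ?P (base 0))" using mnd_power_terminal_0_cells by blast
      then show "map2 D \<alpha> = map2 D' \<alpha>"
        using D.map1_id[OF base_closed] D'.map1_id[OF base_closed] D.map2_id[OF id] D'.map2_id[OF id] that
        by simp
    next
      fix a assume "a \<in> cell0 ?P"
      then have "a = base 0" using mnd_power_terminal_0_cells by blast
      then show "map0 D a = map0 D' a" by (simp only: that)
    qed
    then show "extract_data 0 D = extract_data 0 D' \<longleftrightarrow> D = D'" by (auto simp: ext0)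
  next
    fix D assume "D \<in> strict_2_functors ?P B"
    then interpret D: strict_2_functor ?P B D by (rule strict_2_functorI[OF P B])
    show "extract_data 0 D \<in> dist_law_data 0 B"
      using D.map0[OF base_closed] unfolding ext0 data by blast
  next
    fix y assume "y \<in> dist_law_data 0 B"
    then obtain a where a: "a \<in> cell0 B" "y = ?e a"
      unfolding data by blast
    show "\<exists>D\<in>strict_2_functors ?P B. y = extract_data 0 D"
      by (rule bexI[OF _ constant_functor[OF P B a(1)]]) (use base_closed[of 0] in \<open>simp add: ext0 a(2)\<close>)
  qed
qed

context iterate
begin

text \<open>The \<open>i\<close>-th copy for \<open>i \<le> n\<close> lies in the left-hand factor of the tensor product and is seen by the
  transpose; the last copy has become the structure of the monad that is the image of the object.\<close>

lemma extract_data_Suc: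
  assumes B: "strict_2_category B" and D: "D \<in> strict_2_functors (mnd_power_terminal (Suc n)) B"
  shows "extract_data (Suc n) D =
    flatten_data n (extract_data n (adjunct P (compose gray D num.to_T)))"
proof -
  let ?H = "compose gray D num.to_T"
  let ?K = "adjunct P ?H"
  have H: "map0 ?H (base n, ()) = map0 D (num0 gray (base n, ()))"
    "\<And>e. wf1 e \<Longrightarrow> map1 ?H (cls1 e) = map1 D (num1 gray (cls1 e))"
    "\<And>x. wf2 x \<Longrightarrow> map2 ?H (cls2 x) = map2 D (num2 gray (cls2 x))"
    by (simp_all add: gray_cells(1))
  have T0: "map0 ?K (base n) = transpose0 P ?H (base n)"
    by (simp add: adjunct_def)
  have T1: "map1 ?K (copy1 n i 1) = transpose1 P ?H (copy1 n i 1)" if "1 \<le> i" "i \<le> n" for i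
    using that by (simp add: adjunct_def)
  have T2: "map2 ?K (copy2 n i \<phi>) = transpose2 P ?H (copy2 n i \<phi>)"
    if "1 \<le> i" "i \<le> n" "\<phi> \<in> cell2 deloop_simplex" for i \<phi>
    using that by (simp add: adjunct_def)
  have T3: "map2 ?K (swap n i j 1 1) = transpose2 P ?H (swap n i j 1 1)"
    if "1 \<le> i" "i < j" "j \<le> n" for i j
    using that by (simp add: adjunct_def)
  have cells: "(1, []) \<in> cell2 deloop_simplex" "(1, [0, 0]) \<in> cell2 deloop_simplex"
    by (simp_all add: cell2_deloop)
  have 1: "map1 D (copy1 (Suc n) i 1) = (if i = Suc n then en (map0 ?K (base n))
      else und1 (map1 ?K (copy1 n i 1)))" if "i \<in> {1..Suc n}" for i
    using that by (cases "i = Suc n")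
      (simp_all add: copy1_Suc T0 T1 transpose0_def transpose1_def H del: copy1.simps One_nat_def)
  have 2: "map2 D (copy2 (Suc n) i (1, [])) = (if i = Suc n then unt (map0 ?K (base n))
      else und2 (map2 ?K (copy2 n i (1, []))))" if "i \<in> {1..Suc n}" for i
    using that cells by (cases "i = Suc n")
      (simp_all add: copy2_Suc T0 T2 transpose0_def transpose2_def H del: copy2.simps One_nat_def)
  have 3: "map2 D (copy2 (Suc n) i (1, [0, 0])) = (if i = Suc n then mlt (map0 ?K (base n))
      else und2 (map2 ?K (copy2 n i (1, [0, 0]))))" if "i \<in> {1..Suc n}" for i
    using that cells by (cases "i = Suc n")
      (simp_all add: copy2_Suc T0 T2 transpose0_def transpose2_def H del: copy2.simps One_nat_def)
  have 4: "map2 D (swap (Suc n) i j 1 1) = (if j = Suc n then law (map1 ?K (copy1 n i 1))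
      else und2 (map2 ?K (swap n i j 1 1)))" if "(i, j) \<in> pairs_below (Suc n)" for i j
    using that unfolding pairs_below_def by (cases "j = Suc n")
      (simp_all add: swap_Suc T1 T3 transpose1_def transpose2_def H del: swap.simps One_nat_def)
  have 5: "map0 D (base (Suc n)) = ob (map0 ?K (base n))"
    by (simp add: base_Suc T0 transpose0_def H del: base.simps)
  show ?thesis
    unfolding extract_data_def flatten_data_def prod.case
    by (intro arg_cong2[where f = Pair] 5 restrict_ext)
      (auto simp: 1 2 3 4 pairs_below_def simp del: copy1.simps copy2.simps swap.simps One_nat_def)
qed

end

lemma bij_betw_extract_tower:
  fixes B :: "('o, 'm, 'c) tower"
  assumes "strict_2_category B"
  shows "bij_betw (extract_data n) (parametric_dist_laws n B) (dist_law_data n B)"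
  using assms
proof (induction n arbitrary: B)
  case 0
  then show ?case by (rule bij_betw_extract_0)
next
  case (Suc n)
  interpret iterate n .
  have P: "strict_2_category P" by (rule strict_2_category_mnd_power)
  have mnd: "mnd P = gray" by (simp add: mnd_def)
  have "bij_betw (\<lambda>D. compose gray D num.to_T) (parametric_dist_laws (Suc n) B)
      (strict_2_functors (mnd P) B)"
    unfolding parametric_dist_laws_def P_Suc mnd
    by (rule bij_betw_precompose[OF num.to_T num.from_T Suc.prems]) auto
  moreover have "bij_betw (adjunct P) (strict_2_functors (mnd P) B) (parametric_dist_laws n (monads B))"
    unfolding parametric_dist_laws_def by (rule bij_betw_transpose[OF P Suc.prems])
  moreover have "bij_betw (extract_data n) (parametric_dist_laws n (monads B)) (dist_law_data n (monads B))"
    by (rule Suc.IH[OF strict_2_category_monads[OF Suc.prems]])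
  moreover have "bij_betw (flatten_data n) (dist_law_data n (monads B)) (dist_law_data (Suc n) B)"
    by (rule bij_betw_flatten_data[OF Suc.prems])
  ultimately have "bij_betw (flatten_data n \<circ> (extract_data n \<circ> (adjunct P \<circ> (\<lambda>D. compose gray D num.to_T))))
      (parametric_dist_laws (Suc n) B) (dist_law_data (Suc n) B)"
    by (intro bij_betw_trans)
  then show ?case
    by (rule bij_betw_cong[THEN iffD1, rotated])
      (simp add: extract_data_Suc[OF Suc.prems] parametric_dist_laws_def)
qed

section \<open>Arbitrary target 2-categories\<close>

text \<open>2-functors preserve distributive laws. This is applied to the isomorphism between a target and
  its copy in the types \<open>obj\<close>, \<open>arr\<close>, \<open>cel\<close>, and to its inverse.\<close>

definition push_data :: "nat \<Rightarrow> ('o, 'm, 'c, 'p, 'n, 'd) two_fun \<Rightarrow> ('o, 'm, 'c) law_data \<Rightarrow> ('p, 'n, 'd) law_data"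
  where "push_data n F = (\<lambda>(a, t, \<eta>, \<mu>, \<sigma>).
    (map0 F a, \<lambda>i\<in>{1..n}. map1 F (t i), \<lambda>i\<in>{1..n}. map2 F (\<eta> i), \<lambda>i\<in>{1..n}. map2 F (\<mu> i),
     \<lambda>p\<in>pairs_below n. map2 F (\<sigma> p)))"

context strict_2_functor
begin

lemma map_monad:
  assumes "monad_on A a t \<eta> \<mu>"
  shows "monad_on B (map0 F a) (map1 F t) (map2 F \<eta>) (map2 F \<mu>)"
proof -
  interpret monad_in A a t \<eta> \<mu> by (intro monad_in.intro A.strict_2_category_axioms assms)
  show ?thesis
    using unit_left[THEN arg_cong[of _ _ "map2 F"]] unit_right[THEN arg_cong[of _ _ "map2 F"]]
      assoc[THEN arg_cong[of _ _ "map2 F"]]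
    by unfold_locales (simp_all add: hom1_def hom2_def preserves)
qed

lemma map_distributive_law:
  assumes "distributive_law A a s \<eta> \<mu> t \<eta>' \<mu>' \<sigma>"
  shows "distributive_law B (map0 F a) (map1 F s) (map2 F \<eta>) (map2 F \<mu>)
    (map1 F t) (map2 F \<eta>') (map2 F \<mu>') (map2 F \<sigma>)"
proof -
  interpret D: distributive_law A a s \<eta> \<mu> t \<eta>' \<mu>' \<sigma> by fact
  interpret S: monad_in A a s \<eta> \<mu>
    by (intro monad_in.intro A.strict_2_category_axioms D.S.monad_on_axioms)
  interpret T: monad_in A a t \<eta>' \<mu>'
    by (intro monad_in.intro A.strict_2_category_axioms D.T.monad_on_axioms)
  have [simp]: "\<sigma> \<in> cell2 A" "src2 A \<sigma> = comp1 A s t" "tgt2 A \<sigma> = comp1 A t s"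
    using D.cell by (auto simp: hom2_def)
  show ?thesis
    using D.unit_s[THEN arg_cong[of _ _ "map2 F"]] D.unit_t[THEN arg_cong[of _ _ "map2 F"]]
      D.mult_s[THEN arg_cong[of _ _ "map2 F"]] D.mult_t[THEN arg_cong[of _ _ "map2 F"]]
    by (intro distributive_law.intro distributive_law_axioms.intro map_monad D.S.monad_on_axioms
        D.T.monad_on_axioms) (simp_all add: hom2_def preserves)
qed

lemma map_yang_baxter:
  assumes "yang_baxter A t \<sigma> i j k"
    and "t i \<in> hom1 A a a" "t j \<in> hom1 A a a" "t k \<in> hom1 A a a"
    and "\<sigma> (i, j) \<in> hom2 A (comp1 A (t i) (t j)) (comp1 A (t j) (t i))"
      "\<sigma> (i, k) \<in> hom2 A (comp1 A (t i) (t k)) (comp1 A (t k) (t i))"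
      "\<sigma> (j, k) \<in> hom2 A (comp1 A (t j) (t k)) (comp1 A (t k) (t j))"
    and eq: "t' i = map1 F (t i)" "t' j = map1 F (t j)" "t' k = map1 F (t k)"
      "\<sigma>' (i, j) = map2 F (\<sigma> (i, j))" "\<sigma>' (i, k) = map2 F (\<sigma> (i, k))" "\<sigma>' (j, k) = map2 F (\<sigma> (j, k))"
  shows "yang_baxter B t' \<sigma>' i j k"
  using arg_cong[OF assms(1)[unfolded yang_baxter_def], of "map2 F"] assms(2-7)
  unfolding yang_baxter_def eq by (simp add: hom1_def hom2_def preserves)

lemma push_data:
  assumes "x \<in> dist_law_data n A"
  shows "push_data n F x \<in> dist_law_data n B"
proof -
  obtain a t \<eta> \<mu> \<sigma> where x: "x = (a, t, \<eta>, \<mu>, \<sigma>)" by (metis prod_cases5)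
  note d = assms[unfolded x dist_law_data_def mem_Collect_eq prod.case]
  have a: "a \<in> cell0 A" using d by blast
  have mon: "monad_on A a (t i) (\<eta> i) (\<mu> i)" if "1 \<le> i" "i \<le> n" for i using d that by auto
  have dist: "distributive_law A a (t i) (\<eta> i) (\<mu> i) (t j) (\<eta> j) (\<mu> j) (\<sigma> (i, j))"
    if "1 \<le> i" "i < j" "j \<le> n" for i j using d that by blast
  have yb: "yang_baxter A t \<sigma> i j k" if "1 \<le> i" "i < j" "j < k" "k \<le> n" for i j k using d that by blast
  define t' where "t' = (\<lambda>i\<in>{1..n}. map1 F (t i))"
  define \<eta>' where "\<eta>' = (\<lambda>i\<in>{1..n}. map2 F (\<eta> i))"
  define \<mu>' where "\<mu>' = (\<lambda>i\<in>{1..n}. map2 F (\<mu> i))"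
  define \<sigma>' where "\<sigma>' = (\<lambda>p\<in>pairs_below n. map2 F (\<sigma> p))"
  have at: "t' i = map1 F (t i)" "\<eta>' i = map2 F (\<eta> i)" "\<mu>' i = map2 F (\<mu> i)" if "1 \<le> i" "i \<le> n" for i
    using that by (simp_all add: t'_def \<eta>'_def \<mu>'_def)
  have \<sigma>': "\<sigma>' (i, j) = map2 F (\<sigma> (i, j))" if "1 \<le> i" "i < j" "j \<le> n" for i j
    using that by (simp add: \<sigma>'_def pairs_below_def)
  have "monad_on B (map0 F a) (t' i) (\<eta>' i) (\<mu>' i)" if "i \<in> {1..n}" for i
    using that map_monad[OF mon] by (simp add: at)
  moreover have "distributive_law B (map0 F a) (t' i) (\<eta>' i) (\<mu>' i) (t' j) (\<eta>' j) (\<mu>' j) (\<sigma>' (i, j))"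
    if "1 \<le> i" "i < j" "j \<le> n" for i j
    using that map_distributive_law[OF dist[OF that]] by (simp add: at \<sigma>')
  moreover have "yang_baxter B t' \<sigma>' i j k" if "1 \<le> i" "i < j" "j < k" "k \<le> n" for i j k
    using map_yang_baxter[OF yb[OF that], where t' = t' and \<sigma>' = \<sigma>' and a = a] that
      monad_on.endo[OF mon] distributive_law.cell[OF dist] by (simp add: at \<sigma>')
  ultimately have "(map0 F a, t', \<eta>', \<mu>', \<sigma>') \<in> dist_law_data n B"
    unfolding dist_law_data_def mem_Collect_eq prod.case
    using a by (auto simp: t'_def \<eta>'_def \<mu>'_def \<sigma>'_def)
  then show ?thesis by (simp only: x push_data_def prod.case t'_def \<eta>'_def \<mu>'_def \<sigma>'_def)
qed

end

lemma dist_law_data_cells: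
  assumes "(a, t, \<eta>, \<mu>, \<sigma>) \<in> dist_law_data n B"
  shows "a \<in> cell0 B" "i \<in> {1..n} \<Longrightarrow> t i \<in> cell1 B" "i \<in> {1..n} \<Longrightarrow> \<eta> i \<in> cell2 B"
    "i \<in> {1..n} \<Longrightarrow> \<mu> i \<in> cell2 B" "p \<in> pairs_below n \<Longrightarrow> \<sigma> p \<in> cell2 B"
proof -
  note d = assms[unfolded dist_law_data_def mem_Collect_eq prod.case]
  show "a \<in> cell0 B" using d by blast
  show "i \<in> {1..n} \<Longrightarrow> t i \<in> cell1 B" "i \<in> {1..n} \<Longrightarrow> \<eta> i \<in> cell2 B" "i \<in> {1..n} \<Longrightarrow> \<mu> i \<in> cell2 B"
    using d monad_on.endo monad_on.unit monad_on.mult unfolding hom1_def hom2_def by fastforce+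
  show "p \<in> pairs_below n \<Longrightarrow> \<sigma> p \<in> cell2 B"
    using d distributive_law.cell unfolding hom2_def pairs_below_def by fastforce
qed

lemma push_data_inverse:
  assumes "x \<in> dist_law_data n A"
    and inv: "\<And>a. a \<in> cell0 A \<Longrightarrow> map0 V (map0 U a) = a" "\<And>f. f \<in> cell1 A \<Longrightarrow> map1 V (map1 U f) = f"
      "\<And>\<alpha>. \<alpha> \<in> cell2 A \<Longrightarrow> map2 V (map2 U \<alpha>) = \<alpha>"
  shows "push_data n V (push_data n U x) = x"
proof -
  obtain a t \<eta> \<mu> \<sigma> where x: "x = (a, t, \<eta>, \<mu>, \<sigma>)" by (metis prod_cases5)
  note c = dist_law_data_cells[OF assms(1)[unfolded x]]
  have ext: "t \<in> extensional {1..n}" "\<eta> \<in> extensional {1..n}" "\<mu> \<in> extensional {1..n}"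
      "\<sigma> \<in> extensional (pairs_below n)"
    using assms(1) unfolding x dist_law_data_def by auto
  have "map0 V (map0 U a) = a"
    "(\<lambda>i\<in>{1..n}. map1 V ((\<lambda>i\<in>{1..n}. map1 U (t i)) i)) = t"
    "(\<lambda>i\<in>{1..n}. map2 V ((\<lambda>i\<in>{1..n}. map2 U (\<eta> i)) i)) = \<eta>"
    "(\<lambda>i\<in>{1..n}. map2 V ((\<lambda>i\<in>{1..n}. map2 U (\<mu> i)) i)) = \<mu>"
    "(\<lambda>p\<in>pairs_below n. map2 V ((\<lambda>p\<in>pairs_below n. map2 U (\<sigma> p)) p)) = \<sigma>"
    by (simp add: inv c | rule extensionalityI[OF _ ext(1)] extensionalityI[OF _ ext(2)]
        extensionalityI[OF _ ext(3)] extensionalityI[OF _ ext(4)])+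
  then show ?thesis by (simp only: x push_data_def prod.case)
qed

lemma extract_data_compose:
  "extract_data n (compose (mnd_power_terminal n) G D) = push_data n G (extract_data n D)"
proof -
  have cells: "(1, []) \<in> cell2 deloop_simplex" "(1, [0, 0]) \<in> cell2 deloop_simplex"
    by (simp_all add: cell2_deloop)
  show ?thesis
    unfolding extract_data_def push_data_def prod.case
    using cells by (auto simp: pairs_below_def restrict_def fun_eq_iff)
qed

theorem mainTheorem3:
  fixes B :: "('o, 'm, 'c) two_cat" and n :: nat
  assumes "strict_2_category B" and "1 \<le> n"
  shows "bij_betw (extract_data n) (parametric_dist_laws n B) (dist_law_data n B)"
proof -
  interpret B: strict_2_category B by (rule assms(1))
  interpret transported B "Obj :: 'o \<Rightarrow> ('o, 'm, 'c) obj" "Arr :: 'm \<Rightarrow> ('o, 'm, 'c) arr"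
      "Cel :: 'c \<Rightarrow> ('o, 'm, 'c) cel" un_Obj un_Arr un_Cel
    by unfold_locales simp_all
  let ?P = "mnd_power_terminal n"
  have P: "strict_2_category ?P" by (rule strict_2_category_mnd_power)
  have "bij_betw (compose ?P to_T) (parametric_dist_laws n B) (parametric_dist_laws n T)"
    unfolding parametric_dist_laws_def by (rule bij_betw_postcompose[OF to_T from_T P]) auto
  moreover have "bij_betw (extract_data n) (parametric_dist_laws n T) (dist_law_data n T)"
    by (rule bij_betw_extract_tower[OF strict_2_category_T])
  moreover have "bij_betw (push_data n from_T) (dist_law_data n T) (dist_law_data n B)"
    by (rule bij_betw_byWitness[where f' = "push_data n to_T"])
      (auto intro!: push_data_inverse[of _ _ T] push_data_inverse[of _ _ B]
        strict_2_functor.push_data[OF to_T] strict_2_functor.push_data[OF from_T])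
  ultimately have "bij_betw (push_data n from_T \<circ> (extract_data n \<circ> compose ?P to_T))
      (parametric_dist_laws n B) (dist_law_data n B)"
    by (intro bij_betw_trans)
  moreover have "(push_data n from_T \<circ> (extract_data n \<circ> compose ?P to_T)) D = extract_data n D"
    if "D \<in> parametric_dist_laws n B" for D
  proof -
    interpret D: strict_2_functor ?P B D
      using that by (intro strict_2_functorI P assms(1)) (simp add: parametric_dist_laws_def)
    have "compose ?P from_T (compose ?P to_T D) \<in> strict_2_functors ?P B"
      using strict_2_functor.F[OF compose_functor[OF compose_functor[OF D.strict_2_functor_axioms to_T] from_T]] .
    then have "compose ?P from_T (compose ?P to_T D) = D"
      by (rule functor_eqI[OF _ D.F]) simp_all
    then show ?thesis by (metis comp_apply extract_data_compose)
  qed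
  ultimately show ?thesis by (simp cong: bij_betw_cong)
qed

end
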